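(* Let $\Gamma_{\operatorname{par}}$ be a tropical curve with parallel rays, let $f_1,\ldots,f_n\in\operatorname{Rat}(\Gamma_{\operatorname{par}})\setminus\{-\infty\}$, and let $\psi:\overline{\boldsymbol{T}(\boldsymbol{X})}_n\to\operatorname{Rat}(\Gamma_{\operatorname{par}})$ be the $\boldsymbol{T}$-algebra homomorphism induced by $X_i\mapsto f_i$. Then the subsemifield $\boldsymbol{T}(f_1,\ldots,f_n)$ over $\boldsymbol{T}$ of $\operatorname{Rat}(\Gamma_{\operatorname{par}})$ generated by $f_1,\ldots,f_n$ is isomorphic to $\overline{\boldsymbol{T}(\boldsymbol{X})}_n/\operatorname{Ker}(\psi)$ as a $\boldsymbol{T}$-algebra. Moreover, $\overline{\boldsymbol{T}(\boldsymbol{X})}_n/\operatorname{Ker}(\psi)$ is isomorphic as a $\boldsymbol{T}$-algebra to the rational function semifield of some tropical curve with parallel rays; equivalently, some (and any) surjective $\boldsymbol{T}$-algebra homomorphism $\chi$ from a tropical rational function semifield to it satisfies: (1) $\operatorname{Ker}(\chi)$ is finitely generated as a congruence, (2) $\operatorname{Ker}(\chi)=\boldsymbol{E}(\boldsymbol{V}(\operatorname{Ker}(\chi)))$, (3) $\boldsymbol{V}(\operatorname{Ker}(\chi))$ is connected, and (4) $\boldsymbol{V}(\operatorname{Ker}(\chi))$ is of dimension zero or one. Furthermore $\boldsymbol{V}(\operatorname{Ker}(\psi))$ coincides with the image $\operatorname{Im}(\theta)$ of the map $\theta:\Gamma_{\operatorname{par}}\setminus\Gamma_{\operatorname{par},\infty}\to\mathbb{R}^n$,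 $x\mapsto(f_1(x),\ldots,f_n(x))$.
   Context: **Algebra.** $\boldsymbol{T}=\mathbb{R}\cup\{-\infty\}$ with $a\oplus b=\max\{a,b\}$, $a\odot b=a+b$. Semirings are commutative with absorbing additive identity and multiplicative identity. A $\boldsymbol{T}$-algebra is a semiring with a semiring homomorphism from $\boldsymbol{T}$; $\boldsymbol{T}$-algebra homomorphisms are compatible with the structure maps. A semifield over $\boldsymbol{T}$ is a $\boldsymbol{T}$-algebra in which every nonzero element is invertible, $0\ne1$, and whose structure map is injective. $\boldsymbol{T}(f_1,\ldots,f_n)$ is the smallest subsemifield containing $\boldsymbol{T}$ and $f_1,\ldots,f_n$. **Congruences.** The tropical rational function semifield $\overline{\boldsymbol{T}(\boldsymbol{X})}_n$ consists of $-\infty$ and all functions $\mathbb{R}^n\to\mathbb{R}$ of the form $P-Q$, with $P,Q$ functions defined by tropical Laurent polynomials $\neq-\infty$ in $n$ variables (finite maxima of affine functions with integer slopes and real constants), with pointwise $\oplus,\odot$; $X_i$ denotes the $i$th coordinate function. A congruence on a semiring is an equivalence relation compatible with both operations; it is finitely generated if it is the smallest congruence containing some finite subset of it. $\operatorname{Ker}(\psi)=\{(x,y):\psi(x)=\psi(y)\}$. For $V\subset\mathbb{R}^n$, $\boldsymbol{E}(V)=\{(f,g)\in\overline{\boldsymbol{T}(\boldsymbol{X})}_n^2: f(x)=g(x)\ \forall x\in V\}$; for $T\subset\overline{\boldsymbol{T}(\boldsymbol{X})}_n^2$, $\boldsymbol{V}(T)=\{x\in\mathbb{R}^n: f(x)=g(x)\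 \forall (f,g)\in T\}$. For a finitely generated congruence $E$ the set $\boldsymbol{V}(E)$ is known to be a finite union of $\mathbb{R}$-rational polyhedral sets (sets $\{x: Ax\ge b\}$ with $A$ a rational matrix and $b$ a real vector); the dimension of such a union is the maximal dimension of its members ($-1$ for the empty set). **Tropical curves.** A tropical curve $\Gamma$ is the underlying topological space of a pair $(G,l)$ (a model of $\Gamma$), where $G$ is a finite connected nonempty undirected multigraph (loops allowed) and $l:E(G)\to\mathbb{R}_{>0}\cup\{\infty\}$ takes the value $\infty$ only on leaf edges (non-loop edges having an end, called a leaf end, incident to no other edge), together with an identification of each edge $e$ with $[0,l(e)]$; here $[0,\infty]$ is the one-point compactification of $[0,\infty)$ with $\infty$ at infinite distance from all other points, and if $l(e)=\infty$ a leaf end of $e$ is identified with $\infty$. A curve has many models. Points identified with $\infty$ are points at infinity (set $\Gamma_\infty$); the others are finite points. A ray of $\Gamma$ is an edge of length $\infty$ of some model. **Rational functions.** $\operatorname{Rat}(\Gamma)$ is the set consisting of the constant function $-\infty$ and all continuous $f:\Gamma\to\mathbb{R}\cup\{\pm\infty\}$ that are piecewise affine with integer slopes and finitely many pieces and take values $\pm\infty$ only at points at infinity; with pointwise $\max$ and $+$ on finite points (extended continuously) it is a semifield over $\boldsymbol{T}$. **Parallel rays.** A tropical curve with parallel rays $\Gamma_{\operatorname{par}}$ is a tropical curve $\Gamma$ (its underlying tropical curve) with an equivalence relation $\sim$ on its rays such that $L_1\subset L_2$ implies $L_1\sim L_2$; rays equivalent under $\sim$ are called parallel. Points and points at infinity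 of $\Gamma_{\operatorname{par}}$ are those of $\Gamma$ ($\Gamma_{\operatorname{par},\infty}=\Gamma_\infty$). The rational function semifield $\operatorname{Rat}(\Gamma_{\operatorname{par}})\subset\operatorname{Rat}(\Gamma)$ consists of $-\infty$ and of those $f\in\operatorname{Rat}(\Gamma)\setminus\{-\infty\}$ that have the same slope at infinity along any two parallel rays. *)

theory Defs
  imports "HOL-Analysis.Analysis" "HOL-Algebra.Ring"
begin

section \<open>Algebras and semifields over the tropical semifield\<close>

definition trop :: "ereal ring" where
  "trop = \<lparr>carrier = {a. a \<noteq> \<infinity>}, mult = (+), one = 0, zero = -\<infinity>, add = max\<rparr>"

record 'a talgebra = "'a ring" +
  struct_map :: "ereal \<Rightarrow> 'a"

text \<open>The library's \<open>ring_hom\<close> does not mention the additive identity, which for semirings has to be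
  preserved separately.\<close>

definition semiring_hom :: "('a, 'y) ring_scheme \<Rightarrow> ('b, 'z) ring_scheme \<Rightarrow> ('a \<Rightarrow> 'b) set" where
  "semiring_hom R S = {h \<in> ring_hom R S. h \<zero>\<^bsub>R\<^esub> = \<zero>\<^bsub>S\<^esub>}"

definition T_algebra :: "('a, 'z) talgebra_scheme \<Rightarrow> bool" where
  "T_algebra A \<longleftrightarrow> semiring A \<and> comm_monoid A \<and> struct_map A \<in> semiring_hom trop A"

definition talg_hom ::
    "('a, 'y) talgebra_scheme \<Rightarrow> ('b, 'z) talgebra_scheme \<Rightarrow> ('a \<Rightarrow> 'b) set" where
  "talg_hom A B = {h \<in> semiring_hom A B. \<forall>a\<in>carrier trop. h (struct_map A a) = struct_map B a}"

definition talg_iso :: "('a, 'y) talgebra_scheme \<Rightarrow> ('b, 'z) talgebra_scheme \<Rightarrow> bool" where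
  "talg_iso A B \<longleftrightarrow> (\<exists>h\<in>talg_hom A B. bij_betw h (carrier A) (carrier B))"

definition T_semifield :: "('a, 'z) talgebra_scheme \<Rightarrow> bool" where
  "T_semifield A \<longleftrightarrow> T_algebra A \<and> carrier A - {\<zero>\<^bsub>A\<^esub>} \<subseteq> Units A \<and>
     \<zero>\<^bsub>A\<^esub> \<noteq> \<one>\<^bsub>A\<^esub> \<and> inj_on (struct_map A) (carrier trop)"

definition T_subsemifield :: "'a set \<Rightarrow> ('a, 'z) talgebra_scheme \<Rightarrow> bool" where
  "T_subsemifield S A \<longleftrightarrow> S \<subseteq> carrier A \<and> T_semifield (A\<lparr>carrier := S\<rparr>)"

definition generated_T_semifield :: "('a, 'z) talgebra_scheme \<Rightarrow> 'a set \<Rightarrow> ('a, 'z) talgebra_scheme" where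
  "generated_T_semifield A F = A\<lparr>carrier := \<Inter>{S. T_subsemifield S A \<and> F \<subseteq> S}\<rparr>"

section \<open>Congruences\<close>

definition congruence :: "('a, 'z) ring_scheme \<Rightarrow> ('a \<times> 'a) set \<Rightarrow> bool" where
  "congruence R E \<longleftrightarrow> equiv (carrier R) E \<and>
     (\<forall>(a, b)\<in>E. \<forall>(c, d)\<in>E. (a \<oplus>\<^bsub>R\<^esub> c, b \<oplus>\<^bsub>R\<^esub> d) \<in> E \<and> (a \<otimes>\<^bsub>R\<^esub> c, b \<otimes>\<^bsub>R\<^esub> d) \<in> E)"

definition fin_gen_congruence :: "('a, 'z) ring_scheme \<Rightarrow> ('a \<times> 'a) set \<Rightarrow> bool" where
  "fin_gen_congruence R E \<longleftrightarrow> congruence R E \<and>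
     (\<exists>S. finite S \<and> S \<subseteq> E \<and> (\<forall>E'. congruence R E' \<and> S \<subseteq> E' \<longrightarrow> E \<subseteq> E'))"

definition Ker :: "('a, 'z) ring_scheme \<Rightarrow> ('a \<Rightarrow> 'b) \<Rightarrow> ('a \<times> 'a) set" where
  "Ker R h = {(x, y) \<in> carrier R \<times> carrier R. h x = h y}"

definition quotient_talg :: "('a, 'z) talgebra_scheme \<Rightarrow> ('a \<times> 'a) set \<Rightarrow> 'a set talgebra" where
  "quotient_talg A E =
     \<lparr>carrier = carrier A // E,
      mult = (\<lambda>X Y. \<Union>x\<in>X. \<Union>y\<in>Y. E `` {x \<otimes>\<^bsub>A\<^esub> y}),
      one = E `` {\<one>\<^bsub>A\<^esub>},
      zero = E `` {\<zero>\<^bsub>A\<^esub>},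
      add = (\<lambda>X Y. \<Union>x\<in>X. \<Union>y\<in>Y. E `` {x \<oplus>\<^bsub>A\<^esub> y}),
      struct_map = (\<lambda>a. E `` {struct_map A a})\<rparr>"

section \<open>Tropical rational function semifields\<close>

text \<open>A pair \<open>(u, c)\<close> in \<open>M\<close> is a monomial with exponent vector \<open>u\<close> and coefficient \<open>c\<close>.\<close>

definition trop_laurent_functions :: "(real^'n::finite \<Rightarrow> real) set" where
  "trop_laurent_functions =
     {\<lambda>x. Max ((\<lambda>(u, c). c + (\<Sum>i\<in>UNIV. real_of_int (u $ i) * x $ i)) ` M) | M :: ((int^'n) \<times> real) set.
       finite M \<and> M \<noteq> {}}"

definition trop_rational :: "(real^'n::finite \<Rightarrow> ereal) talgebra" where
  "trop_rational =
     \<lparr>carrier = insert (\<lambda>x. -\<infinity>)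
        {\<lambda>x. ereal (P x - Q x) | P Q. P \<in> trop_laurent_functions \<and> Q \<in> trop_laurent_functions},
      mult = (\<lambda>f g x. f x + g x), one = (\<lambda>x. 0), zero = (\<lambda>x. -\<infinity>), add = (\<lambda>f g x. max (f x) (g x)),
      struct_map = (\<lambda>a x. a)\<rparr>"

definition coord :: "'n \<Rightarrow> real^'n::finite \<Rightarrow> ereal" where
  "coord i = (\<lambda>x. ereal (x $ i))"

definition E_of :: "(real^'n::finite) set \<Rightarrow> ((real^'n \<Rightarrow> ereal) \<times> (real^'n \<Rightarrow> ereal)) set" where
  "E_of V = {(f, g) \<in> carrier trop_rational \<times> carrier trop_rational. \<forall>x\<in>V. f x = g x}"

definition V_of :: "((real^'n::finite \<Rightarrow> ereal) \<times> (real^'n \<Rightarrow> ereal)) set \<Rightarrow> (real^'n) set" where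
  "V_of T = {x. \<forall>(f, g)\<in>T. f x = g x}"

text \<open>The finite set \<open>F\<close> lists the rows of the system \<open>A x \<ge> b\<close>.\<close>

definition rational_polyhedral :: "(real^'n::finite) set \<Rightarrow> bool" where
  "rational_polyhedral P \<longleftrightarrow> (\<exists>F :: ((rat^'n) \<times> real) set. finite F \<and>
     P = {x. \<forall>(a, b)\<in>F. (\<Sum>i\<in>UNIV. real_of_rat (a $ i) * x $ i) \<ge> b})"

definition has_dimension :: "(real^'n::finite) set \<Rightarrow> int \<Rightarrow> bool" where
  "has_dimension V d \<longleftrightarrow> (\<exists>\<P>. finite \<P> \<and> (\<forall>P\<in>\<P>. rational_polyhedral P) \<and> V = \<Union>\<P> \<and>
     d = Max (insert (-1) (aff_dim ` \<P>)))"

definition curve_congruence :: "((real^'n::finite \<Rightarrow> ereal) \<times> (real^'n \<Rightarrow> ereal)) set \<Rightarrow> bool" where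
  "curve_congruence E \<longleftrightarrow>
     fin_gen_congruence trop_rational E \<and>
     E = E_of (V_of E) \<and>
     connected (V_of E) \<and>
     (has_dimension (V_of E) 0 \<or> has_dimension (V_of E) 1)"

section \<open>Tropical curves\<close>

text \<open>A tropical curve is presented by one of its models. The vertices of the graph are points of the
  curve; the edges are named by natural numbers (the graph is finite, the names carry no information),
  and \<open>chart e\<close> is the identification of the edge \<open>e\<close> with \<open>{0..len e}\<close>. The ends of \<open>e\<close> are
  \<open>chart e 0\<close> and \<open>chart e (len e)\<close>; which of them comes first is only a choice of chart, except that
  an edge of infinite length has its leaf end at \<open>\<infinity>\<close>.\<close>

record 'p curve_model =
  verts :: "'p set"
  edges :: "nat set"
  len :: "nat \<Rightarrow> ereal"
  chart :: "nat \<Rightarrow> ereal \<Rightarrow> 'p"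

definition edge_interior :: "('p, 'z) curve_model_scheme \<Rightarrow> nat \<Rightarrow> 'p set" where
  "edge_interior G e = chart G e ` {0<..<len G e}"

definition edge_ends :: "('p, 'z) curve_model_scheme \<Rightarrow> nat \<Rightarrow> 'p set" where
  "edge_ends G e = {chart G e 0, chart G e (len G e)}"

definition tropical_curve :: "('p, 'z) curve_model_scheme \<Rightarrow> bool" where
  "tropical_curve G \<longleftrightarrow>
     finite (verts G) \<and> verts G \<noteq> {} \<and> finite (edges G) \<and>
     (\<forall>e\<in>edges G. 0 < len G e \<and> edge_ends G e \<subseteq> verts G) \<and>
     (\<forall>u\<in>verts G. \<forall>v\<in>verts G. (u, v) \<in> {(a, b). \<exists>e\<in>edges G. edge_ends G e = {a, b}}\<^sup>*) \<and>
     (\<forall>e\<in>edges G. inj_on (chart G e) {0<..<len G e} \<and> edge_interior G e \<inter> verts G = {}) \<and>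
     (\<forall>e\<in>edges G. \<forall>e'\<in>edges G. e \<noteq> e' \<longrightarrow> edge_interior G e \<inter> edge_interior G e' = {}) \<and>
     (\<forall>e\<in>edges G. len G e = \<infinity> \<longrightarrow>
        chart G e 0 \<noteq> chart G e \<infinity> \<and> (\<forall>e'\<in>edges G. e' \<noteq> e \<longrightarrow> chart G e \<infinity> \<notin> edge_ends G e'))"

definition curve_points :: "('p, 'z) curve_model_scheme \<Rightarrow> 'p set" where
  "curve_points G = verts G \<union> (\<Union>e\<in>edges G. chart G e ` {0..len G e})"

definition points_at_infinity :: "('p, 'z) curve_model_scheme \<Rightarrow> 'p set" where
  "points_at_infinity G = {chart G e \<infinity> | e. e \<in> edges G \<and> len G e = \<infinity>}"

definition finite_points :: "('p, 'z) curve_model_scheme \<Rightarrow> 'p set" where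
  "finite_points G = curve_points G - points_at_infinity G"

text \<open>The gluing topology. In \<open>ereal\<close>, \<open>{0..\<infinity>}\<close> is the one-point compactification of \<open>[0, \<infinity>)\<close>.\<close>

definition curve_topology :: "('p, 'z) curve_model_scheme \<Rightarrow> 'p topology" where
  "curve_topology G = topology (\<lambda>U. U \<subseteq> curve_points G \<and>
     (\<forall>e\<in>edges G. openin (top_of_set {0..len G e}) {t \<in> {0..len G e}. chart G e t \<in> U}))"

lemma openin_curve_topology:
  "openin (curve_topology G) U \<longleftrightarrow> U \<subseteq> curve_points G \<and>
     (\<forall>e\<in>edges G. openin (top_of_set {0..len G e}) {t \<in> {0..len G e}. chart G e t \<in> U})"
proof -
  have "istopology (\<lambda>U. U \<subseteq> curve_points G \<and>
     (\<forall>e\<in>edges G. openin (top_of_set {0..len G e}) {t \<in> {0..len G e}. chart G e t \<in> U}))"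
    unfolding istopology_def
  proof (intro conjI allI impI ballI)
    fix S T e
    assume S: "S \<subseteq> curve_points G \<and>
        (\<forall>e\<in>edges G. openin (top_of_set {0..len G e}) {t \<in> {0..len G e}. chart G e t \<in> S})"
      and T: "T \<subseteq> curve_points G \<and>
        (\<forall>e\<in>edges G. openin (top_of_set {0..len G e}) {t \<in> {0..len G e}. chart G e t \<in> T})"
    show "S \<inter> T \<subseteq> curve_points G" using S by blast
    assume e: "e \<in> edges G"
    have "{t \<in> {0..len G e}. chart G e t \<in> S \<inter> T} =
        {t \<in> {0..len G e}. chart G e t \<in> S} \<inter> {t \<in> {0..len G e}. chart G e t \<in> T}" by blast
    then show "openin (top_of_set {0..len G e}) {t \<in> {0..len G e}. chart G e t \<in> S \<inter> T}"
      using S T e by (metis (no_types, lifting) openin_Int)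
  next
    fix \<K> e
    assume K: "\<forall>U\<in>\<K>. U \<subseteq> curve_points G \<and>
        (\<forall>e\<in>edges G. openin (top_of_set {0..len G e}) {t \<in> {0..len G e}. chart G e t \<in> U})"
    show "\<Union>\<K> \<subseteq> curve_points G" using K by blast
    assume e: "e \<in> edges G"
    have "{t \<in> {0..len G e}. chart G e t \<in> \<Union>\<K>} =
        (\<Union>U\<in>\<K>. {t \<in> {0..len G e}. chart G e t \<in> U})" by blast
    moreover have "openin (top_of_set {0..len G e}) (\<Union>U\<in>\<K>. {t \<in> {0..len G e}. chart G e t \<in> U})"
      using K e by (intro openin_Union) blast
    ultimately show "openin (top_of_set {0..len G e}) {t \<in> {0..len G e}. chart G e t \<in> \<Union>\<K>}" by simp
  qed
  then show ?thesis by (simp add: curve_topology_def topology_inverse')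
qed

text \<open>Two models on the same set of points are models of the same curve if and only if they have a
  common subdivision. In a subdivision, every edge is a segment of an edge of the original model,
  traversed in one of the two directions.\<close>

definition subdivides :: "('p, 'y) curve_model_scheme \<Rightarrow> ('p, 'z) curve_model_scheme \<Rightarrow> bool" where
  "subdivides H G \<longleftrightarrow> curve_points H = curve_points G \<and> verts G \<subseteq> verts H \<and>
     (\<forall>d\<in>edges H. \<exists>e\<in>edges G. \<exists>a::real. 0 \<le> a \<and> ereal a \<le> len G e \<and>
        ((\<forall>t\<in>{0..len H d}. ereal a + t \<le> len G e \<and> chart H d t = chart G e (ereal a + t)) \<or>
         (\<forall>t\<in>{0..len H d}. t \<le> ereal a \<and> chart H d t = chart G e (ereal a - t))))"

definition model_of :: "'p curve_model \<Rightarrow> ('p, 'z) curve_model_scheme \<Rightarrow> bool" where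
  "model_of H G \<longleftrightarrow> tropical_curve H \<and>
     (\<exists>N :: 'p curve_model. tropical_curve N \<and> subdivides N H \<and> subdivides N G)"

definition rays :: "('p, 'z) curve_model_scheme \<Rightarrow> 'p set set" where
  "rays G = {chart H e ` {0..\<infinity>} | H e. model_of H G \<and> e \<in> edges H \<and> len H e = \<infinity>}"

section \<open>Rational functions\<close>

text \<open>Functions on a curve are represented by extensional functions on its set of points.\<close>

definition pw_integral_affine :: "ereal \<Rightarrow> (ereal \<Rightarrow> ereal) \<Rightarrow> bool" where
  "pw_integral_affine l g \<longleftrightarrow> (\<exists>\<I> :: real set set. finite \<I> \<and> (\<forall>I\<in>\<I>. is_interval I) \<and>
     \<Union>\<I> = {t. 0 \<le> t \<and> ereal t \<le> l} \<and>
     (\<forall>I\<in>\<I>. \<exists>(m::int) (c::real). \<forall>t\<in>I. g (ereal t) = ereal (real_of_int m * t + c)))"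

definition curve_const :: "('p, 'z) curve_model_scheme \<Rightarrow> ereal \<Rightarrow> 'p \<Rightarrow> ereal" where
  "curve_const G a = (\<lambda>x\<in>curve_points G. a)"

definition Rat_carrier :: "('p, 'z) curve_model_scheme \<Rightarrow> ('p \<Rightarrow> ereal) set" where
  "Rat_carrier G = insert (curve_const G (-\<infinity>))
     {f \<in> extensional (curve_points G).
        continuous_map (curve_topology G) euclidean f \<and>
        (\<forall>x\<in>finite_points G. \<bar>f x\<bar> \<noteq> \<infinity>) \<and>
        (\<forall>e\<in>edges G. pw_integral_affine (len G e) (\<lambda>t. f (chart G e t)))}"

text \<open>Pointwise operations make sense on finite points only (at a point at infinity one may meet
  \<open>\<infinity> + -\<infinity>\<close>); the result is extended continuously.\<close>

definition continuous_ext :: "('p, 'z) curve_model_scheme \<Rightarrow> ('p \<Rightarrow> ereal) \<Rightarrow> 'p \<Rightarrow> ereal" where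
  "continuous_ext G h = (THE k. k \<in> extensional (curve_points G) \<and>
     continuous_map (curve_topology G) euclidean k \<and> (\<forall>x\<in>finite_points G. k x = h x))"

definition Rat :: "('p, 'z) curve_model_scheme \<Rightarrow> ('p \<Rightarrow> ereal) talgebra" where
  "Rat G =
     \<lparr>carrier = Rat_carrier G,
      mult = (\<lambda>f g. continuous_ext G (\<lambda>x. f x + g x)),
      one = curve_const G 0,
      zero = curve_const G (-\<infinity>),
      add = (\<lambda>f g. continuous_ext G (\<lambda>x. max (f x) (g x))),
      struct_map = curve_const G\<rparr>"

section \<open>Tropical curves with parallel rays\<close>

record 'p par_curve = "'p curve_model" +
  parallel :: "('p set \<times> 'p set) set"

definition tropical_curve_par :: "('p, 'z) par_curve_scheme \<Rightarrow> bool" where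
  "tropical_curve_par G \<longleftrightarrow> tropical_curve G \<and> equiv (rays G) (parallel G) \<and>
     (\<forall>L1\<in>rays G. \<forall>L2\<in>rays G. L1 \<subseteq> L2 \<longrightarrow> (L1, L2) \<in> parallel G)"

text \<open>Slopes are taken in the direction of the point at infinity.\<close>

definition slope_at_infinity ::
    "('p, 'z) curve_model_scheme \<Rightarrow> ('p \<Rightarrow> ereal) \<Rightarrow> 'p set \<Rightarrow> int \<Rightarrow> bool" where
  "slope_at_infinity G f L m \<longleftrightarrow>
     (\<exists>H e c. model_of H G \<and> e \<in> edges H \<and> len H e = \<infinity> \<and> L = chart H e ` {0..\<infinity>} \<and>
        (\<forall>\<^sub>F t in at_top. f (chart H e (ereal t)) = ereal (real_of_int m * t + c)))"

definition Rat_par :: "('p, 'z) par_curve_scheme \<Rightarrow> ('p \<Rightarrow> ereal) talgebra" where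
  "Rat_par G = (Rat G)\<lparr>carrier := {f \<in> carrier (Rat G). f = \<zero>\<^bsub>Rat G\<^esub> \<or>
     (\<forall>(L1, L2)\<in>parallel G. \<exists>m. slope_at_infinity G f L1 m \<and> slope_at_infinity G f L2 m)}\<rparr>"

end

(*
A homomorphism psi to Rat(Gamma) evaluates a rational function along the map theta: psi(F)(x) = F(theta(x)) at every finite
point x. Hence Ker(psi) = E(V) for V = Im(theta), and V is a connected finite union of segments and rays whose directions
are primitive integer vectors. For each such piece A let w_A be the maximal violation of the integral linear inequalities
that define A; it is a nonnegative tropical rational function which vanishes exactly on A and dominates a multiple of the
distance to A. Therefore w = min w_A has the same properties for V. This gives V(E(V)) = V, and since two rational functions
that agree on V differ by at most a multiple of w, the single pair (w, 0) generates E(V).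

For the isomorphism with a rational function semifield, V is subdivided into a graph whose edges are parametrised by lattice
length, and two rays are parallel if they have the same direction. A function on this curve extends to R^n: if F_A is an
affine function that agrees with it on the piece A, then F_A - C w_A still agrees with it on A, and for large C it lies below
it on any other piece B. Only two rays with equal directions, along which w_A stays bounded, could be an obstruction; there
the slopes agree by assumption. The extension is the maximum over A of the minima over B.
*)
theory Submission
  imports Defs
begin

section \<open>Tropical rational functions\<close>

text \<open>Primitive directions matter because a primitive \<open>u\<close> admits an integral
  functional with value 1 on \<open>u\<close>: every integer slope along a piece is then the slope
  of an affine function with integral exponents. This is why edges carry lattice length. The pair
  (w, 0) generates since w ~ 0 forces max(h, 0) ~ 0 for each h bounded by a multiple of w; applied
  to f - g and g - f this gives f ~ max(f, g) ~ g. The Lipschitz property of rational functions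
  supplies the bound. The obstacle to building a graph is that images of different edges may overlap
  in segments or cross. The pieces are cut at their ends and at transversal crossings; after that,
  two open segments are equal or disjoint. Homomorphisms are evaluated at finite points only, where
  invertibility makes the values real; values at infinity are recovered by continuity. A
  homomorphism onto the quotient is followed by the embedding of the quotient into Rat(Gamma), so
  its kernel is again of the kind already treated.\<close>

definition PL :: "(real^'n::finite \<Rightarrow> real) set" where
  "PL = {\<lambda>x. P x - Q x | P Q. P \<in> trop_laurent_functions \<and> Q \<in> trop_laurent_functions}"

lemma PL_I: "P \<in> trop_laurent_functions \<Longrightarrow> Q \<in> trop_laurent_functions \<Longrightarrow> (\<lambda>x. P x - Q x) \<in> PL"
  unfolding PL_def by blast

definition iprod :: "int^'n::finite \<Rightarrow> real^'n \<Rightarrow> real" where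
  "iprod u x = (\<Sum>i\<in>UNIV. real_of_int (u $ i) * x $ i)"

lemma iprod_add_left: "iprod (u + v) x = iprod u x + iprod v x"
  by (simp add: iprod_def distrib_right sum.distrib)

lemma iprod_add_right: "iprod u (x + y) = iprod u x + iprod u y"
  by (simp add: iprod_def distrib_left sum.distrib)

lemma iprod_diff_right: "iprod u (x - y) = iprod u x - iprod u y"
  by (simp add: iprod_def right_diff_distrib sum_subtractf)

lemma iprod_scaleR_right: "iprod u (c *\<^sub>R x) = c * iprod u x"
  by (simp add: iprod_def sum_distrib_left mult_ac)

lemma iprod_minus_left: "iprod (- u) x = - iprod u x"
  by (simp add: iprod_def sum_negf)

lemma iprod_0 [simp]: "iprod 0 x = 0"
  by (simp add: iprod_def)

lemma iprod_axis: "iprod (axis i 1) x = x $ i"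
proof -
  have "iprod (axis i 1) x = (\<Sum>j\<in>UNIV. if j = i then x $ j else 0)"
    unfolding iprod_def by (rule sum.cong) (auto simp: axis_def)
  then show ?thesis by simp
qed

lemma trop_laurent_iff:
  "P \<in> trop_laurent_functions \<longleftrightarrow>
     (\<exists>M. finite M \<and> M \<noteq> {} \<and> P = (\<lambda>x. Max ((\<lambda>(u, c). c + iprod u x) ` M)))"
  unfolding trop_laurent_functions_def iprod_def by blast

lemma trop_laurent_affine: "(\<lambda>x. c + iprod u x) \<in> trop_laurent_functions"
  unfolding trop_laurent_iff by (rule exI[of _ "{(u, c)}"]) auto

text \<open>Sums distribute over maxima, so the monomials of the tropical product are the pairwise
  products of monomials; they are collected in \<open>K\<close>.\<close>

lemma trop_laurent_add:
  assumes "P \<in> trop_laurent_functions" "Q \<in> trop_laurent_functions"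
  shows "(\<lambda>x. P x + Q x) \<in> trop_laurent_functions"
proof -
  obtain M N where M: "finite M" "M \<noteq> {}" "P = (\<lambda>x. Max ((\<lambda>(u, c). c + iprod u x) ` M))"
    and N: "finite N" "N \<noteq> {}" "Q = (\<lambda>x. Max ((\<lambda>(u, c). c + iprod u x) ` N))"
    using assms unfolding trop_laurent_iff by blast
  define K where "K = (\<lambda>((u, c), (v, d)). (u + v, c + d)) ` (M \<times> N)"
  have K: "finite K" "K \<noteq> {}" using M N by (auto simp: K_def)
  have "P x + Q x = Max ((\<lambda>(u, c). c + iprod u x) ` K)" for x
  proof (rule Max_eqI[symmetric])
    show "finite ((\<lambda>(u, c). c + iprod u x) ` K)" using K by simp
    fix y assume "y \<in> (\<lambda>(u, c). c + iprod u x) ` K"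
    then obtain u c v d where uc: "(u, c) \<in> M" "(v, d) \<in> N" "y = (c + iprod u x) + (d + iprod v x)"
      by (auto simp: K_def iprod_add_left)
    have "c + iprod u x \<le> P x" "d + iprod v x \<le> Q x"
      using uc M N by (auto intro!: Max_ge rev_image_eqI)
    then show "y \<le> P x + Q x" using uc by simp
  next
    have "P x \<in> (\<lambda>(u, c). c + iprod u x) ` M" "Q x \<in> (\<lambda>(u, c). c + iprod u x) ` N"
      using M N by (auto intro!: Max_in simp del: Max_in)
    then obtain u c v d where "(u, c) \<in> M" "(v, d) \<in> N" "P x = c + iprod u x" "Q x = d + iprod v x"
      by auto
    then show "P x + Q x \<in> (\<lambda>(u, c). c + iprod u x) ` K"
      by (auto simp: K_def iprod_add_left intro!: rev_image_eqI[of "(u + v, c + d)"] rev_image_eqI[of "((u, c), (v, d))"])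
  qed
  with K show ?thesis unfolding trop_laurent_iff by blast
qed

lemma trop_laurent_max:
  assumes "P \<in> trop_laurent_functions" "Q \<in> trop_laurent_functions"
  shows "(\<lambda>x. max (P x) (Q x)) \<in> trop_laurent_functions"
proof -
  obtain M N where M: "finite M" "M \<noteq> {}" "P = (\<lambda>x. Max ((\<lambda>(u, c). c + iprod u x) ` M))"
    and N: "finite N" "N \<noteq> {}" "Q = (\<lambda>x. Max ((\<lambda>(u, c). c + iprod u x) ` N))"
    using assms unfolding trop_laurent_iff by blast
  have "max (P x) (Q x) = Max ((\<lambda>(u, c). c + iprod u x) ` (M \<union> N))" for x
    using M N by (simp add: image_Un Max_Un)
  then show ?thesis unfolding trop_laurent_iff using M N by (intro exI[of _ "M \<union> N"]) auto
qed

lemma PL_affine: "(\<lambda>x. c + iprod u x) \<in> PL"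
  using PL_I[OF trop_laurent_affine[of c u] trop_laurent_affine[of 0 0]] by simp

lemma PL_const: "(\<lambda>x. c) \<in> PL"
  using PL_affine[of c 0] by simp

lemma PL_coord: "(\<lambda>x. x $ i) \<in> PL"
  using PL_affine[of 0 "axis i 1"] by (simp add: iprod_axis)

lemma PL_uminus: "f \<in> PL \<Longrightarrow> (\<lambda>x. - f x) \<in> PL"
proof -
  assume "f \<in> PL"
  then obtain P Q where *: "P \<in> trop_laurent_functions" "Q \<in> trop_laurent_functions" "f = (\<lambda>x. P x - Q x)"
    unfolding PL_def by blast
  then have "(\<lambda>x. - f x) = (\<lambda>x. Q x - P x)" by auto
  then show ?thesis using PL_I * by simp
qed

lemma PL_add:
  assumes "f \<in> PL" "g \<in> PL" shows "(\<lambda>x. f x + g x) \<in> PL"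
proof -
  obtain P Q P' Q' where *: "P \<in> trop_laurent_functions" "Q \<in> trop_laurent_functions"
      "P' \<in> trop_laurent_functions" "Q' \<in> trop_laurent_functions"
      "f = (\<lambda>x. P x - Q x)" "g = (\<lambda>x. P' x - Q' x)"
    using assms unfolding PL_def by blast
  have "(\<lambda>x. f x + g x) = (\<lambda>x. (P x + P' x) - (Q x + Q' x))" using * by auto
  moreover have "(\<lambda>x. P x + P' x) \<in> trop_laurent_functions" "(\<lambda>x. Q x + Q' x) \<in> trop_laurent_functions"
    using * by (auto intro: trop_laurent_add)
  ultimately show ?thesis using PL_I by simp
qed

lemma PL_max:
  assumes "f \<in> PL" "g \<in> PL" shows "(\<lambda>x. max (f x) (g x)) \<in> PL"
proof -
  obtain P Q P' Q' where *: "P \<in> trop_laurent_functions" "Q \<in> trop_laurent_functions"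
      "P' \<in> trop_laurent_functions" "Q' \<in> trop_laurent_functions"
      "f = (\<lambda>x. P x - Q x)" "g = (\<lambda>x. P' x - Q' x)"
    using assms unfolding PL_def by blast
  \<comment> \<open>The two differences are brought to the common tropical denominator
    \<open>Q + Q'\<close>.\<close>
  have "(\<lambda>x. max (f x) (g x)) = (\<lambda>x. max (P x + Q' x) (P' x + Q x) - (Q x + Q' x))" using * by auto
  moreover have "(\<lambda>x. max (P x + Q' x) (P' x + Q x)) \<in> trop_laurent_functions"
    using * by (intro trop_laurent_max trop_laurent_add)
  moreover have "(\<lambda>x. Q x + Q' x) \<in> trop_laurent_functions" using * by (intro trop_laurent_add)
  ultimately show ?thesis using PL_I by simp
qed

lemma PL_diff: "f \<in> PL \<Longrightarrow> g \<in> PL \<Longrightarrow> (\<lambda>x. f x - g x) \<in> PL"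
  using PL_add[of f "\<lambda>x. - g x"] PL_uminus[of g] by simp

lemma PL_min:
  assumes "f \<in> PL" "g \<in> PL" shows "(\<lambda>x. min (f x) (g x)) \<in> PL"
proof -
  have "(\<lambda>x. min (f x) (g x)) = (\<lambda>x. - max (- f x) (- g x))" by auto
  then show ?thesis using assms by (auto intro!: PL_uminus PL_max)
qed

lemma PL_of_nat_mult: "f \<in> PL \<Longrightarrow> (\<lambda>x. real n * f x) \<in> PL"
  by (induction n) (auto simp: distrib_right intro: PL_const PL_add)

lemma PL_Max:
  assumes "finite A" "A \<noteq> {}" "\<And>a. a \<in> A \<Longrightarrow> F a \<in> PL"
  shows "(\<lambda>x. Max ((\<lambda>a. F a x) ` A)) \<in> PL"
  using assms by (induction rule: finite_ne_induct) (auto intro: PL_max)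

lemma PL_Min:
  assumes "finite A" "A \<noteq> {}" "\<And>a. a \<in> A \<Longrightarrow> F a \<in> PL"
  shows "(\<lambda>x. Min ((\<lambda>a. F a x) ` A)) \<in> PL"
  using assms by (induction rule: finite_ne_induct) (auto intro: PL_min)

text \<open>Sums and negation produce integral affine functions, finite maxima the tropical
  polynomials, and a last negation and sum the differences \<open>P - Q\<close>. Later statements on
  rational functions (Lipschitz bounds, slopes, evaluation of homomorphisms) are thereby reduced to
  the generating operations.\<close>

lemma PL_induct [consumes 1, case_names const coord add uminus max]:
  assumes f: "f \<in> PL"
    and const: "\<And>c. S (\<lambda>x. c)"
    and coord: "\<And>i. S (\<lambda>x. x $ i)"
    and add: "\<And>f g. f \<in> PL \<Longrightarrow> g \<in> PL \<Longrightarrow> S f \<Longrightarrow> S g \<Longrightarrow> S (\<lambda>x. f x + g x)"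
    and uminus: "\<And>f. f \<in> PL \<Longrightarrow> S f \<Longrightarrow> S (\<lambda>x. - f x)"
    and max: "\<And>f g. f \<in> PL \<Longrightarrow> g \<in> PL \<Longrightarrow> S f \<Longrightarrow> S g \<Longrightarrow> S (\<lambda>x. max (f x) (g x))"
  shows "S f"
proof -
  \<comment> \<open>Membership in \<open>PL\<close> is carried along, because the closure hypotheses
    ask for it together with \<open>S\<close>.\<close>
  let ?S = "\<lambda>f. f \<in> PL \<and> S f"
  have nat: "?S (\<lambda>x. real k * x $ i)" for k :: nat and i
    by (induction k) (auto simp: distrib_right intro: const coord add PL_const PL_coord PL_add)
  have int: "?S (\<lambda>x. real_of_int k * x $ i)" for k :: int and i
  proof (cases "k \<ge> 0")
    case True
    then show ?thesis using nat[of "nat k" i] by simp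
  next
    case False
    then have "(\<lambda>x :: real^'a. real_of_int k * x $ i) = (\<lambda>x. - (real (nat (- k)) * x $ i))" by auto
    moreover have "?S (\<lambda>x. - (real (nat (- k)) * x $ i))"
      using nat[of "nat (- k)" i] uminus PL_uminus by blast
    ultimately show ?thesis by simp
  qed
  have sum: "?S (\<lambda>x. \<Sum>i\<in>A. real_of_int (u $ i) * x $ i)" for A and u :: "int^'a"
    by (induction A rule: infinite_finite_induct) (auto intro!: const add PL_const PL_add simp: int)
  have aff: "?S (\<lambda>x. c + iprod u x)" for c u
    using sum[of u UNIV] const[of c] add[OF PL_const[of c], of "\<lambda>x. iprod u x"]
      PL_add[OF PL_const[of c], of "\<lambda>x. iprod u x"] unfolding iprod_def by blast
  have "?S P" if "P \<in> trop_laurent_functions" for P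
  proof -
    obtain M where M: "finite M" "M \<noteq> {}" "P = (\<lambda>x. Max ((\<lambda>(u, c). c + iprod u x) ` M))"
      using \<open>P \<in> _\<close> unfolding trop_laurent_iff by blast
    have "?S (\<lambda>x. Max ((\<lambda>(u, c). c + iprod u x) ` M))" using M(1,2)
    proof (induction rule: finite_ne_induct)
      case (singleton a)
      then show ?case using aff[of "snd a" "fst a"] by (auto simp: case_prod_unfold)
    next
      case (insert a M)
      then have "?S (\<lambda>x. max (snd a + iprod (fst a) x) (Max ((\<lambda>(u, c). c + iprod u x) ` M)))"
        using aff[of "snd a" "fst a"] max[of "\<lambda>x. snd a + iprod (fst a) x"]
          PL_max[of "\<lambda>x. snd a + iprod (fst a) x"] by blast
      then show ?case using insert by (auto simp: case_prod_unfold)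
    qed
    then show ?thesis using M by simp
  qed
  moreover obtain P Q where PQ: "P \<in> trop_laurent_functions" "Q \<in> trop_laurent_functions" "f = (\<lambda>x. P x - Q x)"
    using f unfolding PL_def by blast
  ultimately have "?S P" "?S (\<lambda>x. - Q x)" using uminus PL_uminus by auto
  then have "S (\<lambda>x. P x + - Q x)" by (intro add) auto
  then show ?thesis using PQ by simp
qed

text \<open>Apart from the zero element all rational functions are real-valued, so the work is done
  in \<open>PL\<close>, and \<open>ereal\<close> enters only through this description.\<close>

lemma carrier_trop_rational: "carrier (trop_rational :: (real^'a::finite \<Rightarrow> ereal) talgebra) = insert (\<lambda>x. -\<infinity>) ((\<lambda>h x. ereal (h x)) ` PL)"
proof -
  have "{\<lambda>x :: real^'a. ereal (P x - Q x) | P Q. P \<in> trop_laurent_functions \<and> Q \<in> trop_laurent_functions}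
    = (\<lambda>h x. ereal (h x)) ` PL" (is "?A = ?B")
  proof
    show "?A \<subseteq> ?B" using PL_I by (force intro!: image_eqI)
    show "?B \<subseteq> ?A" unfolding PL_def by auto
  qed
  then show ?thesis by (simp add: trop_rational_def)
qed

text \<open>Lipschitz constants add up both for sums and for maxima.\<close>

lemma PL_Lipschitz:
  assumes "f \<in> PL" shows "\<exists>L\<ge>0. \<forall>x y. \<bar>f x - f y\<bar> \<le> L * dist x y"
  using assms
proof (induction rule: PL_induct)
  case (const c)
  show ?case by (rule exI[of _ 0]) auto
next
  case (coord i)
  show ?case by (rule exI[of _ 1]) (simp add: dist_vec_nth_le flip: dist_real_def)
next
  case (add f g)
  then obtain L K where *: "L \<ge> 0" "K \<ge> 0" "\<And>x y. \<bar>f x - f y\<bar> \<le> L * dist x y" "\<And>x y. \<bar>g x - g y\<bar> \<le> K * dist x y"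
    by blast
  have "\<bar>(f x + g x) - (f y + g y)\<bar> \<le> (L + K) * dist x y" for x y
    using *(3)[of x y] *(4)[of x y] by (simp add: distrib_right)
  then show ?case using * by (intro exI[of _ "L + K"]) auto
next
  case (uminus f)
  then show ?case by (metis abs_minus_commute minus_diff_minus abs_minus_cancel)
next
  case (max f g)
  then obtain L K where *: "L \<ge> 0" "K \<ge> 0" "\<And>x y. \<bar>f x - f y\<bar> \<le> L * dist x y" "\<And>x y. \<bar>g x - g y\<bar> \<le> K * dist x y"
    by blast
  have "\<bar>max (f x) (g x) - max (f y) (g y)\<bar> \<le> (L + K) * dist x y" for x y
  proof -
    have "0 \<le> L * dist x y" "0 \<le> K * dist x y" using * by auto
    then show ?thesis using *(3)[of x y] *(4)[of x y] unfolding distrib_right by linarith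
  qed
  then show ?case using * by (intro exI[of _ "L + K"]) auto
qed

lemma PL_continuous:
  assumes "f \<in> PL" shows "continuous_on A f"
proof -
  obtain L where L: "L \<ge> 0" "\<And>x y. \<bar>f x - f y\<bar> \<le> L * dist x y" using PL_Lipschitz[OF assms] by blast
  then have "L-lipschitz_on A f" by (auto simp: lipschitz_on_def dist_real_def)
  then show ?thesis by (rule lipschitz_on_continuous_on)
qed

section \<open>Piecewise integral affine functions of one variable\<close>

text \<open>The finite parameters of an edge of length \<open>l\<close>: the end
  \<open>\<infinity>\<close> of an infinite edge is left out, so that functions of these parameters
  can be real-valued.\<close>

definition dom_upto :: "ereal \<Rightarrow> real set" where
  "dom_upto l = {t. 0 \<le> t \<and> ereal t \<le> l}"

definition int_affine_on :: "real set \<Rightarrow> (real \<Rightarrow> real) \<Rightarrow> bool" where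
  "int_affine_on I h \<longleftrightarrow> (\<exists>(m::int) c. \<forall>t\<in>I. h t = real_of_int m * t + c)"

text \<open>The intervals may overlap, be open or degenerate; continuity is kept as a separate
  condition.\<close>

definition pw_int_affine :: "ereal \<Rightarrow> (real \<Rightarrow> real) \<Rightarrow> bool" where
  "pw_int_affine l h \<longleftrightarrow> (\<exists>\<I>. finite \<I> \<and> (\<forall>I\<in>\<I>. is_interval I) \<and> \<Union>\<I> = dom_upto l \<and>
     (\<forall>I\<in>\<I>. int_affine_on I h))"

lemma int_affine_onI: "(\<And>t. t \<in> I \<Longrightarrow> h t = real_of_int m * t + c) \<Longrightarrow> int_affine_on I h"
  unfolding int_affine_on_def by (intro exI ballI)

lemma int_affine_on_cong: "(\<And>t. t \<in> I \<Longrightarrow> g t = h t) \<Longrightarrow> int_affine_on I h \<Longrightarrow> int_affine_on I g"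
  unfolding int_affine_on_def by simp

lemma pw_int_affineI:
  assumes "finite \<I>" "\<And>I. I \<in> \<I> \<Longrightarrow> is_interval I" "\<Union>\<I> = dom_upto l" "\<And>I. I \<in> \<I> \<Longrightarrow> int_affine_on I h"
  shows "pw_int_affine l h"
  unfolding pw_int_affine_def using assms by (intro exI[of _ \<I>]) simp

lemma int_affine_on_subset: "int_affine_on I h \<Longrightarrow> J \<subseteq> I \<Longrightarrow> int_affine_on J h"
  unfolding int_affine_on_def by blast

lemma int_affine_on_add:
  assumes "int_affine_on I f" "int_affine_on I g"
  shows "int_affine_on I (\<lambda>t. f t + g t)"
proof -
  obtain m c m' c' where "\<forall>t\<in>I. f t = real_of_int m * t + c" "\<forall>t\<in>I. g t = real_of_int m' * t + c'"
    using assms unfolding int_affine_on_def by (elim exE)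
  then have "\<forall>t\<in>I. f t + g t = real_of_int (m + m') * t + (c + c')" by (simp add: algebra_simps)
  then show ?thesis unfolding int_affine_on_def by (intro exI)
qed

lemma int_affine_on_uminus:
  assumes "int_affine_on I f"
  shows "int_affine_on I (\<lambda>t. - f t)"
proof -
  obtain m c where "\<forall>t\<in>I. f t = real_of_int m * t + c"
    using assms unfolding int_affine_on_def by (elim exE)
  then have "\<forall>t\<in>I. - f t = real_of_int (- m) * t + (- c)" by (simp add: algebra_simps)
  then show ?thesis unfolding int_affine_on_def by (intro exI)
qed

lemma is_interval_dom_upto: "is_interval (dom_upto l)"
proof -
  have "ereal x \<le> l" if "ereal b \<le> l" "x \<le> b" for x b
    using that order_trans[of "ereal x" "ereal b" l] by simp
  then show ?thesis unfolding is_interval_1 dom_upto_def by auto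
qed

lemma closed_dom_upto: "closed (dom_upto l)"
proof (cases l)
  case (real r)
  then have "dom_upto l = {0..r}" by (auto simp: dom_upto_def)
  then show ?thesis by simp
next
  case PInf
  then have "dom_upto l = {0..}" by (auto simp: dom_upto_def)
  then show ?thesis by simp
next
  case MInf
  then have "dom_upto l = {}" by (auto simp: dom_upto_def)
  then show ?thesis by simp
qed

text \<open>A common refinement: intersections of intervals are intervals, and subsets inherit
  affinity.\<close>

lemma pw_int_affine_common:
  assumes "finite H" "\<And>h. h \<in> H \<Longrightarrow> pw_int_affine l h"
  shows "\<exists>\<I>. finite \<I> \<and> (\<forall>I\<in>\<I>. is_interval I) \<and> \<Union>\<I> = dom_upto l \<and>
     (\<forall>I\<in>\<I>. \<forall>h\<in>H. int_affine_on I h)"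
  using assms
proof (induction H rule: finite_induct)
  case empty
  show ?case by (rule exI[of _ "{dom_upto l}"]) (auto simp: is_interval_dom_upto)
next
  case (insert h H)
  obtain \<I> where I: "finite \<I>" "\<forall>I\<in>\<I>. is_interval I" "\<Union>\<I> = dom_upto l"
     "\<forall>I\<in>\<I>. \<forall>h\<in>H. int_affine_on I h" using insert.IH insert.prems by auto
  obtain \<J> where J: "finite \<J>" "\<forall>I\<in>\<J>. is_interval I" "\<Union>\<J> = dom_upto l"
     "\<forall>I\<in>\<J>. int_affine_on I h" using insert.prems[OF insertI1] unfolding pw_int_affine_def by (elim exE conjE)
  let ?K = "(\<lambda>(I, J). I \<inter> J) ` (\<I> \<times> \<J>)"
  have "finite ?K" using I(1) J(1) by simp
  moreover have "\<forall>I\<in>?K. is_interval I" using I(2) J(2) is_interval_Int by auto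
  moreover have "\<Union>?K = \<Union>\<I> \<inter> \<Union>\<J>" by auto
  then have "\<Union>?K = dom_upto l" using I(3) J(3) by simp
  moreover have "\<forall>I\<in>?K. \<forall>h\<in>insert h H. int_affine_on I h"
  proof (intro ballI)
    fix K k assume "K \<in> ?K" "k \<in> insert h H"
    then obtain i j where "i \<in> \<I>" "j \<in> \<J>" "K = i \<inter> j" by auto
    then have "int_affine_on i k \<or> int_affine_on j k" using I(4) J(4) \<open>k \<in> insert h H\<close> by auto
    then show "int_affine_on K k" using \<open>K = i \<inter> j\<close> int_affine_on_subset[of _ k K] by auto
  qed
  ultimately show ?case by (intro exI[of _ ?K] conjI)
qed

lemma pw_int_affine_common2:
  assumes "pw_int_affine l f" "pw_int_affine l g"
  obtains \<I> where "finite \<I>" "\<And>I. I \<in> \<I> \<Longrightarrow> is_interval I" "\<Union>\<I> = dom_upto l"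
     "\<And>I. I \<in> \<I> \<Longrightarrow> int_affine_on I f" "\<And>I. I \<in> \<I> \<Longrightarrow> int_affine_on I g"
proof -
  have "\<exists>\<I>. finite \<I> \<and> (\<forall>I\<in>\<I>. is_interval I) \<and> \<Union>\<I> = dom_upto l \<and>
     (\<forall>I\<in>\<I>. \<forall>h\<in>{f, g}. int_affine_on I h)"
    by (rule pw_int_affine_common) (use assms in auto)
  then obtain \<I> where "finite \<I>" "\<forall>I\<in>\<I>. is_interval I" "\<Union>\<I> = dom_upto l"
     "\<forall>I\<in>\<I>. \<forall>h\<in>{f, g}. int_affine_on I h" by (elim exE conjE)
  then show thesis using that[of \<I>] by simp
qed

lemma pw_int_affineI_affine: "pw_int_affine l (\<lambda>t. real_of_int m * t + c)"
  by (rule pw_int_affineI[of "{dom_upto l}"]) (auto simp: is_interval_dom_upto intro: int_affine_onI)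

lemma pw_int_affine_const: "pw_int_affine l (\<lambda>t. c)"
  using pw_int_affineI_affine[of l 0 c] by simp

lemma pw_int_affine_add:
  assumes "pw_int_affine l f" "pw_int_affine l g"
  shows "pw_int_affine l (\<lambda>t. f t + g t)"
proof -
  obtain \<I> where "finite \<I>" "\<And>I. I \<in> \<I> \<Longrightarrow> is_interval I" "\<Union>\<I> = dom_upto l"
     "\<And>I. I \<in> \<I> \<Longrightarrow> int_affine_on I f" "\<And>I. I \<in> \<I> \<Longrightarrow> int_affine_on I g"
    using pw_int_affine_common2[OF assms] by blast
  then show ?thesis unfolding pw_int_affine_def by (intro exI[of _ \<I>]) (simp add: int_affine_on_add)
qed

lemma pw_int_affine_uminus:
  assumes "pw_int_affine l f"
  shows "pw_int_affine l (\<lambda>t. - f t)"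
proof -
  obtain \<I> where "finite \<I>" "\<forall>I\<in>\<I>. is_interval I" "\<Union>\<I> = dom_upto l" "\<forall>I\<in>\<I>. int_affine_on I f"
    using assms unfolding pw_int_affine_def by blast
  then show ?thesis unfolding pw_int_affine_def by (intro exI[of _ \<I>]) (simp add: int_affine_on_uminus)
qed

text \<open>On an interval where both functions are affine, comparing them is a linear inequality.
  The interval splits into two intervals, on each of which the maximum is one of the two
  functions.\<close>

lemma pw_int_affine_max:
  assumes "pw_int_affine l f" "pw_int_affine l g"
  shows "pw_int_affine l (\<lambda>t. max (f t) (g t))"
proof -
  obtain \<I> where I: "finite \<I>" "\<And>I. I \<in> \<I> \<Longrightarrow> is_interval I" "\<Union>\<I> = dom_upto l"
     "\<And>I. I \<in> \<I> \<Longrightarrow> int_affine_on I f" "\<And>I. I \<in> \<I> \<Longrightarrow> int_affine_on I g"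
    using pw_int_affine_common2[OF assms] by blast
  let ?A = "\<lambda>I. {t\<in>I. f t \<le> g t}" and ?B = "\<lambda>I. {t\<in>I. g t \<le> f t}"
  have iv: "is_interval (?A I) \<and> is_interval (?B I)" if "I \<in> \<I>" for I
  proof -
    obtain m c m' c' where e: "\<forall>t\<in>I. f t = real_of_int m * t + c" "\<forall>t\<in>I. g t = real_of_int m' * t + c'"
      using I(4)[OF \<open>I \<in> \<I>\<close>] I(5)[OF \<open>I \<in> \<I>\<close>] unfolding int_affine_on_def by blast
    have half: "is_interval {t. a * t + b \<ge> (0::real)}" for a b
    proof -
      have "convex {t. inner a t \<ge> - b}" by (rule convex_halfspace_ge)
      moreover have "{t. inner a t \<ge> - b} = {t. a * t + b \<ge> 0}" by auto
      ultimately show ?thesis by (simp add: is_interval_convex_1)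
    qed
    have "?A I = I \<inter> {t. (real_of_int m' - m) * t + (c' - c) \<ge> 0}"
      using e by (auto simp: algebra_simps)
    moreover have "?B I = I \<inter> {t. (real_of_int m - m') * t + (c - c') \<ge> 0}"
      using e by (auto simp: algebra_simps)
    ultimately show ?thesis using is_interval_Int[OF I(2)[OF that] half] by simp
  qed
  have "finite (?A ` \<I> \<union> ?B ` \<I>)" using I by simp
  moreover have "\<forall>I\<in>?A ` \<I> \<union> ?B ` \<I>. is_interval I" using iv by blast
  moreover have "\<Union>(?A ` \<I> \<union> ?B ` \<I>) = \<Union>\<I>" (is "\<Union>?U = _")
  proof
    show "\<Union>?U \<subseteq> \<Union>\<I>" by blast
    show "\<Union>\<I> \<subseteq> \<Union>?U"
    proof
      fix t assume "t \<in> \<Union>\<I>"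
      then obtain I where "I \<in> \<I>" "t \<in> I" by blast
      then have "t \<in> ?A I \<or> t \<in> ?B I" by auto
      then show "t \<in> \<Union>?U" using \<open>I \<in> \<I>\<close> by blast
    qed
  qed
  moreover have "\<forall>I\<in>?A ` \<I> \<union> ?B ` \<I>. int_affine_on I (\<lambda>t. max (f t) (g t))"
  proof
    fix J assume "J \<in> ?A ` \<I> \<union> ?B ` \<I>"
    then obtain I where J: "I \<in> \<I>" "J = ?A I \<or> J = ?B I" by blast
    then have "int_affine_on J f" "int_affine_on J g" using I(4,5) int_affine_on_subset[of I] by auto
    moreover have "(\<forall>t\<in>J. max (f t) (g t) = f t) \<or> (\<forall>t\<in>J. max (f t) (g t) = g t)" using J by auto
    ultimately show "int_affine_on J (\<lambda>t. max (f t) (g t))"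
      using int_affine_on_cong[of J "\<lambda>t. max (f t) (g t)"] by metis
  qed
  ultimately show ?thesis unfolding pw_int_affine_def I(3)[symmetric]
    by (intro exI[of _ "?A ` \<I> \<union> ?B ` \<I>"] conjI)
qed

text \<open>Passing to closures, which continuity permits, makes each part contain its start. A part
  is coded by its start \<open>a\<close> and its length \<open>S\<close>, which may be
  \<open>0\<close> or \<open>\<infinity>\<close>; one cover serves all functions of
  \<open>H\<close>.\<close>

lemma pw_int_affine_closed_cover:
  assumes fin: "finite H" and pw: "\<And>h. h \<in> H \<Longrightarrow> pw_int_affine l h"
    and cont: "\<And>h. h \<in> H \<Longrightarrow> continuous_on (dom_upto l) h"
  obtains \<C> :: "(real \<times> ereal) set" where "finite \<C>"
    "\<And>a S. (a, S) \<in> \<C> \<Longrightarrow> 0 \<le> a \<and> 0 \<le> S \<and> ereal a + S \<le> l"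
    "\<And>a S h. (a, S) \<in> \<C> \<Longrightarrow> h \<in> H \<Longrightarrow> \<exists>(m::int) c. \<forall>t\<in>dom_upto S. h (a + t) = real_of_int m * t + c"
    "\<And>t. t \<in> dom_upto l \<Longrightarrow> \<exists>(a, S)\<in>\<C>. a \<le> t \<and> ereal (t - a) \<le> S"
proof -
  obtain \<I> where I: "finite \<I>" "\<forall>I\<in>\<I>. is_interval I" "\<Union>\<I> = dom_upto l"
     "\<forall>I\<in>\<I>. \<forall>h\<in>H. int_affine_on I h" using pw_int_affine_common[OF fin pw] by blast
  \<comment> \<open>Start and length of the closure of an interval.\<close>
  define f where "f I = (Inf I, if bdd_above I then ereal (Sup I - Inf I) else \<infinity>)" for I :: "real set"
  define \<C> where "\<C> = f ` (\<I> - {{}})"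
  have base: "I \<noteq> {}" "bdd_below I" "I \<subseteq> dom_upto l" "\<And>t. t \<in> I \<Longrightarrow> 0 \<le> t \<and> ereal t \<le> l"
      if "I \<in> \<I> - {{}}" for I
  proof -
    show "I \<noteq> {}" using that by blast
    show sub: "I \<subseteq> dom_upto l" using that I by blast
    then show "bdd_below I" by (auto simp: dom_upto_def intro!: bdd_belowI[of _ 0])
    show "\<And>t. t \<in> I \<Longrightarrow> 0 \<le> t \<and> ereal t \<le> l" using sub by (auto simp: dom_upto_def)
  qed
  \<comment> \<open>Parameters coded by \<open>f I\<close> lie in the closure of \<open>I\<close>:
    such a \<open>y\<close> is squeezed between points of \<open>I\<close> close to the infimum and
    points of \<open>I\<close> beyond \<open>y - e\<close>.\<close>
  have shift: "(\<lambda>t. Inf I + t) ` dom_upto (snd (f I)) \<subseteq> closure I" if "I \<in> \<I> - {{}}" for I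
  proof
    fix y assume "y \<in> (\<lambda>t. Inf I + t) ` dom_upto (snd (f I))"
    then obtain t where t: "y = Inf I + t" "0 \<le> t" "ereal t \<le> snd (f I)" by (auto simp: dom_upto_def)
    have up: "bdd_above I \<Longrightarrow> y \<le> Sup I" using t by (auto simp: f_def)
    have iv: "is_interval I" using that I by blast
    show "y \<in> closure I"
      unfolding closure_approachable
    proof (intro allI impI)
      fix e :: real assume e: "e > 0"
      obtain a where a: "a \<in> I" "a < Inf I + e"
        using cInf_lessD[of I "Inf I + e"] base(1)[OF \<open>I \<in> \<I> - {{}}\<close>] e by auto
      show "\<exists>x\<in>I. dist x y < e"
      proof (cases "a \<ge> y")
        case True
        then show ?thesis using a t by (auto simp: dist_real_def intro!: bexI[of _ a])
      next
        case False
        obtain b where b: "b \<in> I" "b > y - e"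
        proof (cases "bdd_above I")
          case True
          then have "y - e < Sup I" using up e by force
          then show ?thesis using less_cSupD[of I "y - e"] base(1)[OF \<open>I \<in> \<I> - {{}}\<close>] that by blast
        next
          case False
          then obtain b where "b \<in> I" "\<not> b \<le> y - e" unfolding bdd_above_def by blast
          then show ?thesis using that by force
        qed
        show ?thesis
        proof (cases "b \<ge> y")
          case True
          then have "y \<in> I" using iv a b False unfolding is_interval_1 by (meson not_le less_imp_le)
          then show ?thesis using e by (intro bexI[of _ y]) auto
        next
          case False
          then show ?thesis using b by (auto simp: dist_real_def intro!: bexI[of _ b])
        qed
      qed
    qed
  qed
  show thesis
  proof (rule that[of \<C>])
    show "finite \<C>" using I by (simp add: \<C>_def)
    show "0 \<le> a \<and> 0 \<le> S \<and> ereal a + S \<le> l" if aS: "(a, S) \<in> \<C>" for a S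
    proof -
      obtain i where i: "i \<in> \<I> - {{}}" "a = Inf i" "S = snd (f i)" using aS by (auto simp: \<C>_def f_def)
      obtain x where x: "x \<in> i" using i by blast
      have "0 \<le> a" unfolding i(2) using base[OF i(1)] by (intro cInf_greatest) auto
      moreover have "0 \<le> S \<and> ereal a + S \<le> l"
      proof (cases "bdd_above i")
        case True
        have "Inf i \<le> x" "x \<le> Sup i" using x True base[OF i(1)] by (auto intro: cInf_lower cSup_upper)
        moreover have "ereal (Sup i) \<le> l"
        proof (cases l)
          case (real r)
          then have "\<And>t. t \<in> i \<Longrightarrow> t \<le> r" using base(4)[OF i(1)] by auto
          then show ?thesis using real base(1)[OF i(1)] by (auto intro: cSup_least)
        next
          case MInf
          then show ?thesis using base(4)[OF i(1) x] by auto
        qed auto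
        ultimately show ?thesis using True i by (auto simp: f_def)
      next
        case False
        have "l = \<infinity>"
        proof (rule ccontr)
          assume "l \<noteq> \<infinity>"
          moreover have "l \<noteq> -\<infinity>" using base(4)[OF i(1) x] by auto
          ultimately obtain r where r: "l = ereal r" by (cases l) auto
          then have "bdd_above i" using base(4)[OF i(1)] by (auto intro!: bdd_aboveI[of _ r])
          then show False using False by blast
        qed
        then show ?thesis using False i by (auto simp: f_def)
      qed
      ultimately show ?thesis by blast
    qed
    show "\<exists>(m::int) c. \<forall>t\<in>dom_upto S. h (a + t) = real_of_int m * t + c" if aS: "(a, S) \<in> \<C>" and h: "h \<in> H" for a S h
    proof -
      obtain i where i: "i \<in> \<I> - {{}}" "a = Inf i" "S = snd (f i)" using aS by (auto simp: \<C>_def f_def)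
      then obtain m c where mc: "\<forall>t\<in>i. h t = real_of_int m * t + c" using I(4) h unfolding int_affine_on_def by blast
      have clo: "closure i \<subseteq> dom_upto l" using base(3)[OF i(1)] closed_dom_upto by (rule closure_minimal)
      \<comment> \<open>The difference from the affine function vanishes on \<open>i\<close>, hence
        by continuity on the closure of \<open>i\<close>.\<close>
      have "h y - (real_of_int m * y + c) \<in> {0}" if "y \<in> closure i" for y
      proof (rule image_closure_subset[THEN subsetD, OF _ _ _ imageI[OF that]])
        show "continuous_on (closure i) (\<lambda>y. h y - (real_of_int m * y + c))"
          by (intro continuous_intros continuous_on_subset[OF cont[OF h] clo])
      qed (use mc in auto)
      then have "h y = real_of_int m * y + c" if "y \<in> closure i" for y using that by auto
      then have "\<forall>t\<in>dom_upto S. h (a + t) = real_of_int m * t + (real_of_int m * a + c)"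
        using shift[OF i(1)] i by (auto simp: algebra_simps image_subset_iff)
      then show ?thesis by blast
    qed
    show "\<exists>(a, S)\<in>\<C>. a \<le> t \<and> ereal (t - a) \<le> S" if t: "t \<in> dom_upto l" for t
    proof -
      obtain i where i: "i \<in> \<I> - {{}}" "t \<in> i" using I(3) t by blast
      have "Inf i \<le> t" using i base[OF i(1)] by (auto intro: cInf_lower)
      moreover have "ereal (t - Inf i) \<le> snd (f i)" using i by (auto simp: f_def intro: cSup_upper)
      ultimately show ?thesis using i unfolding \<C>_def by (intro bexI[of _ "f i"]) (auto simp: f_def)
    qed
  qed
qed

text \<open>One of finitely many intervals covering the half-line is unbounded, and such an interval
  contains a terminal half-line.\<close>

lemma pw_int_affine_eventually:
  assumes "pw_int_affine \<infinity> h"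
  obtains m :: int and c where "\<forall>\<^sub>F t in at_top. h t = real_of_int m * t + c"
proof -
  obtain \<I> where I: "finite \<I>" "\<forall>I\<in>\<I>. is_interval I" "\<Union>\<I> = dom_upto \<infinity>"
     "\<forall>I\<in>\<I>. int_affine_on I h" using assms unfolding pw_int_affine_def by blast
  have "\<exists>I\<in>\<I>. \<not> bdd_above I"
  proof (rule ccontr)
    assume "\<not> ?thesis"
    then have "bdd_above (dom_upto \<infinity>)" using I(1) unfolding I(3)[symmetric] using bdd_above_UN[OF I(1), of "\<lambda>x. x"] by simp
    then obtain M where "\<forall>x\<in>dom_upto \<infinity>. x \<le> M" unfolding bdd_above_def by blast
    moreover have "max 0 (M + 1) \<in> dom_upto \<infinity>" by (simp add: dom_upto_def)
    ultimately have "max 0 (M + 1) \<le> M" by blast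
    then show False by simp
  qed
  then obtain J where J: "J \<in> \<I>" "\<not> bdd_above J" by auto
  then have "J \<noteq> {}" by auto
  then obtain x where x: "x \<in> J" by blast
  have "t \<in> J" if "t \<ge> x" for t
  proof -
    obtain y where "y \<in> J" "y > t" using J(2) unfolding bdd_above_def by (meson not_le)
    moreover have "is_interval J" using I(2) J(1) by blast
    ultimately show ?thesis using x that less_imp_le[of t y] unfolding is_interval_1 by blast
  qed
  moreover obtain m c where "\<forall>t\<in>J. h t = real_of_int m * t + c"
    using I(4) J(1) unfolding int_affine_on_def by blast
  ultimately have "\<forall>\<^sub>F t in at_top. h t = real_of_int m * t + c"
    unfolding eventually_at_top_linorder by (intro exI[of _ x]) simp
  then show thesis by (rule that)
qed

section \<open>Segments and rays with primitive directions\<close>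

abbreviation rvec :: "int^'n::finite \<Rightarrow> real^'n" where
  "rvec u \<equiv> (\<chi> i. real_of_int (u $ i))"

text \<open>Bezout form of the condition that the entries have greatest common divisor one. The
  witness is an integral functional with value 1 on \<open>u\<close>, and this is how primitivity is
  applied.\<close>

definition primitive :: "int^'n::finite \<Rightarrow> bool" where
  "primitive u \<longleftrightarrow> (\<exists>a :: int^'n. (\<Sum>i\<in>UNIV. a $ i * u $ i) = 1)"

lemma primitive_nonzero: "primitive u \<Longrightarrow> u \<noteq> 0"
  unfolding primitive_def by auto

lemma primitive_axis: "primitive (axis i 1)"
  unfolding primitive_def by (rule exI[of _ "axis i 1"]) (simp add: axis_def if_distrib cong: if_cong)

lemma primitive_uminus: "primitive u \<Longrightarrow> primitive (- u)"
  unfolding primitive_def by (metis (no_types, lifting) minus_mult_minus sum.cong vector_uminus_component)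

lemma iprod_rvec: "iprod a (rvec u) = real_of_int (\<Sum>i\<in>UNIV. a $ i * u $ i)"
  by (simp add: iprod_def)

lemma iprod_rvec_pos: "u \<noteq> 0 \<Longrightarrow> iprod u (rvec u) > 0"
proof -
  assume "u \<noteq> 0"
  then obtain i where "u $ i \<noteq> 0" by (auto simp: vec_eq_iff)
  then have "0 < (\<Sum>i\<in>UNIV. u $ i * u $ i)"
    by (intro sum_pos2[of _ i]) (auto simp: zero_less_mult_iff)
  then show ?thesis unfolding iprod_rvec by (simp only: of_int_0_less_iff)
qed

lemma rvec_eq_0_iff: "rvec u = 0 \<longleftrightarrow> u = 0"
  by (simp add: vec_eq_iff)

lemma rvec_uminus: "rvec (- u) = - rvec u"
  by (simp add: vec_eq_iff)

text \<open>The divisor is the least positive integer combination of the entries.\<close>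

lemma primitive_direction:
  assumes "u \<noteq> 0"
  obtains d :: int and v where "d > 0" "primitive v" "rvec u = of_int d *\<^sub>R rvec v"
proof -
  define S where "S = {k :: nat. k > 0 \<and> (\<exists>a :: int^'a. int k = (\<Sum>i\<in>UNIV. a $ i * u $ i))}"
  have "real_of_int (\<Sum>i\<in>UNIV. u $ i * u $ i) > 0" using iprod_rvec_pos[OF assms] by (simp only: iprod_rvec)
  then have "(\<Sum>i\<in>UNIV. u $ i * u $ i) > 0" by (simp only: of_int_0_less_iff)
  then have "nat (\<Sum>i\<in>UNIV. u $ i * u $ i) \<in> S" unfolding S_def
    by (intro CollectI conjI exI[of _ u]) simp_all
  then have S: "(LEAST k. k \<in> S) \<in> S" by (rule LeastI)
  define k where "k = (LEAST k. k \<in> S)"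
  obtain a :: "int^'a" where a: "int k = (\<Sum>i\<in>UNIV. a $ i * u $ i)" and k: "k > 0"
    using S unfolding k_def[symmetric] unfolding S_def by blast
  have dvd: "int k dvd u $ j" for j
  proof (rule ccontr)
    assume nd: "\<not> int k dvd u $ j"
    define r where "r = u $ j mod int k"
    have "r \<noteq> 0" using nd unfolding r_def by (metis dvd_eq_mod_eq_0)
    moreover have "0 \<le> r" "r < int k" using k unfolding r_def by simp_all
    ultimately have r: "0 < r" "r < int k" by simp_all
    \<comment> \<open>The remainder of \<open>u $ j\<close> is again an integer combination of the
      entries, positive and less than \<open>k\<close>, against the minimality of
      \<open>k\<close>.\<close>
    have "r = u $ j - u $ j div int k * (\<Sum>i\<in>UNIV. a $ i * u $ i)"
      unfolding r_def a[symmetric] by (simp add: minus_div_mult_eq_mod)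
    also have "\<dots> = (\<Sum>i\<in>UNIV. (axis j 1 :: int^'a) $ i * u $ i) - (\<Sum>i\<in>UNIV. (u $ j div int k * a $ i) * u $ i)"
    proof -
      have "u $ j = (\<Sum>i\<in>UNIV. if i = j then u $ i else 0)" by simp
      also have "\<dots> = (\<Sum>i\<in>UNIV. (axis j 1 :: int^'a) $ i * u $ i)"
        by (rule sum.cong) (auto simp: axis_def)
      finally show ?thesis by (simp only: sum_distrib_left mult.assoc)
    qed
    also have "\<dots> = (\<Sum>i\<in>UNIV. (\<chi> i. axis j 1 $ i - u $ j div int k * a $ i) $ i * u $ i)"
      by (simp only: sum_subtractf[symmetric] left_diff_distrib vec_lambda_beta)
    finally have e: "r = (\<Sum>i\<in>UNIV. (\<chi> i. axis j 1 $ i - u $ j div int k * a $ i) $ i * u $ i)" .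
    have "nat r \<in> S" unfolding S_def
    proof (intro CollectI conjI exI)
      show "int (nat r) = (\<Sum>i\<in>UNIV. (\<chi> i. axis j 1 $ i - u $ j div int k * a $ i) $ i * u $ i)"
        using r e by simp
    qed (use r in simp)
    then have "k \<le> nat r" unfolding k_def by (rule Least_le)
    then show False using r by simp
  qed
  define v where "v = (\<chi> i. u $ i div int k)"
  have uv: "u $ i = int k * v $ i" for i using dvd[of i] by (simp add: v_def)
  have "int k * 1 = int k * (\<Sum>i\<in>UNIV. a $ i * v $ i)"
    using a uv by (simp add: sum_distrib_left mult_ac)
  then have "primitive v" unfolding primitive_def using k by (intro exI[of _ a]) simp
  moreover have "rvec u = of_int (int k) *\<^sub>R rvec v" using uv by (simp add: vec_eq_iff)
  ultimately show thesis using that[of "int k" v] k by simp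
qed

text \<open>The Bezout witness of \<open>u\<close> turns the vanishing minors into
  \<open>v = k * u\<close> with an integer \<open>k\<close>; the witness of \<open>v\<close> makes
  \<open>k\<close> a divisor of 1, and the positive scalar product excludes
  \<open>-1\<close>.\<close>

lemma primitive_collinear_eq:
  assumes "primitive u" "primitive v"
    and eq: "\<And>i j. u $ j * v $ i = u $ i * v $ j" and pos: "iprod u (rvec v) > 0"
  shows "u = v"
proof -
  obtain a where a: "(\<Sum>i\<in>UNIV. a $ i * u $ i) = 1" using assms unfolding primitive_def by blast
  obtain b where b: "(\<Sum>i\<in>UNIV. b $ i * v $ i) = 1" using assms unfolding primitive_def by blast
  define k where "k = (\<Sum>i\<in>UNIV. a $ i * v $ i)"
  have v: "v $ j = k * u $ j" for j
  proof -
    have "v $ j = (\<Sum>i\<in>UNIV. a $ i * u $ i) * v $ j" using a by simp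
    also have "\<dots> = (\<Sum>i\<in>UNIV. a $ i * (u $ i * v $ j))" by (simp add: sum_distrib_right mult.assoc)
    also have "\<dots> = (\<Sum>i\<in>UNIV. a $ i * (u $ j * v $ i))" by (simp only: eq)
    also have "\<dots> = k * u $ j" unfolding k_def sum_distrib_right by (rule sum.cong) (simp_all add: mult_ac)
    finally show ?thesis .
  qed
  have "k * (\<Sum>i\<in>UNIV. b $ i * u $ i) = 1"
    using b v by (simp add: sum_distrib_left mult_ac)
  then have "k = 1 \<or> k = -1" by (metis zmult_eq_1_iff)
  moreover have "iprod u (rvec v) = of_int k * iprod u (rvec u)"
    by (simp add: iprod_def v sum_distrib_left mult_ac)
  ultimately have "k = 1" using pos iprod_rvec_pos[OF primitive_nonzero[OF assms(1)]] by auto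
  then show ?thesis using v by (simp add: vec_eq_iff)
qed

definition seg :: "real^'n::finite \<Rightarrow> int^'n \<Rightarrow> ereal \<Rightarrow> (real^'n) set" where
  "seg p u T = (\<lambda>t. p + t *\<^sub>R rvec u) ` dom_upto T"

text \<open>The functional sending \<open>x\<close> to a 2 by 2 minor of the pair of
  \<open>u\<close> and \<open>x\<close>. For nonzero \<open>u\<close> the common zeros of all of
  them are the multiples of \<open>u\<close>.\<close>

definition minor :: "int^'n::finite \<Rightarrow> 'n \<Rightarrow> 'n \<Rightarrow> int^'n" where
  "minor u i j = u $ j *s axis i 1 - u $ i *s axis j 1"

text \<open>A row \<open>(a, b)\<close> stands for the inequality \<open>b \<le> iprod a x\<close>.
  The minors for \<open>(i, j)\<close> and \<open>(j, i)\<close> are negatives of each other, so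
  their rows together are equations of the line. The row of \<open>u\<close> bounds the start; the
  last row, absent for a ray, bounds the far end.\<close>

definition seg_rows :: "real^'n::finite \<Rightarrow> int^'n \<Rightarrow> ereal \<Rightarrow> ((int^'n) \<times> real) set" where
  "seg_rows p u T = (\<lambda>a. (a, iprod a p)) ` insert u ((\<lambda>(i, j). minor u i j) ` UNIV) \<union>
     (if T = \<infinity> then {} else {(- u, - iprod u p - real_of_ereal T * iprod u (rvec u))})"

text \<open>This is w_A of the overview. It is a rational function because the rows have integral
  functionals.\<close>

definition seg_gap :: "real^'n::finite \<Rightarrow> int^'n \<Rightarrow> ereal \<Rightarrow> real^'n \<Rightarrow> real" where
  "seg_gap p u T x = Max (insert 0 ((\<lambda>(a, b). b - iprod a x) ` seg_rows p u T))"

lemma iprod_minor: "iprod (minor u i j) x = of_int (u $ j) * x $ i - of_int (u $ i) * x $ j"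
proof -
  have "iprod (minor u i j) x
    = (\<Sum>k\<in>UNIV. (if k = i then of_int (u $ j) * x $ k else 0) - (if k = j then of_int (u $ i) * x $ k else 0))"
    unfolding iprod_def minor_def by (rule sum.cong) (auto simp: axis_def algebra_simps)
  then show ?thesis by (simp add: sum_subtractf)
qed

lemma finite_seg_rows: "finite (seg_rows p u T)"
  unfolding seg_rows_def by simp

lemma seg_gap_nonneg: "0 \<le> seg_gap p u T x"
  unfolding seg_gap_def using finite_seg_rows by (intro Max_ge) auto

lemma seg_gap_ge: "(a, b) \<in> seg_rows p u T \<Longrightarrow> b - iprod a x \<le> seg_gap p u T x"
  unfolding seg_gap_def using finite_seg_rows by (intro Max_ge) (auto intro: rev_image_eqI)

lemma seg_gap_le_0_iff: "seg_gap p u T x \<le> 0 \<longleftrightarrow> (\<forall>(a, b)\<in>seg_rows p u T. b \<le> iprod a x)"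
  unfolding seg_gap_def using finite_seg_rows by (subst Max_le_iff) auto

lemma PL_seg_gap: "seg_gap p u T \<in> PL"
proof -
  have "seg_gap p u T = (\<lambda>x. Max ((\<lambda>r. (\<lambda>(a, b) x. b - iprod a x) r x) ` (insert (0, 0) (seg_rows p u T))))"
    unfolding seg_gap_def by (simp add: case_prod_unfold)
  also have "\<dots> \<in> PL"
  proof (rule PL_Max)
    fix r :: "(int^'a) \<times> real"
    obtain a b where r: "r = (a, b)" by (cases r)
    show "(case r of (a, b) \<Rightarrow> \<lambda>x. b - iprod a x) \<in> PL"
      using PL_affine[of b "- a"] by (simp add: r iprod_minus_left)
  qed (use finite_seg_rows in auto)
  finally show ?thesis .
qed

lemma seg_gap_on_seg:
  assumes "x \<in> seg p u T"
  shows "seg_gap p u T x = 0"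
proof -
  obtain t where t: "0 \<le> t" "ereal t \<le> T" "x = p + t *\<^sub>R rvec u"
    using assms by (auto simp: seg_def dom_upto_def)
  have N: "0 \<le> iprod u (rvec u)" by (cases "u = 0") (auto dest: iprod_rvec_pos)
  have "b \<le> iprod a x" if "(a, b) \<in> seg_rows p u T" for a b
  proof -
    have disj: "a = u \<and> b = iprod u p \<or> (\<exists>i j. a = minor u i j \<and> b = iprod a p) \<or>
         (T \<noteq> \<infinity> \<and> a = - u \<and> b = - iprod u p - real_of_ereal T * iprod u (rvec u))"
      using that unfolding seg_rows_def by (auto split: if_splits)
    consider "a = u" "b = iprod u p"
      | i j where "a = minor u i j" "b = iprod a p"
      | "T \<noteq> \<infinity>" "a = - u" "b = - iprod u p - real_of_ereal T * iprod u (rvec u)"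
      using disj by blast
    then show ?thesis
    proof cases
      case 1
      then show ?thesis using t N by (simp add: iprod_add_right iprod_scaleR_right)
    next
      case 2
      \<comment> \<open>A minor vanishes on \<open>u\<close> itself, so its row is constant along
        the segment.\<close>
      then have "iprod a (rvec u) = 0" by (simp only: iprod_minor) simp
      then show ?thesis using 2 t by (simp add: iprod_add_right iprod_scaleR_right)
    next
      case 3
      then have "t \<le> real_of_ereal T" using t by (cases T) auto
      then have "t * iprod u (rvec u) \<le> real_of_ereal T * iprod u (rvec u)" using N by (rule mult_right_mono)
      then show ?thesis using 3 t by (simp add: iprod_add_right iprod_scaleR_right iprod_minus_left)
    qed
  qed
  then have "seg_gap p u T x \<le> 0" unfolding seg_gap_le_0_iff by blast
  then show ?thesis using seg_gap_nonneg[of p u T x] by simp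
qed

text \<open>A bound of Hoffman type.\<close>

lemma seg_gap_dist:
  assumes u: "u \<noteq> 0" and T: "0 \<le> T"
  obtains C where "C \<ge> 0" "\<And>x. \<exists>y\<in>seg p u T. dist x y \<le> C * seg_gap p u T x"
proof -
  define N where "N = iprod u (rvec u)"
  define U where "U = (\<Sum>i\<in>UNIV. \<bar>real_of_int (u $ i)\<bar>)"
  have N: "N > 0" unfolding N_def using u by (rule iprod_rvec_pos)
  have Nsum: "N = (\<Sum>j\<in>UNIV. of_int (u $ j) * of_int (u $ j))" by (simp add: N_def iprod_def)
  have U: "U \<ge> 0" by (simp add: U_def sum_nonneg)
  \<comment> \<open>Each of the \<open>CARD('a)\<close> coordinates contributes at most
    \<open>U / N\<close> for the distance to the line, and clamping the parameter adds
    \<open>U / N\<close> in total.\<close>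
  define C where "C = (of_nat CARD('a) * U + U) / N"
  have C: "C \<ge> 0" unfolding C_def using N U by simp
  have "\<exists>y\<in>seg p u T. dist x y \<le> C * seg_gap p u T x" for x
  proof -
    define D where "D = seg_gap p u T x"
    have D: "D \<ge> 0" unfolding D_def by (rule seg_gap_nonneg)
    define w where "w = x - p"
    define t where "t = iprod u w / N"
    \<comment> \<open>\<open>t\<close> is the parameter of the orthogonal projection of
      \<open>x\<close> to the line; \<open>s\<close> clamps it to the segment.\<close>
    define s where "s = max 0 (if T = \<infinity> then t else min t (real_of_ereal T))"
    have s_in: "p + s *\<^sub>R rvec u \<in> seg p u T"
      using T unfolding seg_def dom_upto_def by (cases T) (auto simp: s_def)
    have rows: "b - iprod a x \<le> D" if "(a, b) \<in> seg_rows p u T" for a b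
      unfolding D_def using that by (rule seg_gap_ge)
    have "iprod u p - iprod u x \<le> D" by (rule rows) (auto simp: seg_rows_def)
    then have "- (t * N) \<le> D" using N by (simp add: t_def w_def iprod_diff_right)
    then have lo: "- t \<le> D / N" using N by (simp add: field_simps)
    have hi: "t - real_of_ereal T \<le> D / N" if "T \<noteq> \<infinity>"
    proof -
      have "(- iprod u p - real_of_ereal T * iprod u (rvec u)) - iprod (- u) x \<le> D"
        by (rule rows) (use that in \<open>auto simp: seg_rows_def\<close>)
      then have "t * N - real_of_ereal T * N \<le> D"
        using N by (simp add: t_def w_def iprod_diff_right iprod_minus_left N_def)
      then have "(t - real_of_ereal T) * N \<le> D" by (simp add: left_diff_distrib)
      then show ?thesis using N by (simp add: pos_le_divide_eq)
    qed
    have DN: "0 \<le> D / N" using D N by simp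
    have "T \<noteq> \<infinity> \<Longrightarrow> 0 \<le> real_of_ereal T" using T by (simp add: real_of_ereal_pos)
    then have st: "\<bar>t - s\<bar> \<le> D / N" using lo hi DN by (auto simp: s_def)
    \<comment> \<open>The rows for both orders of the indices give the two signs of the absolute
      value.\<close>
    have minor: "\<bar>of_int (u $ j) * w $ i - of_int (u $ i) * w $ j\<bar> \<le> D" for i j
    proof -
      have "iprod a p - iprod a x \<le> D" if "a = minor u i j" for a i j
        by (rule rows) (use that in \<open>force simp: seg_rows_def\<close>)
      from this[OF refl, of j i] this[OF refl, of i j] show ?thesis
        unfolding iprod_minor w_def by (simp add: algebra_simps abs_le_iff)
    qed
    have comp: "\<bar>(w - t *\<^sub>R rvec u) $ i\<bar> \<le> D * U / N" for i
    proof -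
      have "t * N = iprod u w" using N by (simp add: t_def)
      then have "N * (w - t *\<^sub>R rvec u) $ i = N * w $ i - of_int (u $ i) * iprod u w"
        by (simp add: right_diff_distrib mult_ac)
      \<comment> \<open>Lagrange's identity: \<open>N\<close> times the component orthogonal to
        \<open>u\<close> is a combination of minors.\<close>
      also have "\<dots> = (\<Sum>j\<in>UNIV. of_int (u $ j) * (of_int (u $ j) * w $ i - of_int (u $ i) * w $ j))"
        unfolding Nsum iprod_def
        by (simp add: sum_distrib_left sum_distrib_right right_diff_distrib sum_subtractf mult_ac)
      finally have "N * \<bar>(w - t *\<^sub>R rvec u) $ i\<bar> = \<bar>\<Sum>j\<in>UNIV. of_int (u $ j) * (of_int (u $ j) * w $ i - of_int (u $ i) * w $ j)\<bar>"
        using N by (metis abs_mult abs_of_pos)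
      also have "\<dots> \<le> (\<Sum>j\<in>UNIV. \<bar>of_int (u $ j) * (of_int (u $ j) * w $ i - of_int (u $ i) * w $ j)\<bar>)"
        by (rule sum_abs)
      also have "\<dots> \<le> (\<Sum>j\<in>UNIV. \<bar>of_int (u $ j)\<bar> * D)"
        by (intro sum_mono) (simp only: abs_mult, intro mult_left_mono minor abs_ge_zero)
      also have "\<dots> = D * U" by (simp add: U_def sum_distrib_left mult.commute)
      finally show ?thesis using N by (simp add: pos_le_divide_eq mult.commute)
    qed
    have "dist x (p + s *\<^sub>R rvec u) \<le> (\<Sum>i\<in>UNIV. \<bar>(x - (p + s *\<^sub>R rvec u)) $ i\<bar>)"
      unfolding dist_norm by (rule norm_le_l1_cart)
    also have "\<dots> \<le> (\<Sum>i\<in>(UNIV :: 'a set). D * U / N + D / N * \<bar>real_of_int (u $ i)\<bar>)"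
    proof (rule sum_mono)
      fix i
      have "(x - (p + s *\<^sub>R rvec u)) $ i = (w - t *\<^sub>R rvec u) $ i + (t - s) * of_int (u $ i)"
        by (simp add: w_def algebra_simps)
      then have "\<bar>(x - (p + s *\<^sub>R rvec u)) $ i\<bar> \<le> \<bar>(w - t *\<^sub>R rvec u) $ i\<bar> + \<bar>t - s\<bar> * \<bar>real_of_int (u $ i)\<bar>"
        by (metis abs_mult abs_triangle_ineq)
      also have "\<dots> \<le> D * U / N + D / N * \<bar>real_of_int (u $ i)\<bar>"
        by (intro add_mono comp mult_right_mono st abs_ge_zero)
      finally show "\<bar>(x - (p + s *\<^sub>R rvec u)) $ i\<bar> \<le> D * U / N + D / N * \<bar>real_of_int (u $ i)\<bar>" .
    qed
    also have "\<dots> = of_nat CARD('a) * (D * U / N) + D / N * U"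
      by (simp only: sum.distrib sum_constant sum_distrib_left[symmetric] U_def[symmetric])
    also have "\<dots> = C * D"
      using N by (simp add: C_def field_simps)
    finally show ?thesis using s_in unfolding D_def by (intro bexI)
  qed
  then show thesis by (rule that[OF C])
qed

lemma seg_eq_gap:
  assumes "u \<noteq> 0" "0 \<le> T"
  shows "seg p u T = {x. seg_gap p u T x \<le> 0}"
proof -
  obtain C where C: "C \<ge> 0" "\<And>x. \<exists>y\<in>seg p u T. dist x y \<le> C * seg_gap p u T x"
    using seg_gap_dist[OF assms] by blast
  have "x \<in> seg p u T" if "seg_gap p u T x \<le> 0" for x
  proof -
    obtain y where "y \<in> seg p u T" "dist x y \<le> C * seg_gap p u T x" using C by blast
    moreover have "C * seg_gap p u T x \<le> 0" using that C(1) by (simp add: mult_nonneg_nonpos)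
    ultimately have "dist x y \<le> 0" by linarith
    then show ?thesis using \<open>y \<in> seg p u T\<close> by simp
  qed
  then show ?thesis using seg_gap_on_seg by fastforce
qed

text \<open>If the gap is bounded along a ray, no row can be violated more and more, so every row
  functional is nonnegative on \<open>v\<close>. For the minors in both orders this gives
  collinearity, the row of \<open>u\<close> fixes the sign, and a row for a far end would contradict
  that sign.\<close>

lemma seg_gap_bounded_along:
  assumes u: "primitive u" and v: "primitive v"
    and bound: "\<And>s. s \<ge> 0 \<Longrightarrow> seg_gap p u T (q + s *\<^sub>R rvec v) \<le> K"
  shows "T = \<infinity> \<and> u = v"
proof -
  have pos: "iprod a (rvec v) \<ge> 0" if "(a, b) \<in> seg_rows p u T" for a b
  proof (rule ccontr)
    assume n: "\<not> ?thesis"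
    \<comment> \<open>At this parameter the row \<open>(a, b)\<close> would be violated by at least
      \<open>K + 1\<close>.\<close>
    define s where "s = (\<bar>K - b + iprod a q\<bar> + 1) / - iprod a (rvec v)"
    have "s \<ge> 0" unfolding s_def using n by (intro divide_nonneg_pos) auto
    moreover have "s * (- iprod a (rvec v)) = \<bar>K - b + iprod a q\<bar> + 1" using n by (simp add: s_def)
    ultimately have s: "s \<ge> 0" "s * (- iprod a (rvec v)) = \<bar>K - b + iprod a q\<bar> + 1" by blast+
    have "b - iprod a (q + s *\<^sub>R rvec v) \<le> K" using bound[OF s(1)] seg_gap_ge[OF that] order_trans by blast
    then show False using s(2) by (simp add: iprod_add_right iprod_scaleR_right)
  qed
  have eq: "u $ j * v $ i = u $ i * v $ j" for i j
  proof -
    have "iprod (minor u i j) (rvec v) \<ge> 0" for i j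
      by (rule pos[of _ "iprod (minor u i j) p"]) (force simp: seg_rows_def)
    from this[of j i] this[of i j] have "real_of_int (u $ j * v $ i) = real_of_int (u $ i * v $ j)"
      unfolding iprod_minor by simp
    then show ?thesis by (simp only: of_int_eq_iff)
  qed
  have uv: "iprod u (rvec v) \<ge> 0" by (rule pos[of _ "iprod u p"]) (simp add: seg_rows_def)
  have "iprod u (rvec v) \<noteq> 0"
  proof
    assume 0: "iprod u (rvec v) = 0"
    \<comment> \<open>Summing the vanishing minors against \<open>u\<close> expresses
      \<open>v\<close> through \<open>u\<close>; with scalar product zero this would give
      \<open>v = 0\<close>.\<close>
    have "iprod u (rvec u) * real_of_int (v $ i) = iprod u (rvec v) * real_of_int (u $ i)" for i
    proof -
      have "real_of_int (u $ j) * real_of_int (v $ i) = real_of_int (u $ i) * real_of_int (v $ j)" for j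
        using eq[of j i] by (metis of_int_mult)
      then have "real_of_int (u $ j) * real_of_int (u $ j) * real_of_int (v $ i) =
          real_of_int (u $ j) * real_of_int (v $ j) * real_of_int (u $ i)" for j
        by (metis mult.assoc mult.commute)
      then show ?thesis unfolding iprod_def sum_distrib_right by (intro sum.cong) (simp_all only: vec_lambda_beta)
    qed
    then have "v = 0" using 0 iprod_rvec_pos[OF primitive_nonzero[OF u]] by (simp add: vec_eq_iff)
    then show False using primitive_nonzero[OF v] by simp
  qed
  then have uv: "iprod u (rvec v) > 0" using uv by simp
  have "T = \<infinity>"
  proof (rule ccontr)
    assume "T \<noteq> \<infinity>"
    then have "iprod (- u) (rvec v) \<ge> 0" by (intro pos) (auto simp: seg_rows_def)
    then show False using uv by (simp add: iprod_minus_left)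
  qed
  then show ?thesis using primitive_collinear_eq[OF u v eq uv] by simp
qed

section \<open>Extension of piecewise affine functions from a union of segments\<close>

lemma PL_along_line:
  assumes "h \<in> PL"
  shows "pw_int_affine l (\<lambda>t. h (p + t *\<^sub>R rvec u))"
  using assms
proof (induction rule: PL_induct)
  case (const c)
  show ?case by (rule pw_int_affine_const)
next
  case (coord i)
  show ?case using pw_int_affineI_affine[of l "u $ i" "p $ i"] by (simp add: add.commute mult.commute)
qed (auto intro: pw_int_affine_add pw_int_affine_uminus pw_int_affine_max)

text \<open>The order of quantifiers is the point: the slope depends on the direction
  \<open>u\<close> but not on the start \<open>p\<close>. Hence a rational function has equal slopes
  along rays of equal direction, as parallel rays demand.\<close>

lemma PL_slope_at_infinity:
  assumes "h \<in> PL"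
  shows "\<exists>m::int. \<forall>p. \<exists>c. \<forall>\<^sub>F t in at_top. h (p + t *\<^sub>R rvec u) = real_of_int m * t + c"
  using assms
proof (induction rule: PL_induct)
  case (const c)
  show ?case by (intro exI[of _ 0] allI exI[of _ c]) simp
next
  case (coord i)
  show ?case by (intro exI[of _ "u $ i"] allI, rule exI[of _ "_ $ i"]) (simp add: mult.commute)
next
  case (add f g)
  obtain m where m: "\<And>p. \<exists>c. \<forall>\<^sub>F t in at_top. f (p + t *\<^sub>R rvec u) = real_of_int m * t + c" using add by blast
  obtain n where n: "\<And>p. \<exists>c. \<forall>\<^sub>F t in at_top. g (p + t *\<^sub>R rvec u) = real_of_int n * t + c" using add by blast
  show ?case
  proof (intro exI[of _ "m + n"] allI)
    fix p
    obtain c where c: "\<forall>\<^sub>F t in at_top. f (p + t *\<^sub>R rvec u) = real_of_int m * t + c" using m by blast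
    obtain d where d: "\<forall>\<^sub>F t in at_top. g (p + t *\<^sub>R rvec u) = real_of_int n * t + d" using n by blast
    have "\<forall>\<^sub>F t in at_top. f (p + t *\<^sub>R rvec u) + g (p + t *\<^sub>R rvec u) = real_of_int (m + n) * t + (c + d)"
      using c d by eventually_elim (simp add: algebra_simps)
    then show "\<exists>c. \<forall>\<^sub>F t in at_top. f (p + t *\<^sub>R rvec u) + g (p + t *\<^sub>R rvec u) = real_of_int (m + n) * t + c" by (rule exI)
  qed
next
  case (uminus f)
  obtain m where m: "\<And>p. \<exists>c. \<forall>\<^sub>F t in at_top. f (p + t *\<^sub>R rvec u) = real_of_int m * t + c" using uminus by blast
  show ?case
  proof (intro exI[of _ "- m"] allI)
    fix p
    obtain c where c: "\<forall>\<^sub>F t in at_top. f (p + t *\<^sub>R rvec u) = real_of_int m * t + c" using m by blast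
    have "\<forall>\<^sub>F t in at_top. - f (p + t *\<^sub>R rvec u) = real_of_int (- m) * t + (- c)"
      using c by eventually_elim simp
    then show "\<exists>c. \<forall>\<^sub>F t in at_top. - f (p + t *\<^sub>R rvec u) = real_of_int (- m) * t + c" by (rule exI)
  qed
next
  case (max f g)
  \<comment> \<open>Different integer slopes differ by at least 1, so for nonnegative parameters the
    steeper function is ahead from \<open>d - c\<close> on.\<close>
  have aux: "\<forall>\<^sub>F t in at_top. real_of_int m * t + c \<ge> real_of_int n * t + d" if "m > n" for m n :: int and c d
  proof (rule eventually_at_top_linorderI[of "max 0 (d - c)"])
    fix t assume t: "max 0 (d - c) \<le> t"
    have "t \<le> real_of_int (m - n) * t" using that t by (simp add: mult_le_cancel_right1)
    then show "real_of_int n * t + d \<le> real_of_int m * t + c" using t by (simp add: algebra_simps)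
  qed
  obtain m where m: "\<And>p. \<exists>c. \<forall>\<^sub>F t in at_top. f (p + t *\<^sub>R rvec u) = real_of_int m * t + c" using max by blast
  obtain n where n: "\<And>p. \<exists>c. \<forall>\<^sub>F t in at_top. g (p + t *\<^sub>R rvec u) = real_of_int n * t + c" using max by blast
  show ?case
  proof (intro exI[of _ "max m n"] allI)
    fix p
    obtain c where c: "\<forall>\<^sub>F t in at_top. f (p + t *\<^sub>R rvec u) = real_of_int m * t + c" using m by blast
    obtain d where d: "\<forall>\<^sub>F t in at_top. g (p + t *\<^sub>R rvec u) = real_of_int n * t + d" using n by blast
    consider "m > n" | "n > m" | "m = n" by linarith
    then show "\<exists>c. \<forall>\<^sub>F t in at_top. max (f (p + t *\<^sub>R rvec u)) (g (p + t *\<^sub>R rvec u)) = real_of_int (max m n) * t + c"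
    proof cases
      case 1
      have "\<forall>\<^sub>F t in at_top. max (f (p + t *\<^sub>R rvec u)) (g (p + t *\<^sub>R rvec u)) = real_of_int (max m n) * t + c"
        using c d aux[OF 1, of d c] by eventually_elim (use 1 in simp)
      then show ?thesis by (rule exI)
    next
      case 2
      have "\<forall>\<^sub>F t in at_top. max (f (p + t *\<^sub>R rvec u)) (g (p + t *\<^sub>R rvec u)) = real_of_int (max m n) * t + d"
        using c d aux[OF 2, of c d] by eventually_elim (use 2 in simp)
      then show ?thesis by (rule exI)
    next
      case 3
      have "\<forall>\<^sub>F t in at_top. max (f (p + t *\<^sub>R rvec u)) (g (p + t *\<^sub>R rvec u)) = real_of_int (max m n) * t + max c d"
        using c d by eventually_elim (use 3 in simp)
      then show ?thesis by (rule exI)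
    qed
  qed
qed

text \<open>On a bounded interval affine functions need only be compared at the two ends; on a
  half-line the values at \<open>0\<close> and the slopes are compared. The slopes are an
  obstruction only if \<open>m = 0\<close>, and then \<open>unbounded\<close> excludes a positive
  \<open>\<beta>\<close>.\<close>

lemma affine_dominated:
  fixes \<alpha> \<beta> c m :: real
  assumes R: "0 \<le> R"
    and nonneg: "\<And>t. t \<in> dom_upto R \<Longrightarrow> 0 \<le> c + m * t"
    and zero: "\<And>t. t \<in> dom_upto R \<Longrightarrow> c + m * t = 0 \<Longrightarrow> \<alpha> + \<beta> * t \<le> 0"
    and unbounded: "R = \<infinity> \<Longrightarrow> m = 0 \<Longrightarrow> \<beta> \<le> 0"
  shows "\<exists>C\<ge>0. \<forall>t\<in>dom_upto R. \<alpha> + \<beta> * t \<le> C * (c + m * t)"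
proof -
  have pt: "\<exists>C\<ge>0. \<alpha> + \<beta> * t \<le> C * (c + m * t)" if "t \<in> dom_upto R" for t
  proof (cases "c + m * t = 0")
    case True
    then show ?thesis using zero[OF that] by auto
  next
    case False
    then have "c + m * t > 0" using nonneg[OF that] by simp
    then show ?thesis by (intro exI[of _ "\<bar>\<alpha> + \<beta> * t\<bar> / (c + m * t)"]) auto
  qed
  have "0 \<in> dom_upto R" using R by (simp add: dom_upto_def zero_ereal_def)
  then obtain C1 where C1: "C1 \<ge> 0" "\<alpha> + \<beta> * 0 \<le> C1 * (c + m * 0)" using pt by blast
  have c0: "c \<ge> 0" using nonneg[OF \<open>0 \<in> dom_upto R\<close>] by simp
  show ?thesis
  proof (cases R)
    case (real r)
    then have r: "0 \<le> r" "r \<in> dom_upto R" using R by (auto simp: dom_upto_def)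
    obtain C2 where C2: "C2 \<ge> 0" "\<alpha> + \<beta> * r \<le> C2 * (c + m * r)" using pt r by blast
    define C where "C = max C1 C2"
    have "C1 * c \<le> C * c" using c0 by (simp add: C_def mult_right_mono)
    then have e1: "\<alpha> \<le> C * c" using C1 by simp
    have "C2 * (c + m * r) \<le> C * (c + m * r)" using nonneg[OF r(2)] by (simp add: C_def mult_right_mono)
    then have e2: "\<alpha> + \<beta> * r \<le> C * (c + m * r)" using C2 by simp
    have "\<alpha> + \<beta> * t \<le> C * (c + m * t)" if "t \<in> dom_upto R" for t
    proof -
      have t: "0 \<le> t" "t \<le> r" using that real by (auto simp: dom_upto_def)
      \<comment> \<open>A linear function on \<open>[0, r]\<close> is bounded by its larger value at
        the two ends.\<close>
      have "(\<beta> - C * m) * t \<le> max 0 ((\<beta> - C * m) * r)"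
        using t by (cases "\<beta> - C * m \<ge> 0") (auto simp: mult_left_mono mult_nonpos_nonneg intro: max.coboundedI1 max.coboundedI2)
      then show ?thesis using e1 e2 by (auto simp: algebra_simps max_def split: if_splits)
    qed
    then show ?thesis using C1 by (intro exI[of _ C]) (auto simp: C_def)
  next
    case PInf
    have mem: "t \<in> dom_upto R" if "t \<ge> 0" for t using that PInf by (simp add: dom_upto_def)
    have m0: "m \<ge> 0"
    proof (rule ccontr)
      assume n: "\<not> ?thesis"
      \<comment> \<open>The parameter at which \<open>c + m * t\<close> would be
        \<open>-1\<close>.\<close>
      have "0 \<le> c + m * ((c + 1) / (- m))" using n c0 by (intro nonneg mem divide_nonneg_pos) auto
      then show False using n by simp
    qed
    define C where "C = max C1 (if m = 0 then 0 else \<beta> / m)"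
    have "C1 * c \<le> C * c" using c0 by (simp add: C_def mult_right_mono)
    then have e1: "\<alpha> \<le> C * c" using C1 by simp
    have e2: "\<beta> \<le> C * m"
    proof (cases "m = 0")
      case True
      then show ?thesis using unbounded PInf by simp
    next
      case False
      then have "\<beta> = \<beta> / m * m" by simp
      also have "\<dots> \<le> C * m" using m0 False by (intro mult_right_mono) (simp_all add: C_def)
      finally show ?thesis .
    qed
    have "\<alpha> + \<beta> * t \<le> C * (c + m * t)" if "t \<in> dom_upto R" for t
    proof -
      have "\<beta> * t \<le> C * m * t" using that by (intro mult_right_mono e2) (simp add: dom_upto_def)
      then show ?thesis using e1 by (simp add: algebra_simps)
    qed
    then show ?thesis using C1 by (intro exI[of _ C]) (auto simp: C_def)
  qed (use R in simp)
qed

text \<open>The second piece is cut where the gap of the first is affine along it, and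
  \<open>affine_dominated\<close> treats each part. If the gap is constant on an unbounded part, it
  is bounded along the whole ray, and \<open>seg_gap_bounded_along\<close> leads to the hypothesis
  \<open>parallel\<close>.\<close>

lemma seg_gap_dominates:
  fixes \<alpha> \<beta> :: real
  assumes u: "primitive u" and v: "primitive v"
    and zero: "\<And>s. s \<in> dom_upto S \<Longrightarrow> seg_gap p u T (q + s *\<^sub>R rvec v) = 0 \<Longrightarrow> \<alpha> + \<beta> * s \<le> 0"
    and parallel: "S = \<infinity> \<Longrightarrow> T = \<infinity> \<Longrightarrow> u = v \<Longrightarrow> \<beta> \<le> 0"
  shows "\<exists>C\<ge>0. \<forall>s\<in>dom_upto S. \<alpha> + \<beta> * s \<le> C * seg_gap p u T (q + s *\<^sub>R rvec v)"
proof -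
  define w where "w s = seg_gap p u T (q + s *\<^sub>R rvec v)" for s
  have w0: "w s \<ge> 0" for s by (simp add: w_def seg_gap_nonneg)
  have contw: "continuous_on A w" for A unfolding w_def
    by (intro continuous_on_compose2[OF PL_continuous[OF PL_seg_gap, of UNIV]] continuous_intros) auto
  have pw: "pw_int_affine S w" unfolding w_def by (rule PL_along_line[OF PL_seg_gap])
  obtain \<C> where C: "finite \<C>"
    "\<And>a R. (a, R) \<in> \<C> \<Longrightarrow> 0 \<le> a \<and> 0 \<le> R \<and> ereal a + R \<le> S"
    "\<And>a R. (a, R) \<in> \<C> \<Longrightarrow> \<exists>(m::int) c. \<forall>t\<in>dom_upto R. w (a + t) = real_of_int m * t + c"
    "\<And>t. t \<in> dom_upto S \<Longrightarrow> \<exists>(a, R)\<in>\<C>. a \<le> t \<and> ereal (t - a) \<le> R"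
  proof (rule pw_int_affine_closed_cover[of "{w}" S])
    fix \<C> :: "(real \<times> ereal) set"
    assume h: "finite \<C>" "\<And>a R. (a, R) \<in> \<C> \<Longrightarrow> 0 \<le> a \<and> 0 \<le> R \<and> ereal a + R \<le> S"
    "\<And>a R h. (a, R) \<in> \<C> \<Longrightarrow> h \<in> {w} \<Longrightarrow> \<exists>(m::int) c. \<forall>t\<in>dom_upto R. h (a + t) = real_of_int m * t + c"
    "\<And>t. t \<in> dom_upto S \<Longrightarrow> \<exists>(a, R)\<in>\<C>. a \<le> t \<and> ereal (t - a) \<le> R"
    show thesis by (rule that[OF h(1) h(2) h(3)[OF _ singletonI] h(4)])
  qed (use pw contw in auto)
  have loc: "\<exists>C\<ge>0. \<forall>t\<in>dom_upto (snd r). \<alpha> + \<beta> * (fst r + t) \<le> C * w (fst r + t)" if r: "r \<in> \<C>" for r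
  proof -
    obtain a R where aR: "r = (a, R)" by (cases r)
    have R: "0 \<le> a" "0 \<le> R" "ereal a + R \<le> S" using C(2)[of a R] r aR by auto
    obtain m c where mc: "\<forall>t\<in>dom_upto R. w (a + t) = real_of_int m * t + c" using C(3)[of a R] r aR by blast
    have mem: "a + t \<in> dom_upto S" if "t \<in> dom_upto R" for t
    proof -
      have "ereal a + ereal t \<le> ereal a + R" using that by (intro add_left_mono) (simp add: dom_upto_def)
      then show ?thesis using that R(1,3) order_trans by (auto simp: dom_upto_def)
    qed
    have "\<exists>C\<ge>0. \<forall>t\<in>dom_upto R. (\<alpha> + \<beta> * a) + \<beta> * t \<le> C * (c + real_of_int m * t)"
    proof (rule affine_dominated[OF R(2)])
      show "0 \<le> c + real_of_int m * t" if "t \<in> dom_upto R" for t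
        using that mc w0[of "a + t"] by simp
      show "\<alpha> + \<beta> * a + \<beta> * t \<le> 0" if "t \<in> dom_upto R" "c + real_of_int m * t = 0" for t
      proof -
        have "w (a + t) = real_of_int m * t + c" using mc that(1) by blast
        then have "w (a + t) = 0" using that(2) by simp
        then show ?thesis using zero[OF mem[OF that(1)]] unfolding w_def by (simp only: distrib_left add.assoc)
      qed
      assume inf: "R = \<infinity>" "real_of_int m = 0"
      have "S = \<infinity>" using R inf by simp
      \<comment> \<open>The gap is constant from \<open>a\<close> on and bounded on the compact
        rest.\<close>
      have "compact (w ` {0..a})" by (intro compact_continuous_image contw compact_Icc)
      then obtain K where K: "\<And>s. 0 \<le> s \<Longrightarrow> s \<le> a \<Longrightarrow> w s \<le> K"
        using bounded_imp_bdd_above[OF compact_imp_bounded] unfolding bdd_above_def by (metis atLeastAtMost_iff imageI)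
      have "w s \<le> max K c" if "s \<ge> 0" for s
      proof (cases "s \<le> a")
        case True
        then show ?thesis using K that by (simp add: le_max_iff_disj)
      next
        case False
        then have "s - a \<in> dom_upto R" using inf by (simp add: dom_upto_def)
        then show ?thesis using mc[rule_format, of "s - a"] inf by simp
      qed
      then have "T = \<infinity> \<and> u = v"
        unfolding w_def by (intro seg_gap_bounded_along[OF u v, of p T q "max K c"])
      then show "\<beta> \<le> 0" using parallel \<open>S = \<infinity>\<close> by simp
    qed
    then show ?thesis using mc by (simp add: aR algebra_simps)
  qed
  then have "\<forall>r\<in>\<C>. \<exists>C. C\<ge>0 \<and> (\<forall>t\<in>dom_upto (snd r). \<alpha> + \<beta> * (fst r + t) \<le> C * w (fst r + t))" by blast
  from bchoice[OF this] obtain K where K: "\<And>r. r \<in> \<C> \<Longrightarrow> K r \<ge> 0 \<and> (\<forall>t\<in>dom_upto (snd r). \<alpha> + \<beta> * (fst r + t) \<le> K r * w (fst r + t))"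
    by blast
  \<comment> \<open>All constants are nonnegative, so their sum is at least each of them.\<close>
  define C where "C = sum K \<C>"
  have C0: "C \<ge> 0" unfolding C_def using K by (intro sum_nonneg) blast
  moreover have "\<alpha> + \<beta> * s \<le> C * w s" if "s \<in> dom_upto S" for s
  proof -
    obtain a R where aR: "(a, R) \<in> \<C>" "a \<le> s" "ereal (s - a) \<le> R" using C(4)[OF \<open>s \<in> dom_upto S\<close>] by blast
    have "K (a, R) \<le> C" unfolding C_def using aR K C(1) by (intro member_le_sum) auto
    then have "K (a, R) * w s \<le> C * w s" by (intro mult_right_mono w0)
    moreover have "\<alpha> + \<beta> * (a + (s - a)) \<le> K (a, R) * w (a + (s - a))"
    proof -
      have "s - a \<in> dom_upto R" using aR by (simp add: dom_upto_def)
      then show ?thesis using K[OF aR(1)] unfolding fst_conv snd_conv by blast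
    qed
    ultimately show ?thesis by simp
  qed
  ultimately show ?thesis unfolding w_def by blast
qed

type_synonym 'n piece = "(real^'n) \<times> (int^'n) \<times> ereal"

text \<open>Length \<open>0\<close> is allowed, so a point is a piece; it still carries some
  primitive direction.\<close>

definition pieces :: "('n::finite) piece set \<Rightarrow> bool" where
  "pieces D \<longleftrightarrow> finite D \<and> D \<noteq> {} \<and> (\<forall>(p, u, T)\<in>D. primitive u \<and> 0 \<le> T)"

definition support :: "('n::finite) piece set \<Rightarrow> (real^'n) set" where
  "support D = (\<Union>(p, u, T)\<in>D. seg p u T)"

lemma piecesD:
  assumes "pieces D" "(p, u, T) \<in> D"
  shows "primitive u" "u \<noteq> 0" "0 \<le> T"
proof -
  show "primitive u" "0 \<le> T" using assms unfolding pieces_def by auto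
  then show "u \<noteq> 0" by (intro primitive_nonzero)
qed

lemma PL_extension:
  fixes g :: "real^'n::finite \<Rightarrow> real"
  assumes D: "pieces D"
    and slope: "\<And>p u T. (p, u, T) \<in> D \<Longrightarrow> \<forall>t\<in>dom_upto T. g (p + t *\<^sub>R rvec u) = real_of_int (m (p, u, T)) * t + c (p, u, T)"
    and parallel: "\<And>p q u. (p, u, \<infinity>) \<in> D \<Longrightarrow> (q, u, \<infinity>) \<in> D \<Longrightarrow> m (p, u, \<infinity>) = m (q, u, \<infinity>)"
  obtains F where "F \<in> PL" "\<And>x. x \<in> support D \<Longrightarrow> F x = g x"
proof -
  have ex: "\<exists>F\<in>PL. (\<forall>x\<in>seg p u T. F x = g x) \<and> (\<forall>x\<in>seg q v S. F x \<le> g x)"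
    if A: "(p, u, T) \<in> D" and B: "(q, v, S) \<in> D" for p u T q v S
  proof -
    obtain a where a: "(\<Sum>i\<in>UNIV. a $ i * u $ i) = 1" using piecesD(1)[OF D A] unfolding primitive_def by blast
    \<comment> \<open>The Bezout witness scaled by the slope: \<open>G\<close> has integral
      exponents and the prescribed slope along \<open>u\<close>.\<close>
    define k where "k = m (p, u, T) *s a"
    define G where "G x = (c (p, u, T) - iprod k p) + iprod k x" for x
    have G: "G \<in> PL" unfolding G_def by (rule PL_affine)
    have "iprod k (rvec u) = real_of_int (m (p, u, T)) * real_of_int (\<Sum>i\<in>UNIV. a $ i * u $ i)"
      by (simp add: iprod_def k_def sum_distrib_left mult.assoc)
    then have ku: "iprod k (rvec u) = m (p, u, T)" using a by simp
    have GA: "G x = g x" if "x \<in> seg p u T" for x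
    proof -
      obtain t where t: "t \<in> dom_upto T" "x = p + t *\<^sub>R rvec u" using \<open>x \<in> seg p u T\<close> unfolding seg_def by blast
      then have "g x = real_of_int (m (p, u, T)) * t + c (p, u, T)" using slope[OF A] by simp
      then show ?thesis using t ku by (simp add: G_def iprod_add_right iprod_scaleR_right)
    qed
    define \<alpha> where "\<alpha> = G q - c (q, v, S)"
    define \<beta> where "\<beta> = iprod k (rvec v) - m (q, v, S)"
    have dif: "G (q + s *\<^sub>R rvec v) - g (q + s *\<^sub>R rvec v) = \<alpha> + \<beta> * s" if "s \<in> dom_upto S" for s
      using slope[OF B, rule_format, OF that]
      by (simp add: G_def \<alpha>_def \<beta>_def iprod_add_right iprod_scaleR_right algebra_simps)
    have "\<exists>C\<ge>0. \<forall>s\<in>dom_upto S. \<alpha> + \<beta> * s \<le> C * seg_gap p u T (q + s *\<^sub>R rvec v)"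
    proof (rule seg_gap_dominates[OF piecesD(1)[OF D A] piecesD(1)[OF D B]])
      fix s assume s: "s \<in> dom_upto S" "seg_gap p u T (q + s *\<^sub>R rvec v) = 0"
      then have "q + s *\<^sub>R rvec v \<in> seg p u T" using seg_eq_gap[OF piecesD(2,3)[OF D A]] by simp
      then show "\<alpha> + \<beta> * s \<le> 0" using GA dif[OF s(1)] by simp
    next
      \<comment> \<open>For rays of equal direction the slopes agree by assumption, so
        \<open>\<beta>\<close> is \<open>0\<close>.\<close>
      assume "S = \<infinity>" "T = \<infinity>" "u = v"
      then show "\<beta> \<le> 0" using parallel[of p u q] A B ku by (simp add: \<beta>_def)
    qed
    then obtain C where C: "C \<ge> 0" "\<forall>s\<in>dom_upto S. \<alpha> + \<beta> * s \<le> C * seg_gap p u T (q + s *\<^sub>R rvec v)" by blast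
    \<comment> \<open>The constant is rounded up, so that the multiple of the gap has integral
      slopes and stays in \<open>PL\<close>.\<close>
    obtain N where N: "C \<le> real N" using real_arch_simple by blast
    define F where "F x = G x - real N * seg_gap p u T x" for x
    have "F \<in> PL" unfolding F_def by (intro PL_diff G PL_of_nat_mult PL_seg_gap)
    moreover have "F x = g x" if "x \<in> seg p u T" for x
      using GA[OF that] seg_gap_on_seg[OF that] by (simp add: F_def)
    moreover have "F x \<le> g x" if "x \<in> seg q v S" for x
    proof -
      obtain s where s: "s \<in> dom_upto S" "x = q + s *\<^sub>R rvec v" using \<open>x \<in> seg q v S\<close> unfolding seg_def by blast
      have "\<alpha> + \<beta> * s \<le> C * seg_gap p u T x" using C(2) s by simp
      also have "\<dots> \<le> real N * seg_gap p u T x" by (intro mult_right_mono N seg_gap_nonneg)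
      finally show ?thesis using dif[OF s(1)] s(2) by (simp add: F_def)
    qed
    ultimately show ?thesis by blast
  qed
  define sg where "sg A = seg (fst A) (fst (snd A)) (snd (snd A))" for A :: "'n piece"
  have "\<exists>F. F\<in>PL \<and> (\<forall>x\<in>sg A. F x = g x) \<and> (\<forall>x\<in>sg B. F x \<le> g x)" if "A \<in> D" "B \<in> D" for A B
    using ex[of "fst A" "fst (snd A)" "snd (snd A)" "fst B" "fst (snd B)" "snd (snd B)"] that by (auto simp: sg_def)
  then have "\<forall>r\<in>D \<times> D. \<exists>F. F \<in> PL \<and> (\<forall>x\<in>sg (fst r). F x = g x) \<and> (\<forall>x\<in>sg (snd r). F x \<le> g x)" by auto
  from bchoice[OF this] obtain \<Psi> where
    \<Psi>: "\<forall>r\<in>D \<times> D. \<Psi> r \<in> PL \<and> (\<forall>x\<in>sg (fst r). \<Psi> r x = g x) \<and> (\<forall>x\<in>sg (snd r). \<Psi> r x \<le> g x)" by blast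
  define \<Phi> where "\<Phi> A B = \<Psi> (A, B)" for A B
  have \<Phi>: "\<Phi> A B \<in> PL" "\<And>x. x \<in> sg A \<Longrightarrow> \<Phi> A B x = g x" "\<And>x. x \<in> sg B \<Longrightarrow> \<Phi> A B x \<le> g x"
    if "A \<in> D" "B \<in> D" for A B
    using \<Psi>[rule_format, of "(A, B)"] that unfolding \<Phi>_def by simp_all
  have fin: "finite D" "D \<noteq> {}" using D unfolding pieces_def by auto
  \<comment> \<open>At a point of the piece \<open>A\<close> all entries of row \<open>A\<close>
    equal the value of \<open>g\<close>, and every other row has an entry in column \<open>A\<close>
    that is at most this value; so the maximum of the row minima is the value of
    \<open>g\<close>.\<close>
  define F where "F x = Max ((\<lambda>A. Min ((\<lambda>B. \<Phi> A B x) ` D)) ` D)" for x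
  have "F \<in> PL" unfolding F_def by (intro PL_Max PL_Min fin \<Phi>(1))
  moreover have "F x = g x" if "x \<in> support D" for x
  proof -
    obtain p u T where "(p, u, T) \<in> D" "x \<in> seg p u T" using \<open>x \<in> support D\<close> unfolding support_def by blast
    then obtain A where A: "A \<in> D" "x \<in> sg A" unfolding sg_def by (metis fst_conv snd_conv)
    show ?thesis unfolding F_def
    proof (rule Max_eqI)
      show "finite ((\<lambda>A. Min ((\<lambda>B. \<Phi> A B x) ` D)) ` D)" using fin by simp
      fix y assume "y \<in> (\<lambda>A. Min ((\<lambda>B. \<Phi> A B x) ` D)) ` D"
      then obtain A' where A': "A' \<in> D" "y = Min ((\<lambda>B. \<Phi> A' B x) ` D)" by blast
      have "y \<le> \<Phi> A' A x" unfolding A'(2) using fin A by (intro Min_le) auto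
      then show "y \<le> g x" using \<Phi>(3)[OF A'(1) A(1) A(2)] by simp
    next
      have "(\<lambda>B. \<Phi> A B x) ` D = {g x}" using \<Phi>(2)[OF A(1) _ A(2)] fin by auto
      then show "g x \<in> (\<lambda>A. Min ((\<lambda>B. \<Phi> A B x) ` D)) ` D" using A(1) by (intro image_eqI[of _ _ A]) simp_all
    qed
  qed
  ultimately show thesis by (rule that)
qed

section \<open>The congruence of a union of segments\<close>

lemma trop_rational_simps [simp]:
  "x \<otimes>\<^bsub>trop_rational\<^esub> y = (\<lambda>z. x z + y z)" "x \<oplus>\<^bsub>trop_rational\<^esub> y = (\<lambda>z. max (x z) (y z))"
  "\<one>\<^bsub>trop_rational\<^esub> = (\<lambda>z. 0)" "\<zero>\<^bsub>trop_rational\<^esub> = (\<lambda>z. -\<infinity>)"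
  "struct_map trop_rational a = (\<lambda>z. a)"
  by (simp_all add: trop_rational_def)

lemma PL_in_carrier: "f \<in> PL \<Longrightarrow> (\<lambda>x. ereal (f x)) \<in> carrier trop_rational"
  unfolding carrier_trop_rational by blast

lemma trop_rational_cases:
  assumes "F \<in> carrier (trop_rational :: (real^'n::finite \<Rightarrow> ereal) talgebra)"
  obtains "F = (\<lambda>x. -\<infinity>)" | f where "f \<in> PL" "F = (\<lambda>x. ereal (f x))"
  using assms unfolding carrier_trop_rational by blast

lemma trop_rational_add_closed:
  assumes "F \<in> carrier (trop_rational :: (real^'n::finite \<Rightarrow> ereal) talgebra)" "G \<in> carrier trop_rational"
  shows "(\<lambda>x. max (F x) (G x)) \<in> carrier trop_rational"
proof (cases rule: trop_rational_cases[OF assms(1)])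
  case 1
  then show ?thesis using assms by simp
next
  case F: (2 f)
  show ?thesis
  proof (cases rule: trop_rational_cases[OF assms(2)])
    case 1
    then show ?thesis using assms by simp
  next
    case (2 g)
    then show ?thesis using F PL_in_carrier[OF PL_max[of f g]] by (simp add: ereal_max[symmetric] del: ereal_max)
  qed
qed

lemma trop_rational_mult_closed:
  assumes "F \<in> carrier (trop_rational :: (real^'n::finite \<Rightarrow> ereal) talgebra)" "G \<in> carrier trop_rational"
  shows "(\<lambda>x. F x + G x) \<in> carrier trop_rational"
proof (cases rule: trop_rational_cases[OF assms(1)])
  case F: 1
  show ?thesis
    by (cases rule: trop_rational_cases[OF assms(2)]) (use F assms(1) in auto)
next
  case F: (2 f)
  show ?thesis
  proof (cases rule: trop_rational_cases[OF assms(2)])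
    case 1
    then show ?thesis using F assms(2) by simp
  next
    case (2 g)
    then show ?thesis using F PL_in_carrier[OF PL_add[of f g]] by simp
  qed
qed

lemma trop_rational_const: "a \<noteq> \<infinity> \<Longrightarrow> (\<lambda>x. a) \<in> carrier trop_rational"
  using PL_in_carrier[OF PL_const] carrier_trop_rational by (cases a) auto

lemma congruence_E_of: "congruence trop_rational (E_of V)"
proof -
  have "equiv (carrier trop_rational) (E_of V)"
    unfolding E_of_def by (rule equivI) (auto simp: refl_on_def sym_def trans_def)
  moreover have "(a \<oplus>\<^bsub>trop_rational\<^esub> c, b \<oplus>\<^bsub>trop_rational\<^esub> d) \<in> E_of V \<and> (a \<otimes>\<^bsub>trop_rational\<^esub> c, b \<otimes>\<^bsub>trop_rational\<^esub> d) \<in> E_of V"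
    if "(a, b) \<in> E_of V" "(c, d) \<in> E_of V" for a b c d
    using that trop_rational_add_closed trop_rational_mult_closed unfolding E_of_def by auto
  ultimately show ?thesis unfolding congruence_def by auto
qed

lemma congruence_compat:
  assumes "congruence trop_rational E" "(a, b) \<in> E" "(c, d) \<in> E"
  shows "((\<lambda>x. max (a x) (c x)), (\<lambda>x. max (b x) (d x))) \<in> E" "((\<lambda>x. a x + c x), (\<lambda>x. b x + d x)) \<in> E"
  using assms unfolding congruence_def by auto

text \<open>The bound is exploited through maxima: if \<open>h\<close> is at most
  \<open>m F\<close>, then \<open>max (m F) h\<close> is \<open>m F\<close>, and relating
  \<open>m F\<close> to \<open>0\<close> relates \<open>max 0 h\<close> to \<open>0\<close>. Adding
  \<open>k\<close>, with \<open>h - k\<close> in place of \<open>h\<close>, relates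
  \<open>max k h\<close> to \<open>k\<close>; so \<open>f\<close> and \<open>g\<close> are both
  related to \<open>max f g\<close>.\<close>

lemma congruence_generated_by_bound:
  assumes E: "congruence trop_rational E" and F: "F \<in> PL" and F0: "((\<lambda>x. ereal (F x)), (\<lambda>x. 0)) \<in> E"
    and f: "f \<in> PL" and g: "g \<in> PL" and bound: "\<And>x. \<bar>f x - g x\<bar> \<le> real m * F x"
  shows "((\<lambda>x. ereal (f x)), (\<lambda>x. ereal (g x))) \<in> E"
proof -
  have eq: "equiv (carrier trop_rational) E" using E unfolding congruence_def by blast
  have refl: "(h, h) \<in> E" if "h \<in> carrier trop_rational" for h
    using eq that by (auto simp: equiv_def refl_on_def)
  have sym: "(h, k) \<in> E \<Longrightarrow> (k, h) \<in> E" for h k using eq by (auto simp: equiv_def sym_def)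
  have trans: "(h, k) \<in> E \<Longrightarrow> (k, l) \<in> E \<Longrightarrow> (h, l) \<in> E" for h k l using eq unfolding equiv_def trans_def by blast
  have mF: "((\<lambda>x. ereal (real m * F x)), (\<lambda>x. 0)) \<in> E"
  proof (induction m)
    case 0
    show ?case using refl[OF trop_rational_const[of 0]] by (simp add: zero_ereal_def)
  next
    case (Suc m)
    have "ereal (real (Suc m) * F x) = ereal (real m * F x) + ereal (F x)" for x by (simp add: algebra_simps)
    then show ?case using congruence_compat(2)[OF E Suc F0] by simp
  qed
  have small: "((\<lambda>x. ereal (max (h x) 0)), (\<lambda>x. 0)) \<in> E" if h: "h \<in> PL" "\<And>x. h x \<le> real m * F x" for h
  proof -
    have "max (real m * F x) (h x) = real m * F x" for x using h by (simp add: max_absorb1)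
    then have "((\<lambda>x. ereal (real m * F x)), (\<lambda>x. max 0 (ereal (h x)))) \<in> E"
      using congruence_compat(1)[OF E mF refl[OF PL_in_carrier[OF h(1)]]] by (simp only: ereal_max[symmetric])
    moreover have "(\<lambda>x. max 0 (ereal (h x))) = (\<lambda>x. ereal (max (h x) 0))" by (auto simp: max_def)
    ultimately have "((\<lambda>x. ereal (real m * F x)), (\<lambda>x. ereal (max (h x) 0))) \<in> E" by simp
    then show ?thesis using sym trans[OF _ mF] by simp
  qed
  have half: "((\<lambda>x. ereal (k x)), (\<lambda>x. ereal (max (k x) (h x)))) \<in> E"
    if h: "h \<in> PL" and k: "k \<in> PL" and b: "\<And>x. h x - k x \<le> real m * F x" for h k
  proof -
    have "((\<lambda>x. ereal (max (h x - k x) 0)), (\<lambda>x. 0)) \<in> E" by (intro small PL_diff h k b)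
    from congruence_compat(2)[OF E refl[OF PL_in_carrier[OF k]] this]
    have "((\<lambda>x. ereal (k x + max (h x - k x) 0)), (\<lambda>x. ereal (k x))) \<in> E" by (simp only: plus_ereal.simps add_0_right)
    moreover have "k x + max (h x - k x) 0 = max (k x) (h x)" for x by simp
    ultimately have "((\<lambda>x. ereal (max (k x) (h x))), (\<lambda>x. ereal (k x))) \<in> E" by (simp only:)
    then show ?thesis by (rule sym)
  qed
  have "((\<lambda>x. ereal (f x)), (\<lambda>x. ereal (max (f x) (g x)))) \<in> E"
    using bound by (intro half f g) (simp add: abs_le_iff algebra_simps)
  moreover have "((\<lambda>x. ereal (g x)), (\<lambda>x. ereal (max (g x) (f x)))) \<in> E"
    using bound by (intro half f g) (simp add: abs_le_iff algebra_simps)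
  then have "((\<lambda>x. ereal (max (f x) (g x))), (\<lambda>x. ereal (g x))) \<in> E"
    by (subst max.commute) (rule sym)
  ultimately show ?thesis by (rule trans)
qed

section \<open>Gap and distance for a finite union of pieces\<close>

definition piece_gap :: "('n::finite) piece \<Rightarrow> real^'n \<Rightarrow> real" where
  "piece_gap = (\<lambda>(p, u, T). seg_gap p u T)"

definition support_gap :: "('n::finite) piece set \<Rightarrow> real^'n \<Rightarrow> real" where
  "support_gap D x = Min ((\<lambda>A. piece_gap A x) ` D)"

lemma PL_support_gap:
  assumes "pieces D" shows "support_gap D \<in> PL"
proof -
  have "piece_gap A \<in> PL" for A :: "'a piece" by (cases A) (simp add: piece_gap_def PL_seg_gap)
  then show ?thesis using PL_Min[of D piece_gap] assms unfolding pieces_def support_gap_def by blast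
qed

lemma support_gap_nonneg:
  assumes "pieces D" shows "0 \<le> support_gap D x"
  using assms seg_gap_nonneg unfolding pieces_def support_gap_def
  by (intro Min.boundedI) (auto simp: piece_gap_def)

lemma support_gap_attained:
  assumes "pieces D" obtains p u T where "(p, u, T) \<in> D" "support_gap D x = seg_gap p u T x"
proof -
  have "support_gap D x \<in> (\<lambda>A. piece_gap A x) ` D"
    using assms unfolding pieces_def support_gap_def by (intro Min_in) auto
  then show thesis using that by (auto simp: piece_gap_def)
qed

lemma support_gap_on_support:
  assumes "pieces D" "x \<in> support D" shows "support_gap D x = 0"
proof -
  obtain p u T where A: "(p, u, T) \<in> D" "x \<in> seg p u T" using assms(2) unfolding support_def by blast
  have "support_gap D x \<le> piece_gap (p, u, T) x"
    using assms(1) A unfolding pieces_def support_gap_def by (intro Min_le) auto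
  then show ?thesis using seg_gap_on_seg[OF A(2)] support_gap_nonneg[OF assms(1), of x] by (simp add: piece_gap_def)
qed

text \<open>The piece that attains the minimum has its own Hoffman bound; the sum of the finitely
  many constants serves for all pieces.\<close>

lemma support_gap_dist:
  assumes D: "pieces D"
  obtains C where "C \<ge> 0" "\<And>x. \<exists>y\<in>support D. dist x y \<le> C * support_gap D x"
proof -
  have "\<forall>A\<in>D. \<exists>C. C \<ge> 0 \<and> (\<forall>x. \<exists>y\<in>support D. dist x y \<le> C * piece_gap A x)"
  proof
    fix A assume A: "A \<in> D"
    obtain p u T where puT: "A = (p, u, T)" by (cases A)
    obtain C where C: "C \<ge> 0" "\<And>x. \<exists>y\<in>seg p u T. dist x y \<le> C * seg_gap p u T x"
      using seg_gap_dist[OF piecesD(2,3)[OF D A[unfolded puT]], of p] by blast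
    moreover have "seg p u T \<subseteq> support D" using A puT unfolding support_def by blast
    ultimately have "\<forall>x. \<exists>y\<in>support D. dist x y \<le> C * piece_gap A x" by (auto simp: puT piece_gap_def)
    with C show "\<exists>C. C \<ge> 0 \<and> (\<forall>x. \<exists>y\<in>support D. dist x y \<le> C * piece_gap A x)" by blast
  qed
  from bchoice[OF this] obtain K where
    K: "\<And>A. A \<in> D \<Longrightarrow> K A \<ge> 0 \<and> (\<forall>x. \<exists>y\<in>support D. dist x y \<le> K A * piece_gap A x)" by blast
  have fin: "finite D" using D unfolding pieces_def by blast
  define C where "C = sum K D"
  have "C \<ge> 0" unfolding C_def using K by (intro sum_nonneg) blast
  moreover have "\<exists>y\<in>support D. dist x y \<le> C * support_gap D x" for x
  proof -
    obtain p u T where A: "(p, u, T) \<in> D" "support_gap D x = seg_gap p u T x" using support_gap_attained[OF D] by blast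
    obtain y where y: "y \<in> support D" "dist x y \<le> K (p, u, T) * piece_gap (p, u, T) x" using K[OF A(1)] by blast
    have "K (p, u, T) \<le> C" unfolding C_def using A K fin by (intro member_le_sum) auto
    then have "K (p, u, T) * piece_gap (p, u, T) x \<le> C * support_gap D x"
      using A by (simp add: piece_gap_def mult_right_mono seg_gap_nonneg)
    then show ?thesis using y by force
  qed
  ultimately show thesis by (rule that)
qed

lemma support_gap_eq_0_iff:
  assumes D: "pieces D" shows "support_gap D x = 0 \<longleftrightarrow> x \<in> support D"
proof
  assume 0: "support_gap D x = 0"
  obtain C where "C \<ge> 0" "\<And>x. \<exists>y\<in>support D. dist x y \<le> C * support_gap D x" using support_gap_dist[OF D] by blast
  then obtain y where "y \<in> support D" "dist x y \<le> C * support_gap D x" by blast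
  then show "x \<in> support D" using 0 by simp
qed (rule support_gap_on_support[OF D])

lemma seg_start: "0 \<le> T \<Longrightarrow> p \<in> seg p u T"
  unfolding seg_def dom_upto_def by (rule image_eqI[of _ _ 0]) (auto simp: zero_ereal_def)

lemma support_nonempty: "pieces D \<Longrightarrow> support D \<noteq> {}"
  unfolding pieces_def support_def using seg_start by fastforce

text \<open>The single pair of \<open>support_gap D\<close> and \<open>0\<close> lies in the
  congruence and already cuts out the support.\<close>

lemma V_of_E_of_support:
  assumes D: "pieces D" shows "V_of (E_of (support D)) = support D"
proof
  show "support D \<subseteq> V_of (E_of (support D))" unfolding V_of_def E_of_def by blast
  show "V_of (E_of (support D)) \<subseteq> support D"
  proof
    fix x assume x: "x \<in> V_of (E_of (support D))"
    have "((\<lambda>x. ereal (support_gap D x)), (\<lambda>x. ereal 0)) \<in> E_of (support D)"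
      unfolding E_of_def using PL_in_carrier[OF PL_support_gap[OF D]] PL_in_carrier[OF PL_const[of 0]]
        support_gap_on_support[OF D] by auto
    moreover have "\<forall>(f, g)\<in>E_of (support D). f x = g x" using x unfolding V_of_def by blast
    ultimately have "ereal (support_gap D x) = ereal 0" by fast
    then have "support_gap D x = 0" by simp
    then show "x \<in> support D" using support_gap_eq_0_iff[OF D] by blast
  qed
qed

text \<open>The difference vanishes at a point of the support near \<open>x\<close>, so at
  \<open>x\<close> it is at most a Lipschitz constant times a distance, and that distance is at most
  a multiple of the gap.\<close>

lemma E_of_support_bound:
  assumes D: "pieces D" and f: "f \<in> PL" and g: "g \<in> PL" and eq: "\<And>x. x \<in> support D \<Longrightarrow> f x = g x"
  obtains m :: nat where "\<And>x. \<bar>f x - g x\<bar> \<le> real m * support_gap D x"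
proof -
  obtain L where L: "L \<ge> 0" "\<And>x y. \<bar>(f x - g x) - (f y - g y)\<bar> \<le> L * dist x y"
    using PL_Lipschitz[OF PL_diff[OF f g]] by blast
  obtain C where C: "C \<ge> 0" "\<And>x. \<exists>y\<in>support D. dist x y \<le> C * support_gap D x" using support_gap_dist[OF D] by blast
  obtain m where m: "L * C \<le> real m" using real_arch_simple by blast
  have "\<bar>f x - g x\<bar> \<le> real m * support_gap D x" for x
  proof -
    obtain y where y: "y \<in> support D" "dist x y \<le> C * support_gap D x" using C by blast
    have "\<bar>f x - g x\<bar> \<le> L * dist x y" using L(2)[of x y] eq[OF y(1)] by simp
    also have "\<dots> \<le> L * (C * support_gap D x)" by (intro mult_left_mono y L)
    also have "\<dots> \<le> real m * support_gap D x"
      using mult_right_mono[OF m support_gap_nonneg[OF D, of x]] by (simp add: mult.assoc)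
    finally show ?thesis .
  qed
  then show thesis by (rule that)
qed

lemma fin_gen_E_of_support:
  assumes D: "pieces D" shows "fin_gen_congruence trop_rational (E_of (support D))"
  unfolding fin_gen_congruence_def
proof (intro conjI exI[of _ "{((\<lambda>x. ereal (support_gap D x)), (\<lambda>x. 0))}"] allI impI)
  show "congruence trop_rational (E_of (support D))" by (rule congruence_E_of)
  show "{(\<lambda>x. ereal (support_gap D x), \<lambda>x. 0)} \<subseteq> E_of (support D)"
    unfolding E_of_def using PL_in_carrier[OF PL_support_gap[OF D]] trop_rational_const[of 0]
        support_gap_on_support[OF D] by (auto simp: zero_ereal_def)
  fix E' assume E': "congruence trop_rational E' \<and> {(\<lambda>x. ereal (support_gap D x), \<lambda>x. 0)} \<subseteq> E'"
  show "E_of (support D) \<subseteq> E'"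
  proof
    fix r assume "r \<in> E_of (support D)"
    then obtain a b where ab: "r = (a, b)" "a \<in> carrier trop_rational" "b \<in> carrier trop_rational"
      "\<And>x. x \<in> support D \<Longrightarrow> a x = b x" unfolding E_of_def by blast
    \<comment> \<open>A point of the support separates the zero element from real-valued functions,
      so a pair either consists of two zeros or of two members of \<open>PL\<close>.\<close>
    obtain x0 where x0: "x0 \<in> support D" using support_nonempty[OF D] by blast
    show "r \<in> E'"
    proof (cases rule: trop_rational_cases[OF ab(2)])
      case 1
      then have "b = (\<lambda>x. -\<infinity>)" using ab(4)[OF x0] by (cases rule: trop_rational_cases[OF ab(3)]) auto
      moreover have "equiv (carrier trop_rational) E'" using E' unfolding congruence_def by blast
      ultimately show ?thesis using 1 ab(1,2) by (auto simp: equiv_def refl_on_def)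
    next
      case a: (2 f)
      show ?thesis
      proof (cases rule: trop_rational_cases[OF ab(3)])
        case 1
        then show ?thesis using ab(4)[OF x0] a by simp
      next
        case b: (2 g)
        obtain m where "\<And>x. \<bar>f x - g x\<bar> \<le> real m * support_gap D x"
          using E_of_support_bound[OF D a(1) b(1)] ab(4) a b by auto
        then show ?thesis unfolding ab(1) a(2) b(2)
          using E' by (intro congruence_generated_by_bound[OF _ PL_support_gap[OF D] _ a(1) b(1)]) auto
      qed
    qed
  qed
qed simp

section \<open>Polyhedrality and dimension of the support\<close>

lemma seg_eq_rows:
  assumes "u \<noteq> 0" "0 \<le> T"
  shows "seg p u T = {x. \<forall>(a, b)\<in>seg_rows p u T. b \<le> iprod a x}"
  using seg_eq_gap[OF assms] by (simp add: seg_gap_le_0_iff)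

lemma rational_polyhedral_seg:
  assumes "u \<noteq> 0" "0 \<le> T"
  shows "rational_polyhedral (seg p u T)"
proof -
  have [simp]: "real_of_rat (rat_of_int k) = real_of_int k" for k by simp
  define F where "F = (\<lambda>(a, b). ((\<chi> i. rat_of_int (a $ i)), b)) ` seg_rows p u T"
  have "finite F" unfolding F_def using finite_seg_rows by blast
  moreover have "seg p u T = {x. \<forall>(a, b)\<in>F. (\<Sum>i\<in>UNIV. real_of_rat (a $ i) * x $ i) \<ge> b}"
    unfolding seg_eq_rows[OF assms] F_def by (auto simp: iprod_def)
  ultimately show ?thesis unfolding rational_polyhedral_def by (intro exI[of _ F]) blast
qed

lemma aff_dim_seg:
  assumes "0 \<le> T"
  shows "aff_dim (seg p u T) = 0 \<or> aff_dim (seg p u T) = 1"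
proof -
  have "seg p u T \<subseteq> affine hull {p, p + rvec u}"
  proof
    fix x assume "x \<in> seg p u T"
    then obtain t where "x = p + t *\<^sub>R rvec u" unfolding seg_def by blast
    then have "x = (1 - t) *\<^sub>R p + t *\<^sub>R (p + rvec u)" by (simp add: algebra_simps)
    then show "x \<in> affine hull {p, p + rvec u}" unfolding affine_hull_2 by force
  qed
  then have "aff_dim (seg p u T) \<le> aff_dim {p, p + rvec u}"
    by (metis aff_dim_affine_hull aff_dim_subset)
  also have "\<dots> \<le> 1" using aff_dim_le_card[of "{p, p + rvec u}"] by (auto simp: card_insert_if split: if_splits)
  finally have "aff_dim (seg p u T) \<le> 1" .
  moreover have "aff_dim (seg p u T) \<noteq> -1" using seg_start[OF assms] aff_dim_empty[of "seg p u T"] by blast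
  ultimately show ?thesis using aff_dim_geq[of "seg p u T"] by linarith
qed

lemma has_dimension_support:
  assumes D: "pieces D"
  shows "has_dimension (support D) 0 \<or> has_dimension (support D) 1"
proof -
  define P where "P = (\<lambda>(p, u, T). seg p u T) ` D"
  have fin: "finite P" "P \<noteq> {}" using D unfolding P_def pieces_def by auto
  have poly: "rational_polyhedral A" "aff_dim A = 0 \<or> aff_dim A = 1" if "A \<in> P" for A
  proof -
    obtain p u T where A: "(p, u, T) \<in> D" "A = seg p u T" using \<open>A \<in> P\<close> unfolding P_def by auto
    show "rational_polyhedral A" "aff_dim A = 0 \<or> aff_dim A = 1"
      unfolding A(2) by (intro rational_polyhedral_seg aff_dim_seg piecesD[OF D A(1)])+
  qed
  define d where "d = Max (insert (-1) (aff_dim ` P))"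
  have "d \<in> insert (-1) (aff_dim ` P)" unfolding d_def using fin by (intro Max_in) auto
  \<comment> \<open>Some member has dimension at least \<open>0\<close>, so the maximum is not the
    default \<open>-1\<close>.\<close>
  moreover obtain A where "A \<in> P" using fin by blast
  then have "aff_dim A \<le> d" unfolding d_def using fin by (intro Max_ge) auto
  ultimately have "d = 0 \<or> d = 1" using poly(2) \<open>A \<in> P\<close> by force
  moreover have "has_dimension (support D) d"
    unfolding has_dimension_def using fin poly(1) by (intro exI[of _ P]) (auto simp: P_def support_def d_def)
  ultimately show ?thesis by blast
qed

lemma curve_congruence_support:
  assumes "pieces D" "connected (support D)"
  shows "curve_congruence (E_of (support D))"
  unfolding curve_congruence_def V_of_E_of_support[OF assms(1)]
  using fin_gen_E_of_support[OF assms(1)] assms(2) has_dimension_support[OF assms(1)] by blast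

section \<open>Rational functions on tropical curves\<close>

lemma continuous_on_ereal_edge:
  assumes "continuous_on (dom_upto (ereal l)) h"
  shows "continuous_on {0..ereal l} (\<lambda>t. ereal (h (real_of_ereal t)))"
proof -
  have "continuous_on {0..ereal l} real_of_ereal"
    by (rule continuous_on_subset[OF continuous_on_real]) auto
  moreover have "real_of_ereal ` {0..ereal l} \<subseteq> dom_upto (ereal l)"
  proof
    fix y assume "y \<in> real_of_ereal ` {0..ereal l}"
    then obtain t where "0 \<le> t" "t \<le> ereal l" "y = real_of_ereal t" by auto
    then show "y \<in> dom_upto (ereal l)" by (cases t) (auto simp: dom_upto_def)
  qed
  ultimately have "continuous_on {0..ereal l} (\<lambda>t. h (real_of_ereal t))"
    by (intro continuous_on_compose2[OF assms])
  then show ?thesis by (rule continuous_on_ereal)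
qed

text \<open>The value at \<open>\<infinity>\<close> that continuity forces on an affine function of
  slope \<open>m\<close>.\<close>

definition affine_limit :: "int \<Rightarrow> real \<Rightarrow> ereal" where
  "affine_limit m c = (if m > 0 then \<infinity> else if m < 0 then -\<infinity> else ereal c)"

lemma affine_limit: "((\<lambda>t. ereal (real_of_int m * t + c)) \<longlongrightarrow> affine_limit m c) at_top"
proof -
  have pos: "((\<lambda>t. ereal (real_of_int m * t + c)) \<longlongrightarrow> \<infinity>) at_top" if "m > 0" for m c
    unfolding tendsto_PInfty
  proof
    fix r
    show "\<forall>\<^sub>F t in at_top. ereal r < ereal (real_of_int m * t + c)"
    proof (rule eventually_at_top_linorderI[of "\<bar>r - c\<bar> + 1"])
      fix t assume t: "\<bar>r - c\<bar> + 1 \<le> t"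
      have "1 * t \<le> real_of_int m * t" using that t by (intro mult_right_mono) auto
      then show "ereal r < ereal (real_of_int m * t + c)" using t by simp
    qed
  qed
  consider "m > 0" | "m < 0" | "m = 0" by linarith
  then show ?thesis
  proof cases
    case 2
    then have "((\<lambda>t. - ereal (real_of_int (- m) * t + (- c))) \<longlongrightarrow> - \<infinity>) at_top"
      using pos[of "- m" "- c"] by (intro tendsto_uminus_ereal) auto
    then show ?thesis using 2 by (simp add: affine_limit_def add.commute)
  qed (auto simp: affine_limit_def pos)
qed

lemma at_within_ereal_infinity: "at \<infinity> within {0..\<infinity>::ereal} = at_left \<infinity>"
  by (rule at_within_nhd[of \<infinity> "{0<..}"]) auto

text \<open>The point \<open>\<infinity>\<close> is approached only from the left, through real
  parameters, where \<open>h\<close> is eventually affine; at other points continuity is local and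
  inherited from \<open>h\<close>.\<close>

lemma continuous_on_ereal_ray:
  assumes cont: "continuous_on (dom_upto \<infinity>) h"
    and ev: "\<forall>\<^sub>F t in at_top. h t = real_of_int m * t + c"
  shows "continuous_on {0..\<infinity>} (\<lambda>t. if t = \<infinity> then affine_limit m c else ereal (h (real_of_ereal t)))"
    (is "continuous_on _ ?f")
  unfolding continuous_on_def
proof
  fix x :: ereal assume x: "x \<in> {0..\<infinity>}"
  show "(?f \<longlongrightarrow> ?f x) (at x within {0..\<infinity>})"
  proof (cases "x = \<infinity>")
    case True
    have "\<forall>\<^sub>F t in at_top. ereal (real_of_int m * t + c) = ?f (ereal t)"
      using ev by eventually_elim simp
    then have "((\<lambda>t. ?f (ereal t)) \<longlongrightarrow> affine_limit m c) at_top"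
      by (rule Lim_transform_eventually[OF affine_limit])
    then have "(?f \<longlongrightarrow> affine_limit m c) (at_left \<infinity>)"
      unfolding at_left_PInf filterlim_filtermap .
    then have "(?f \<longlongrightarrow> affine_limit m c) (at \<infinity> within {0..\<infinity>})"
      by (simp only: at_within_ereal_infinity)
    then show ?thesis using True by simp
  next
    case False
    then have x': "x \<in> {0..<\<infinity>}" using x by auto
    have "continuous_on {0..<\<infinity>::ereal} real_of_ereal"
      by (rule continuous_on_subset[OF continuous_on_real]) auto
    moreover have "real_of_ereal ` {0..<\<infinity>} \<subseteq> dom_upto \<infinity>"
      by (auto simp: dom_upto_def intro: real_of_ereal_pos)
    ultimately have "continuous_on {0..<\<infinity>} (\<lambda>t. h (real_of_ereal t))"
      by (intro continuous_on_compose2[OF cont])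
    then have "continuous_on {0..<\<infinity>} (\<lambda>t. ereal (h (real_of_ereal t)))"
      by (rule continuous_on_ereal)
    then have "continuous_on {0..<\<infinity>} ?f" by (rule continuous_on_eq) auto
    then have "(?f \<longlongrightarrow> ?f x) (at x within {0..<\<infinity>})" using x' unfolding continuous_on_def by blast
    moreover have "at x within {0..<\<infinity>} = at x within {0..\<infinity>}"
      by (rule at_within_nhd[of x "{..<\<infinity>}"]) (use x' in auto)
    ultimately show ?thesis by simp
  qed
qed

section \<open>Points, vertices and ends of a curve\<close>

lemma curve_len_pos: "tropical_curve G \<Longrightarrow> e \<in> edges G \<Longrightarrow> 0 < len G e"
  unfolding tropical_curve_def by blast

lemma chart_in_points: "e \<in> edges G \<Longrightarrow> t \<in> {0..len G e} \<Longrightarrow> chart G e t \<in> curve_points G"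
  unfolding curve_points_def by blast

lemma chart_end_in_verts:
  "tropical_curve G \<Longrightarrow> e \<in> edges G \<Longrightarrow> chart G e (len G e) \<in> verts G"
  "tropical_curve G \<Longrightarrow> e \<in> edges G \<Longrightarrow> chart G e 0 \<in> verts G"
proof -
  have *: "edge_ends G e \<subseteq> verts G" if "tropical_curve G" "e \<in> edges G"
    using that unfolding tropical_curve_def by simp
  show "tropical_curve G \<Longrightarrow> e \<in> edges G \<Longrightarrow> chart G e (len G e) \<in> verts G"
    "tropical_curve G \<Longrightarrow> e \<in> edges G \<Longrightarrow> chart G e 0 \<in> verts G"
    using * unfolding edge_ends_def by simp_all
qed

lemma chart_interior_not_vert:
  "tropical_curve G \<Longrightarrow> e \<in> edges G \<Longrightarrow> 0 < t \<Longrightarrow> t < len G e \<Longrightarrow> chart G e t \<notin> verts G"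
proof -
  assume *: "tropical_curve G" "e \<in> edges G" "0 < t" "t < len G e"
  then have "edge_interior G e \<inter> verts G = {}" unfolding tropical_curve_def by blast
  moreover have "chart G e t \<in> edge_interior G e" unfolding edge_interior_def using * by simp
  ultimately show ?thesis by blast
qed

lemma infinite_end_not_end:
  assumes "tropical_curve G" "e \<in> edges G" "len G e = \<infinity>" "e' \<in> edges G" "e' \<noteq> e"
  shows "chart G e \<infinity> \<noteq> chart G e' 0" "chart G e \<infinity> \<noteq> chart G e' (len G e')"
proof -
  have "chart G e \<infinity> \<notin> edge_ends G e'" using assms unfolding tropical_curve_def by blast
  then show "chart G e \<infinity> \<noteq> chart G e' 0" "chart G e \<infinity> \<noteq> chart G e' (len G e')" unfolding edge_ends_def by auto
qed

lemma infinite_end_not_start: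
  "tropical_curve G \<Longrightarrow> e \<in> edges G \<Longrightarrow> len G e = \<infinity> \<Longrightarrow> chart G e 0 \<noteq> chart G e \<infinity>"
  unfolding tropical_curve_def by blast

text \<open>A point at infinity is a vertex, so an edge can meet it only at an end, and the leaf
  condition leaves only the infinite end of its own edge.\<close>

lemma chart_eq_infinite_end:
  assumes G: "tropical_curve G" and e: "e \<in> edges G" "t \<in> {0..len G e}"
    and e': "e' \<in> edges G" "len G e' = \<infinity>" and eq: "chart G e t = chart G e' \<infinity>"
  shows "e' = e \<and> t = \<infinity>"
proof -
  have "chart G e t \<in> verts G" using chart_end_in_verts(1)[OF G e'(1)] e'(2) eq by simp
  then have "\<not> (0 < t \<and> t < len G e)" using chart_interior_not_vert[OF G e(1)] by blast
  moreover have "0 \<le> t" "t \<le> len G e" using e(2) by simp_all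
  ultimately consider "t = 0" | "t = len G e" by (metis order_le_less)
  then show ?thesis
  proof cases
    case 1
    then show ?thesis using eq infinite_end_not_end(1)[OF G e' e(1)] infinite_end_not_start[OF G e'] by (cases "e' = e") auto
  next
    case 2
    then show ?thesis using eq infinite_end_not_end(2)[OF G e' e(1)] e'(2) by (cases "e' = e") auto
  qed
qed

lemma chart_finite_point:
  assumes G: "tropical_curve G" and e: "e \<in> edges G" and t: "t \<in> dom_upto (len G e)"
  shows "chart G e (ereal t) \<in> finite_points G"
proof -
  have t': "ereal t \<in> {0..len G e}" using t by (simp add: dom_upto_def)
  have "chart G e (ereal t) \<noteq> chart G e' \<infinity>" if "e' \<in> edges G" "len G e' = \<infinity>" for e'
    using chart_eq_infinite_end[OF G e t' that] by auto
  then show ?thesis using chart_in_points[OF e t'] unfolding finite_points_def points_at_infinity_def by blast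
qed

lemma finite_point_cases:
  assumes G: "tropical_curve G" and x: "x \<in> finite_points G"
  obtains "x \<in> verts G" | e t where "e \<in> edges G" "t \<in> dom_upto (len G e)" "x = chart G e (ereal t)"
proof -
  have "x \<in> verts G \<or> (\<exists>e\<in>edges G. \<exists>t\<in>{0..len G e}. x = chart G e t)"
    using x unfolding finite_points_def curve_points_def by blast
  then show thesis
  proof (elim disjE bexE)
    fix e t assume h: "e \<in> edges G" "t \<in> {0..len G e}" "x = chart G e t"
    have "t \<noteq> \<infinity>"
    proof
      assume "t = \<infinity>"
      then have "x \<in> points_at_infinity G" using h unfolding points_at_infinity_def by auto
      then show False using x unfolding finite_points_def by blast
    qed
    then obtain s where "t = ereal s" using h(2) by (cases t) auto
    then show thesis using h by (intro that(2)[of e s]) (auto simp: dom_upto_def)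
  qed (rule that(1))
qed

lemma curve_point_cases:
  assumes "x \<in> curve_points G"
  obtains "x \<in> finite_points G" | e where "e \<in> edges G" "len G e = \<infinity>" "x = chart G e \<infinity>"
  using assms unfolding finite_points_def points_at_infinity_def by blast

lemma finite_points_nonempty:
  assumes G: "tropical_curve G" shows "finite_points G \<noteq> {}"
proof (cases "edges G = {}")
  case True
  then have "finite_points G = verts G" by (auto simp: finite_points_def curve_points_def points_at_infinity_def)
  then show ?thesis using G unfolding tropical_curve_def by simp
next
  case False
  then obtain e where e: "e \<in> edges G" by blast
  have "0 \<in> dom_upto (len G e)" using curve_len_pos[OF G e] by (simp add: dom_upto_def zero_ereal_def less_imp_le)
  then show ?thesis using chart_finite_point[OF G e] by blast
qed

section \<open>The gluing topology\<close>

lemma topspace_curve_topology: "topspace (curve_topology G) = curve_points G"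
proof -
  have "openin (curve_topology G) (curve_points G)"
    unfolding openin_curve_topology
  proof (intro conjI ballI)
    fix e assume "e \<in> edges G"
    then have "{t \<in> {0..len G e}. chart G e t \<in> curve_points G} = {0..len G e}" using chart_in_points by blast
    then show "openin (top_of_set {0..len G e}) {t \<in> {0..len G e}. chart G e t \<in> curve_points G}" by simp
  qed simp
  moreover have "topspace (curve_topology G) \<subseteq> curve_points G"
    using openin_topspace[of "curve_topology G"] unfolding openin_curve_topology by blast
  ultimately show ?thesis using openin_subset by blast
qed

text \<open>The topology is the final one for the charts, so continuity is tested edge by
  edge.\<close>

lemma continuous_map_curve_iff:
  fixes k :: "'p \<Rightarrow> 'b::topological_space"
  shows "continuous_map (curve_topology G) euclidean k \<longleftrightarrow> (\<forall>e\<in>edges G. continuous_on {0..len G e} (\<lambda>t. k (chart G e t)))"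
proof -
  have eq: "{t \<in> {0..len G e}. chart G e t \<in> {x \<in> curve_points G. k x \<in> U}} = {0..len G e} \<inter> (\<lambda>t. k (chart G e t)) -` U"
    if "e \<in> edges G" for e U using chart_in_points[OF that] by blast
  have "continuous_map (curve_topology G) euclidean k \<longleftrightarrow>
      (\<forall>U. open U \<longrightarrow> openin (curve_topology G) {x \<in> curve_points G. k x \<in> U})"
    unfolding continuous_map_def by (simp add: topspace_curve_topology)
  also have "\<dots> \<longleftrightarrow> (\<forall>U. open U \<longrightarrow> (\<forall>e\<in>edges G. openin (top_of_set {0..len G e}) ({0..len G e} \<inter> (\<lambda>t. k (chart G e t)) -` U)))"
    unfolding openin_curve_topology using eq by simp
  also have "\<dots> \<longleftrightarrow> (\<forall>e\<in>edges G. continuous_on {0..len G e} (\<lambda>t. k (chart G e t)))"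
    unfolding continuous_openin_preimage_eq by meson
  finally show ?thesis .
qed

text \<open>Each point at infinity is a limit of finite points along its edge, and limits in
  \<open>ereal\<close> are unique.\<close>

lemma continuous_map_curve_unique:
  fixes k k' :: "'p \<Rightarrow> ereal"
  assumes G: "tropical_curve G"
    and k: "k \<in> extensional (curve_points G)" "continuous_map (curve_topology G) euclidean k"
    and k': "k' \<in> extensional (curve_points G)" "continuous_map (curve_topology G) euclidean k'"
    and eq: "\<And>x. x \<in> finite_points G \<Longrightarrow> k x = k' x"
  shows "k = k'"
proof (rule extensionalityI[OF k(1) k'(1)])
  fix x assume "x \<in> curve_points G"
  then show "k x = k' x"
  proof (cases rule: curve_point_cases)
    case 1
    then show ?thesis by (rule eq)
  next
    case (2 e)
    have lim: "((\<lambda>t. f (chart G e (ereal t))) \<longlongrightarrow> f x) at_top"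
      if "continuous_map (curve_topology G) euclidean f" for f :: "'p \<Rightarrow> ereal"
    proof -
      have "continuous_on {0..\<infinity>} (\<lambda>t. f (chart G e t))" using that 2 unfolding continuous_map_curve_iff by force
      then have "((\<lambda>t. f (chart G e t)) \<longlongrightarrow> f x) (at \<infinity> within {0..\<infinity>})"
        using 2 unfolding continuous_on_def by auto
      then have "((\<lambda>t. f (chart G e t)) \<longlongrightarrow> f x) (filtermap ereal at_top)"
        by (simp only: at_within_ereal_infinity at_left_PInf)
      then show ?thesis unfolding filterlim_filtermap .
    qed
    have "\<forall>\<^sub>F t in at_top. k (chart G e (ereal t)) = k' (chart G e (ereal t))"
      by (rule eventually_at_top_linorderI[of 0]) (use 2 in \<open>auto intro!: eq chart_finite_point[OF G] simp: dom_upto_def\<close>)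
    from Lim_transform_eventually[OF lim[OF k(2)] this] lim[OF k'(2)] show ?thesis
      by (intro tendsto_unique[of at_top]) auto
  qed
qed

text \<open>Real-valued counterpart of membership in \<open>Rat_carrier\<close>. Charts are applied
  to real parameters only, so values at points at infinity are unconstrained.\<close>

definition curve_PL :: "('p, 'z) curve_model_scheme \<Rightarrow> ('p \<Rightarrow> real) \<Rightarrow> bool" where
  "curve_PL G h \<longleftrightarrow> (\<forall>e\<in>edges G. continuous_on (dom_upto (len G e)) (\<lambda>t. h (chart G e (ereal t))) \<and>
     pw_int_affine (len G e) (\<lambda>t. h (chart G e (ereal t))))"

lemma curve_PL_D:
  assumes "curve_PL G h" "e \<in> edges G"
  shows "continuous_on (dom_upto (len G e)) (\<lambda>t. h (chart G e (ereal t)))"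
    "pw_int_affine (len G e) (\<lambda>t. h (chart G e (ereal t)))"
  using assms unfolding curve_PL_def by auto

lemma curve_PL_add: "curve_PL G f \<Longrightarrow> curve_PL G g \<Longrightarrow> curve_PL G (\<lambda>x. f x + g x)"
  unfolding curve_PL_def by (auto intro: continuous_on_add pw_int_affine_add)

lemma curve_PL_max: "curve_PL G f \<Longrightarrow> curve_PL G g \<Longrightarrow> curve_PL G (\<lambda>x. max (f x) (g x))"
  unfolding curve_PL_def by (auto intro: continuous_on_max pw_int_affine_max)

section \<open>Rational functions and their real values at finite points\<close>

lemma pw_integral_affine_iff:
  assumes "\<And>t. t \<in> dom_upto l \<Longrightarrow> g (ereal t) = ereal (h t)"
  shows "pw_integral_affine l g \<longleftrightarrow> pw_int_affine l h"
proof -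
  have "(\<exists>(m::int) c. \<forall>t\<in>I. g (ereal t) = ereal (real_of_int m * t + c)) \<longleftrightarrow> int_affine_on I h"
    if "\<Union>\<I> = dom_upto l" "I \<in> \<I>" for I and \<I> :: "real set set"
  proof -
    have "\<forall>t\<in>I. g (ereal t) = ereal (h t)" using that assms by blast
    then show ?thesis unfolding int_affine_on_def by simp
  qed
  then have "(finite \<I> \<and> (\<forall>I\<in>\<I>. is_interval I) \<and> \<Union>\<I> = dom_upto l \<and>
       (\<forall>I\<in>\<I>. \<exists>(m::int) (c::real). \<forall>t\<in>I. g (ereal t) = ereal (real_of_int m * t + c)))
    \<longleftrightarrow> (finite \<I> \<and> (\<forall>I\<in>\<I>. is_interval I) \<and> \<Union>\<I> = dom_upto l \<and> (\<forall>I\<in>\<I>. int_affine_on I h))" for \<I>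
    by (intro conj_cong refl ball_cong) auto
  then show ?thesis unfolding pw_integral_affine_def pw_int_affine_def dom_upto_def[symmetric] by simp
qed

lemma Rat_carrier_finite_value:
  assumes "f \<in> Rat_carrier G" "f \<noteq> curve_const G (-\<infinity>)" "x \<in> finite_points G"
  shows "f x = ereal (real_of_ereal (f x))"
proof -
  have "\<bar>f x\<bar> \<noteq> \<infinity>" using assms unfolding Rat_carrier_def by auto
  then show ?thesis by (simp add: ereal_real)
qed

lemma Rat_carrier_curve_PL:
  assumes G: "tropical_curve G" and f: "f \<in> Rat_carrier G" "f \<noteq> curve_const G (-\<infinity>)"
  shows "curve_PL G (\<lambda>x. real_of_ereal (f x))"
  unfolding curve_PL_def
proof (intro ballI conjI)
  fix e assume e: "e \<in> edges G"
  have val: "f (chart G e (ereal t)) = ereal (real_of_ereal (f (chart G e (ereal t))))" if "t \<in> dom_upto (len G e)" for t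
    by (rule Rat_carrier_finite_value[OF f chart_finite_point[OF G e that]])
  have f': "continuous_map (curve_topology G) euclidean f" "pw_integral_affine (len G e) (\<lambda>t. f (chart G e t))"
    using f e unfolding Rat_carrier_def by auto
  show "pw_int_affine (len G e) (\<lambda>t. real_of_ereal (f (chart G e (ereal t))))"
    using pw_integral_affine_iff[of "len G e" "\<lambda>t. f (chart G e t)" "\<lambda>t. real_of_ereal (f (chart G e (ereal t)))"] val f'(2) by blast
  have "continuous_on {0..len G e} (\<lambda>t. f (chart G e t))"
    using f'(1) e unfolding continuous_map_curve_iff by blast
  then have "continuous_on (dom_upto (len G e)) (\<lambda>t. f (chart G e (ereal t)))"
    by (rule continuous_on_compose2) (auto simp: dom_upto_def intro: continuous_on_ereal continuous_on_id)
  moreover have "(\<lambda>t. f (chart G e (ereal t))) ` dom_upto (len G e) \<subseteq> UNIV - {\<infinity>, -\<infinity>}"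
  proof
    fix y assume "y \<in> (\<lambda>t. f (chart G e (ereal t))) ` dom_upto (len G e)"
    then obtain t where "t \<in> dom_upto (len G e)" "y = f (chart G e (ereal t))" by blast
    then have "y = ereal (real_of_ereal y)" using val by simp
    then show "y \<in> UNIV - {\<infinity>, -\<infinity>}" by (cases y) auto
  qed
  ultimately show "continuous_on (dom_upto (len G e)) (\<lambda>t. real_of_ereal (f (chart G e (ereal t))))"
    by (intro continuous_on_compose2[OF continuous_on_real])
qed

lemma curve_const_continuous: "continuous_map (curve_topology G) euclidean (curve_const G a)"
  unfolding continuous_map_curve_iff
proof
  fix e assume "e \<in> edges G"
  then have "curve_const G a (chart G e t) = a" if "t \<in> {0..len G e}" for t
    using chart_in_points[of e G t] that by (simp add: curve_const_def)
  then show "continuous_on {0..len G e} (\<lambda>t. curve_const G a (chart G e t))"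
    by (intro continuous_on_eq[OF continuous_on_const[of _ a]]) simp
qed

lemma curve_const_finite: "x \<in> finite_points G \<Longrightarrow> curve_const G a x = a"
  unfolding finite_points_def curve_const_def by simp

lemma curve_const_extensional: "curve_const G a \<in> extensional (curve_points G)"
  unfolding curve_const_def by simp

text \<open>Along an infinite edge \<open>h\<close> is eventually affine, which determines the value
  of a continuous extension at the infinite end.\<close>

lemma Rat_carrier_extension:
  assumes G: "tropical_curve G" and h: "curve_PL G h"
  obtains k where "k \<in> Rat_carrier G" "k \<noteq> curve_const G (-\<infinity>)" "\<And>x. x \<in> finite_points G \<Longrightarrow> k x = ereal (h x)"
proof -
  let ?I = "\<lambda>e. e \<in> edges G \<and> len G e = \<infinity>"
  have "\<forall>e\<in>{e. ?I e}. \<exists>mc. \<forall>\<^sub>F t in at_top. h (chart G e (ereal t)) = real_of_int (fst mc) * t + snd mc"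
  proof
    fix e assume "e \<in> {e. ?I e}"
    then have "pw_int_affine \<infinity> (\<lambda>t. h (chart G e (ereal t)))" using curve_PL_D(2)[OF h, of e] by simp
    then obtain m c where "\<forall>\<^sub>F t in at_top. h (chart G e (ereal t)) = real_of_int m * t + c"
      by (rule pw_int_affine_eventually)
    then show "\<exists>mc. \<forall>\<^sub>F t in at_top. h (chart G e (ereal t)) = real_of_int (fst mc) * t + snd mc"
      by (intro exI[of _ "(m, c)"]) simp
  qed
  from bchoice[OF this] obtain mc where
    mc: "\<And>e. e \<in> edges G \<Longrightarrow> len G e = \<infinity> \<Longrightarrow> \<forall>\<^sub>F t in at_top. h (chart G e (ereal t)) = real_of_int (fst (mc e)) * t + snd (mc e)"
    by auto
  \<comment> \<open>A point at infinity ends a single infinite edge, so the choice is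
    determined.\<close>
  define edge_at where "edge_at x = (SOME e. ?I e \<and> chart G e \<infinity> = x)" for x
  have edge_at: "edge_at (chart G e \<infinity>) = e" if "?I e" for e
    unfolding edge_at_def
  proof (rule some_equality)
    fix e' assume e': "?I e' \<and> chart G e' \<infinity> = chart G e \<infinity>"
    then show "e' = e" using chart_eq_infinite_end[OF G, of e \<infinity> e'] that by simp
  qed (use that in simp)
  define k where "k = (\<lambda>x\<in>curve_points G. if x \<in> finite_points G then ereal (h x)
     else affine_limit (fst (mc (edge_at x))) (snd (mc (edge_at x))))"
  have k_fin: "k x = ereal (h x)" if "x \<in> finite_points G" for x
    using that unfolding k_def finite_points_def by simp
  have k_inf: "k (chart G e \<infinity>) = affine_limit (fst (mc e)) (snd (mc e))" if e: "?I e" for e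
  proof -
    have "chart G e \<infinity> \<in> points_at_infinity G" using e unfolding points_at_infinity_def by blast
    moreover have "chart G e \<infinity> \<in> curve_points G" using chart_in_points[of e G \<infinity>] e by simp
    ultimately show ?thesis using edge_at[OF e] unfolding k_def finite_points_def by simp
  qed
  have cont: "continuous_map (curve_topology G) euclidean k"
    unfolding continuous_map_curve_iff
  proof
    fix e assume e: "e \<in> edges G"
    have kt: "k (chart G e t) = ereal (h (chart G e (ereal (real_of_ereal t))))" if "t \<in> {0..len G e}" "t \<noteq> \<infinity>" for t
    proof -
      obtain s where s: "t = ereal s" using \<open>t \<in> {0..len G e}\<close> \<open>t \<noteq> \<infinity>\<close> by (cases t) auto
      then have "s \<in> dom_upto (len G e)" using that by (simp add: dom_upto_def)
      then show ?thesis using k_fin[OF chart_finite_point[OF G e]] s by simp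
    qed
    show "continuous_on {0..len G e} (\<lambda>t. k (chart G e t))"
    proof (cases "len G e = \<infinity>")
      case True
      have "continuous_on {0..\<infinity>} (\<lambda>t. if t = \<infinity> then affine_limit (fst (mc e)) (snd (mc e))
          else ereal (h (chart G e (ereal (real_of_ereal t)))))"
        using curve_PL_D(1)[OF h e] mc[OF e True] True by (intro continuous_on_ereal_ray) simp_all
      then have "continuous_on {0..\<infinity>} (\<lambda>t. k (chart G e t))"
        by (rule continuous_on_eq) (use k_inf[of e] kt e True in auto)
      then show ?thesis using True by simp
    next
      case False
      then obtain l where l: "len G e = ereal l" using curve_len_pos[OF G e] by (cases "len G e") auto
      have "continuous_on {0..ereal l} (\<lambda>t. ereal (h (chart G e (ereal (real_of_ereal t)))))"
        using curve_PL_D(1)[OF h e] l continuous_on_ereal_edge[of l "\<lambda>t. h (chart G e (ereal t))"] by simp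
      then have "continuous_on {0..ereal l} (\<lambda>t. k (chart G e t))"
      proof (rule continuous_on_eq)
        fix t assume "t \<in> {0..ereal l}"
        moreover from this have "t \<noteq> \<infinity>" by auto
        ultimately show "ereal (h (chart G e (ereal (real_of_ereal t)))) = k (chart G e t)" using kt[of t] l by auto
      qed
      then show ?thesis using l by simp
    qed
  qed
  show thesis
  proof (rule that[of k])
    have "pw_integral_affine (len G e) (\<lambda>t. k (chart G e t))" if e: "e \<in> edges G" for e
      using pw_integral_affine_iff[of "len G e" "\<lambda>t. k (chart G e t)" "\<lambda>t. h (chart G e (ereal t))"]
        k_fin[OF chart_finite_point[OF G e]] curve_PL_D(2)[OF h e] by blast
    moreover have "k \<in> extensional (curve_points G)" unfolding k_def by simp
    ultimately show "k \<in> Rat_carrier G" unfolding Rat_carrier_def using cont k_fin by auto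
    obtain x where "x \<in> finite_points G" using finite_points_nonempty[OF G] by blast
    then have "k x \<noteq> curve_const G (-\<infinity>) x" using k_fin curve_const_finite[of x G "-\<infinity>"] by simp
    then show "k \<noteq> curve_const G (-\<infinity>)" by auto
    show "k x = ereal (h x)" if "x \<in> finite_points G" for x using that by (rule k_fin)
  qed
qed

lemma Rat_carrier_continuous:
  assumes "f \<in> Rat_carrier G"
  shows "f \<in> extensional (curve_points G)" "continuous_map (curve_topology G) euclidean f"
  using assms curve_const_continuous curve_const_extensional unfolding Rat_carrier_def by auto

lemma Rat_carrier_eqI:
  assumes "tropical_curve G" "f \<in> Rat_carrier G" "g \<in> Rat_carrier G" "\<And>x. x \<in> finite_points G \<Longrightarrow> f x = g x"
  shows "f = g"
  using assms continuous_map_curve_unique Rat_carrier_continuous by metis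

text \<open>Discharges the definite description behind the operations of \<open>Rat\<close>: values
  at finite points determine a continuous extension.\<close>

lemma continuous_ext_eqI:
  assumes G: "tropical_curve G" and k: "k \<in> Rat_carrier G" and eq: "\<And>x. x \<in> finite_points G \<Longrightarrow> k x = h x"
  shows "continuous_ext G h = k"
  unfolding continuous_ext_def
proof (rule the_equality)
  show "k \<in> extensional (curve_points G) \<and> continuous_map (curve_topology G) euclidean k \<and> (\<forall>x\<in>finite_points G. k x = h x)"
    using Rat_carrier_continuous[OF k] eq by blast
  fix k' assume k': "k' \<in> extensional (curve_points G) \<and> continuous_map (curve_topology G) euclidean k' \<and> (\<forall>x\<in>finite_points G. k' x = h x)"
  then show "k' = k" using Rat_carrier_continuous[OF k] eq
    by (intro continuous_map_curve_unique[OF G]) auto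
qed

lemma Rat_simps [simp]:
  "carrier (Rat G) = Rat_carrier G"
  "x \<otimes>\<^bsub>Rat G\<^esub> y = continuous_ext G (\<lambda>z. x z + y z)" "x \<oplus>\<^bsub>Rat G\<^esub> y = continuous_ext G (\<lambda>z. max (x z) (y z))"
  "\<one>\<^bsub>Rat G\<^esub> = curve_const G 0" "\<zero>\<^bsub>Rat G\<^esub> = curve_const G (-\<infinity>)"
  "struct_map (Rat G) = curve_const G"
  by (simp_all add: Rat_def)

lemma zero_in_Rat_carrier: "curve_const G (-\<infinity>) \<in> Rat_carrier G"
  unfolding Rat_carrier_def by simp

text \<open>If one argument is the zero function, the other is the sum; otherwise both are real at
  finite points and \<open>Rat_carrier_extension\<close> supplies the sum.\<close>

lemma Rat_add:
  assumes G: "tropical_curve G" and f: "f \<in> Rat_carrier G" and g: "g \<in> Rat_carrier G"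
  shows "f \<oplus>\<^bsub>Rat G\<^esub> g \<in> Rat_carrier G"
    "x \<in> finite_points G \<Longrightarrow> (f \<oplus>\<^bsub>Rat G\<^esub> g) x = max (f x) (g x)"
proof -
  have "\<exists>k\<in>Rat_carrier G. \<forall>x\<in>finite_points G. k x = max (f x) (g x)"
  proof (cases "f = curve_const G (-\<infinity>) \<or> g = curve_const G (-\<infinity>)")
    case True
    then show ?thesis using f g by (auto simp: curve_const_finite)
  next
    case False
    obtain k where k: "k \<in> Rat_carrier G" "\<And>x. x \<in> finite_points G \<Longrightarrow> k x = ereal (max (real_of_ereal (f x)) (real_of_ereal (g x)))"
      using Rat_carrier_extension[OF G curve_PL_max[OF Rat_carrier_curve_PL[OF G f] Rat_carrier_curve_PL[OF G g]]] False by auto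
    moreover have "k x = max (f x) (g x)" if "x \<in> finite_points G" for x
      using k(2)[OF that] Rat_carrier_finite_value[OF f _ that] Rat_carrier_finite_value[OF g _ that] False
      by (metis ereal_max)
    ultimately show ?thesis by blast
  qed
  then obtain k where k: "k \<in> Rat_carrier G" "\<And>x. x \<in> finite_points G \<Longrightarrow> k x = max (f x) (g x)" by blast
  have "f \<oplus>\<^bsub>Rat G\<^esub> g = k" using continuous_ext_eqI[OF G k] by simp
  then show "f \<oplus>\<^bsub>Rat G\<^esub> g \<in> Rat_carrier G"
    "x \<in> finite_points G \<Longrightarrow> (f \<oplus>\<^bsub>Rat G\<^esub> g) x = max (f x) (g x)" using k by simp_all
qed

lemma Rat_mult:
  assumes G: "tropical_curve G" and f: "f \<in> Rat_carrier G" and g: "g \<in> Rat_carrier G"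
  shows "f \<otimes>\<^bsub>Rat G\<^esub> g \<in> Rat_carrier G"
    "x \<in> finite_points G \<Longrightarrow> (f \<otimes>\<^bsub>Rat G\<^esub> g) x = f x + g x"
proof -
  \<comment> \<open>The value \<open>\<infinity>\<close> is excluded because
    \<open>-\<infinity> + \<infinity>\<close> is \<open>\<infinity>\<close> in \<open>ereal\<close>,
    which would spoil absorption by the zero function.\<close>
  have ninf: "h x \<noteq> \<infinity>" if "h \<in> Rat_carrier G" "x \<in> finite_points G" for h x
  proof (cases "h = curve_const G (-\<infinity>)")
    case False
    then show ?thesis using Rat_carrier_finite_value[OF that(1) _ that(2)] by (metis PInfty_neq_ereal(1))
  qed (use that in \<open>simp add: curve_const_finite\<close>)
  have "\<exists>k\<in>Rat_carrier G. \<forall>x\<in>finite_points G. k x = f x + g x"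
  proof (cases "f = curve_const G (-\<infinity>) \<or> g = curve_const G (-\<infinity>)")
    case True
    then have "\<forall>x\<in>finite_points G. curve_const G (-\<infinity>) x = f x + g x"
      using ninf[OF f] ninf[OF g] by (auto simp: curve_const_finite)
    then show ?thesis using zero_in_Rat_carrier by blast
  next
    case False
    obtain k where k: "k \<in> Rat_carrier G" "\<And>x. x \<in> finite_points G \<Longrightarrow> k x = ereal (real_of_ereal (f x) + real_of_ereal (g x))"
      using Rat_carrier_extension[OF G curve_PL_add[OF Rat_carrier_curve_PL[OF G f] Rat_carrier_curve_PL[OF G g]]] False by auto
    moreover have "k x = f x + g x" if "x \<in> finite_points G" for x
      using k(2)[OF that] Rat_carrier_finite_value[OF f _ that] Rat_carrier_finite_value[OF g _ that] False
      by (metis plus_ereal.simps(1))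
    ultimately show ?thesis by blast
  qed
  then obtain k where k: "k \<in> Rat_carrier G" "\<And>x. x \<in> finite_points G \<Longrightarrow> k x = f x + g x" by blast
  have "f \<otimes>\<^bsub>Rat G\<^esub> g = k" using continuous_ext_eqI[OF G k] by simp
  then show "f \<otimes>\<^bsub>Rat G\<^esub> g \<in> Rat_carrier G"
    "x \<in> finite_points G \<Longrightarrow> (f \<otimes>\<^bsub>Rat G\<^esub> g) x = f x + g x" using k by simp_all
qed

section \<open>Homomorphisms into the semifield of a curve\<close>

text \<open>The map theta, recovered from the homomorphism. For a homomorphism into
  \<open>Rat G\<close> the values of \<open>\<psi> (coord i)\<close> at finite points are real, so
  \<open>real_of_ereal\<close> loses nothing there.\<close>

definition eval_map :: "((real^'n::finite \<Rightarrow> ereal) \<Rightarrow> 'p \<Rightarrow> ereal) \<Rightarrow> 'p \<Rightarrow> real^'n" where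
  "eval_map \<psi> x = (\<chi> i. real_of_ereal (\<psi> (coord i) x))"

lemma talg_homD:
  assumes "h \<in> talg_hom A B"
  shows "x \<in> carrier A \<Longrightarrow> h x \<in> carrier B"
    "x \<in> carrier A \<Longrightarrow> y \<in> carrier A \<Longrightarrow> h (x \<otimes>\<^bsub>A\<^esub> y) = h x \<otimes>\<^bsub>B\<^esub> h y"
    "x \<in> carrier A \<Longrightarrow> y \<in> carrier A \<Longrightarrow> h (x \<oplus>\<^bsub>A\<^esub> y) = h x \<oplus>\<^bsub>B\<^esub> h y"
    "h \<one>\<^bsub>A\<^esub> = \<one>\<^bsub>B\<^esub>" "h \<zero>\<^bsub>A\<^esub> = \<zero>\<^bsub>B\<^esub>" "a \<noteq> \<infinity> \<Longrightarrow> h (struct_map A a) = struct_map B a"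
  using assms unfolding talg_hom_def semiring_hom_def ring_hom_def trop_def by auto

lemma talg_homI:
  assumes "\<And>x. x \<in> carrier A \<Longrightarrow> h x \<in> carrier B"
    "\<And>x y. x \<in> carrier A \<Longrightarrow> y \<in> carrier A \<Longrightarrow> h (x \<otimes>\<^bsub>A\<^esub> y) = h x \<otimes>\<^bsub>B\<^esub> h y"
    "\<And>x y. x \<in> carrier A \<Longrightarrow> y \<in> carrier A \<Longrightarrow> h (x \<oplus>\<^bsub>A\<^esub> y) = h x \<oplus>\<^bsub>B\<^esub> h y"
    "h \<one>\<^bsub>A\<^esub> = \<one>\<^bsub>B\<^esub>" "h \<zero>\<^bsub>A\<^esub> = \<zero>\<^bsub>B\<^esub>" "\<And>a. a \<noteq> \<infinity> \<Longrightarrow> h (struct_map A a) = struct_map B a"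
  shows "h \<in> talg_hom A B"
  using assms unfolding talg_hom_def semiring_hom_def ring_hom_def trop_def by auto

lemma ereal_sum_eq_0_finite:
  fixes a b :: ereal
  assumes "a + b = 0" shows "a = ereal (real_of_ereal a)" "b = - a"
  using assms by (cases a; cases b; auto)+

text \<open>Evaluation at a finite point turns the operations of \<open>Rat G\<close> into those of
  \<open>ereal\<close>, so both sides respect the generating operations of
  \<open>PL\<close>.\<close>

lemma trop_rational_hom_eval_PL:
  assumes G: "tropical_curve G" and \<psi>: "\<psi> \<in> talg_hom trop_rational (Rat G)" and x: "x \<in> finite_points G"
    and h: "h \<in> PL"
  shows "\<psi> (\<lambda>z. ereal (h z)) x = ereal (h (eval_map \<psi> x))"
proof -
  note hom = talg_homD[OF \<psi>]
  have mult: "\<psi> (\<lambda>z. ereal (f z + g z)) x = \<psi> (\<lambda>z. ereal (f z)) x + \<psi> (\<lambda>z. ereal (g z)) x"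
    if "f \<in> PL" "g \<in> PL" for f g
    using hom(2)[OF PL_in_carrier[OF that(1)] PL_in_carrier[OF that(2)]]
      Rat_mult(2)[OF G _ _ x, of "\<psi> (\<lambda>z. ereal (f z))" "\<psi> (\<lambda>z. ereal (g z))"]
      hom(1)[OF PL_in_carrier[OF that(1)]] hom(1)[OF PL_in_carrier[OF that(2)]] by simp
  have add: "\<psi> (\<lambda>z. ereal (max (f z) (g z))) x = max (\<psi> (\<lambda>z. ereal (f z)) x) (\<psi> (\<lambda>z. ereal (g z)) x)"
    if "f \<in> PL" "g \<in> PL" for f g
    using hom(3)[OF PL_in_carrier[OF that(1)] PL_in_carrier[OF that(2)]]
      Rat_add(2)[OF G _ _ x, of "\<psi> (\<lambda>z. ereal (f z))" "\<psi> (\<lambda>z. ereal (g z))"]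
      hom(1)[OF PL_in_carrier[OF that(1)]] hom(1)[OF PL_in_carrier[OF that(2)]] by simp
  have const: "\<psi> (\<lambda>z. ereal c) x = ereal c" for c
    using hom(6)[of "ereal c"] curve_const_finite[OF x] by simp
  \<comment> \<open>The values of mutually inverse elements add up to \<open>0\<close>; this forces
    them to be real and settles the case of negation.\<close>
  have inverse: "\<psi> (\<lambda>z. ereal (f z)) x + \<psi> (\<lambda>z. ereal (- f z)) x = 0" if "f \<in> PL" for f
    using mult[OF that PL_uminus[OF that]] const[of 0] by (simp add: zero_ereal_def)
  show ?thesis using h
  proof (induction rule: PL_induct)
    case (const c)
    show ?case by (rule \<open>\<psi> (\<lambda>z. ereal c) x = ereal c\<close>)
  next
    case (coord i)
    have "\<psi> (coord i) x = ereal (real_of_ereal (\<psi> (coord i) x))"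
      using ereal_sum_eq_0_finite(1)[OF inverse[OF PL_coord]] by (simp only: coord_def)
    then show ?case by (simp add: eval_map_def coord_def)
  next
    case (add f g)
    then show ?case using mult[of f g] by simp
  next
    case (uminus f)
    then show ?case using ereal_sum_eq_0_finite(2)[OF inverse[OF uminus(1)]] by simp
  next
    case (max f g)
    then show ?case using \<open>f \<in> PL \<Longrightarrow> g \<in> PL \<Longrightarrow> \<psi> (\<lambda>z. ereal (max (f z) (g z))) x = max (\<psi> (\<lambda>z. ereal (f z)) x) (\<psi> (\<lambda>z. ereal (g z)) x)\<close>
      by (simp add: ereal_max)
  qed
qed

lemma trop_rational_hom_eval:
  assumes G: "tropical_curve G" and \<psi>: "\<psi> \<in> talg_hom trop_rational (Rat G)" and x: "x \<in> finite_points G"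
    and F: "F \<in> carrier trop_rational"
  shows "\<psi> F x = F (eval_map \<psi> x)"
proof (cases rule: trop_rational_cases[OF F])
  case 1
  then show ?thesis using talg_homD(5)[OF \<psi>] curve_const_finite[OF x] by simp
next
  case (2 f)
  then show ?thesis using trop_rational_hom_eval_PL[OF G \<psi> x] by simp
qed

lemma Ker_trop_rational_hom:
  assumes G: "tropical_curve G" and \<psi>: "\<psi> \<in> talg_hom trop_rational (Rat G)"
  shows "Ker trop_rational \<psi> = E_of (eval_map \<psi> ` finite_points G)"
proof -
  have "\<psi> F = \<psi> F' \<longleftrightarrow> (\<forall>x\<in>finite_points G. F (eval_map \<psi> x) = F' (eval_map \<psi> x))"
    if "F \<in> carrier trop_rational" "F' \<in> carrier trop_rational" for F F'
  proof
    assume "\<psi> F = \<psi> F'"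
    then show "\<forall>x\<in>finite_points G. F (eval_map \<psi> x) = F' (eval_map \<psi> x)"
      using trop_rational_hom_eval[OF G \<psi> _ that(1)] trop_rational_hom_eval[OF G \<psi> _ that(2)] by simp
  next
    assume "\<forall>x\<in>finite_points G. F (eval_map \<psi> x) = F' (eval_map \<psi> x)"
    then show "\<psi> F = \<psi> F'"
      using that talg_homD(1)[OF \<psi>] trop_rational_hom_eval[OF G \<psi>] by (intro Rat_carrier_eqI[OF G]) auto
  qed
  then show ?thesis unfolding Ker_def E_of_def by auto
qed

section \<open>Images of curves as finite unions of segments\<close>

definition piecewise :: "(real^'n::finite) set \<Rightarrow> bool" where
  "piecewise A \<longleftrightarrow> (\<exists>D. finite D \<and> (\<forall>(p, u, T)\<in>D. primitive u \<and> 0 \<le> T) \<and> support D = A)"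

text \<open>\<open>piecewise\<close> admits the empty set of pieces, which makes it stable under
  unions over empty index sets; nonemptiness is restored here.\<close>

lemma piecewise_pieces:
  assumes "piecewise A" "A \<noteq> {}" obtains D where "pieces D" "support D = A"
proof -
  obtain D where "finite D" "\<forall>(p, u, T)\<in>D. primitive u \<and> 0 \<le> T" "support D = A"
    using assms unfolding piecewise_def by blast
  moreover from this have "D \<noteq> {}" using assms unfolding support_def by auto
  ultimately show thesis using that unfolding pieces_def by blast
qed

lemma piecewise_UN:
  assumes "finite I" "\<And>i. i \<in> I \<Longrightarrow> piecewise (A i)"
  shows "piecewise (\<Union>i\<in>I. A i)"
proof -
  have "\<forall>i\<in>I. \<exists>D. finite D \<and> (\<forall>(p, u, T)\<in>D. primitive u \<and> 0 \<le> T) \<and> support D = A i"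
    using assms(2) unfolding piecewise_def by simp
  from bchoice[OF this] obtain D where
    D: "\<forall>i\<in>I. finite (D i) \<and> (\<forall>(p, u, T)\<in>D i. primitive u \<and> 0 \<le> T) \<and> support (D i) = A i" by (elim exE)
  have "support (\<Union>i\<in>I. D i) = (\<Union>i\<in>I. support (D i))" by (simp add: support_def)
  also have "\<dots> = (\<Union>i\<in>I. A i)" using D by simp
  finally have "support (\<Union>i\<in>I. D i) = (\<Union>i\<in>I. A i)" .
  moreover have "finite (\<Union>i\<in>I. D i)" using D assms(1) by simp
  moreover have "\<forall>(p, u, T)\<in>(\<Union>i\<in>I. D i). primitive u \<and> 0 \<le> T" using D by simp
  ultimately show ?thesis unfolding piecewise_def by (intro exI conjI)
qed

text \<open>The velocity \<open>m\<close> need not be primitive. If \<open>m = d v\<close> with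
  \<open>v\<close> primitive, the same set is traversed along \<open>v\<close> with the length
  multiplied by \<open>d\<close>; if \<open>m = 0\<close>, it is a point, presented as a segment of
  length \<open>0\<close> with an arbitrary direction.\<close>

lemma piecewise_affine_image:
  assumes "0 \<le> S"
  shows "piecewise ((\<lambda>t. c + t *\<^sub>R rvec m) ` dom_upto S)"
proof -
  have "\<exists>u T. primitive u \<and> 0 \<le> T \<and> seg c u T = (\<lambda>t. c + t *\<^sub>R rvec m) ` dom_upto S"
  proof (cases "m = 0")
    case True
    have "dom_upto 0 = {0}" by (auto simp: dom_upto_def zero_ereal_def)
    moreover have "0 \<in> dom_upto S" using assms by (simp add: dom_upto_def zero_ereal_def)
    ultimately have "seg c (axis undefined 1) 0 = (\<lambda>t. c + t *\<^sub>R rvec m) ` dom_upto S"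
      unfolding seg_def using True by (auto simp: zero_vec_def[symmetric] image_constant_conv)
    then show ?thesis using primitive_axis by (intro exI[of _ "axis undefined 1"] exI[of _ 0]) simp
  next
    case False
    obtain d v where d: "d > 0" "primitive v" "rvec m = of_int d *\<^sub>R rvec v"
      using primitive_direction[OF False] by blast
    have "(\<lambda>t. t * of_int d) ` dom_upto S = dom_upto (S * ereal (of_int d))"
    proof
      show "(\<lambda>t. t * of_int d) ` dom_upto S \<subseteq> dom_upto (S * ereal (of_int d))"
      proof
        fix y assume "y \<in> (\<lambda>t. t * of_int d) ` dom_upto S"
        then obtain t where t: "0 \<le> t" "ereal t \<le> S" "y = t * of_int d" by (auto simp: dom_upto_def)
        have "ereal t * ereal (of_int d) \<le> S * ereal (of_int d)" using t d by (intro ereal_mult_right_mono) auto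
        then show "y \<in> dom_upto (S * ereal (of_int d))" using t d by (simp add: dom_upto_def)
      qed
      show "dom_upto (S * ereal (of_int d)) \<subseteq> (\<lambda>t. t * of_int d) ` dom_upto S"
      proof
        fix y assume "y \<in> dom_upto (S * ereal (of_int d))"
        then have y: "0 \<le> y" "ereal y \<le> S * ereal (of_int d)" by (auto simp: dom_upto_def)
        have "ereal (y / of_int d) \<le> S" using y(2) d(1) by (cases S) (auto simp: field_simps)
        then show "y \<in> (\<lambda>t. t * of_int d) ` dom_upto S"
          using d y by (intro image_eqI[of _ _ "y / of_int d"]) (auto simp: dom_upto_def)
      qed
    qed
    then have "seg c v (S * ereal (of_int d)) = (\<lambda>t. c + t *\<^sub>R rvec m) ` dom_upto S"
      unfolding seg_def d(3) by (simp add: image_image[symmetric, where f = "\<lambda>t. c + t *\<^sub>R rvec v" and g = "\<lambda>t. t * of_int d"])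
    then show ?thesis using d assms by (intro exI[of _ v] exI[of _ "S * ereal (of_int d)"]) auto
  qed
  then obtain u T where "primitive u" "0 \<le> T" "seg c u T = (\<lambda>t. c + t *\<^sub>R rvec m) ` dom_upto S" by blast
  then show ?thesis unfolding piecewise_def by (intro exI[of _ "{(c, u, T)}"]) (auto simp: support_def)
qed

lemma piecewise_point: "piecewise {c}"
proof -
  have "dom_upto 0 = {0}" by (auto simp: dom_upto_def zero_ereal_def)
  then show ?thesis using piecewise_affine_image[of 0 c 0] by simp
qed

locale curve_map =
  fixes G :: "('p, 'z) curve_model_scheme" and \<theta> :: "'p \<Rightarrow> real^'n::finite"
  assumes G: "tropical_curve G"
    and coords: "\<And>i. curve_PL G (\<lambda>x. \<theta> x $ i)"
begin

text \<open>One subdivision of the edge serves all coordinates at once, so the map is affine with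
  integral velocity on each part.\<close>

lemma piecewise_edge:
  assumes e: "e \<in> edges G"
  shows "piecewise ((\<lambda>t. \<theta> (chart G e (ereal t))) ` dom_upto (len G e))"
proof -
  let ?H = "range (\<lambda>i t. \<theta> (chart G e (ereal t)) $ i)"
  obtain \<C> where C: "finite \<C>"
    "\<And>a S. (a, S) \<in> \<C> \<Longrightarrow> 0 \<le> a \<and> 0 \<le> S \<and> ereal a + S \<le> len G e"
    "\<And>a S h. (a, S) \<in> \<C> \<Longrightarrow> h \<in> ?H \<Longrightarrow> \<exists>(m::int) c. \<forall>t\<in>dom_upto S. h (a + t) = real_of_int m * t + c"
    "\<And>t. t \<in> dom_upto (len G e) \<Longrightarrow> \<exists>(a, S)\<in>\<C>. a \<le> t \<and> ereal (t - a) \<le> S"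
  proof (rule pw_int_affine_closed_cover[of ?H "len G e"])
    show "finite ?H" by simp
    fix h assume "h \<in> ?H"
    then obtain i where "h = (\<lambda>t. \<theta> (chart G e (ereal t)) $ i)" by (rule rangeE)
    then show "pw_int_affine (len G e) h" "continuous_on (dom_upto (len G e)) h"
      using curve_PL_D[OF coords e] by simp_all
  qed (rule that)
  define B where "B r = (\<lambda>t. \<theta> (chart G e (ereal (fst r + t)))) ` dom_upto (snd r)" for r
  have "piecewise (B r)" if r: "r \<in> \<C>" for r
  proof -
    obtain a S where aS: "r = (a, S)" by (cases r)
    have "\<exists>(m::int) c. \<forall>t\<in>dom_upto S. \<theta> (chart G e (ereal (a + t))) $ i = real_of_int m * t + c" for i
      using C(3)[of a S "\<lambda>t. \<theta> (chart G e (ereal t)) $ i", OF _ rangeI] r unfolding aS by simp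
    then have "\<forall>i. \<exists>mc. \<forall>t\<in>dom_upto S. \<theta> (chart G e (ereal (a + t))) $ i = real_of_int (fst mc) * t + snd mc"
      unfolding split_paired_Ex fst_conv snd_conv by (intro allI)
    from choice[OF this] obtain mc where
      "\<forall>i. \<forall>t\<in>dom_upto S. \<theta> (chart G e (ereal (a + t))) $ i = real_of_int (fst (mc i)) * t + snd (mc i)" by blast
    moreover define m c where "m i = fst (mc i)" and "c i = snd (mc i)" for i
    ultimately have mc: "\<And>i t. t \<in> dom_upto S \<Longrightarrow> \<theta> (chart G e (ereal (a + t))) $ i = real_of_int (m i) * t + c i"
      by simp
    have "\<theta> (chart G e (ereal (a + t))) = (\<chi> i. c i) + t *\<^sub>R rvec (\<chi> i. m i)" if "t \<in> dom_upto S" for t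
      using mc[OF that] by (simp add: vec_eq_iff)
    then have "B r = (\<lambda>t. (\<chi> i. c i) + t *\<^sub>R rvec (\<chi> i. m i)) ` dom_upto S"
      unfolding B_def aS by (intro image_cong) simp_all
    then show ?thesis using piecewise_affine_image[of S "\<chi> i. c i" "\<chi> i. m i"] C(2)[of a S] r aS by (simp only:)
  qed
  then have "piecewise (\<Union>r\<in>\<C>. B r)" by (rule piecewise_UN[OF C(1)])
  moreover have "(\<lambda>t. \<theta> (chart G e (ereal t))) ` dom_upto (len G e) = (\<Union>r\<in>\<C>. B r)"
  proof
    show "(\<lambda>t. \<theta> (chart G e (ereal t))) ` dom_upto (len G e) \<subseteq> (\<Union>r\<in>\<C>. B r)"
    proof
      fix y assume "y \<in> (\<lambda>t. \<theta> (chart G e (ereal t))) ` dom_upto (len G e)"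
      then obtain t where t: "t \<in> dom_upto (len G e)" "y = \<theta> (chart G e (ereal t))" by blast
      obtain a S where aS: "(a, S) \<in> \<C>" "a \<le> t" "ereal (t - a) \<le> S" using C(4)[OF t(1)] by blast
      then have "y \<in> B (a, S)" unfolding B_def t(2)
        by (intro image_eqI[of _ _ "t - a"]) (simp_all add: dom_upto_def)
      then show "y \<in> (\<Union>r\<in>\<C>. B r)" using aS by blast
    qed
    show "(\<Union>r\<in>\<C>. B r) \<subseteq> (\<lambda>t. \<theta> (chart G e (ereal t))) ` dom_upto (len G e)"
    proof
      fix y assume "y \<in> (\<Union>r\<in>\<C>. B r)"
      then obtain a S t where t: "(a, S) \<in> \<C>" "t \<in> dom_upto S" "y = \<theta> (chart G e (ereal (a + t)))"
        unfolding B_def by auto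
      have "ereal a + ereal t \<le> ereal a + S" using t(2) by (intro add_left_mono) (simp add: dom_upto_def)
      then have "a + t \<in> dom_upto (len G e)" using C(2)[OF t(1)] t(2) order_trans by (auto simp: dom_upto_def)
      then show "y \<in> (\<lambda>t. \<theta> (chart G e (ereal t))) ` dom_upto (len G e)" using t(3) by blast
    qed
  qed
  ultimately show ?thesis by simp
qed

lemma finite_points_eq:
  "finite_points G = (verts G \<inter> finite_points G) \<union> (\<Union>e\<in>edges G. (\<lambda>t. chart G e (ereal t)) ` dom_upto (len G e))"
proof
  show "finite_points G \<subseteq> (verts G \<inter> finite_points G) \<union> (\<Union>e\<in>edges G. (\<lambda>t. chart G e (ereal t)) ` dom_upto (len G e))"
  proof
    fix x assume x: "x \<in> finite_points G"
    show "x \<in> (verts G \<inter> finite_points G) \<union> (\<Union>e\<in>edges G. (\<lambda>t. chart G e (ereal t)) ` dom_upto (len G e))"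
      by (rule finite_point_cases[OF G x]) (use x in auto)
  qed
  show "(verts G \<inter> finite_points G) \<union> (\<Union>e\<in>edges G. (\<lambda>t. chart G e (ereal t)) ` dom_upto (len G e)) \<subseteq> finite_points G"
    using chart_finite_point[OF G] by auto
qed

lemma piecewise_image: "piecewise (\<theta> ` finite_points G)"
proof -
  have "\<theta> ` finite_points G = (\<Union>v\<in>verts G \<inter> finite_points G. {\<theta> v}) \<union>
      (\<Union>e\<in>edges G. (\<lambda>t. \<theta> (chart G e (ereal t))) ` dom_upto (len G e))" (is "_ = ?A \<union> ?B")
    by (subst finite_points_eq) (simp only: image_Un image_UN image_image UNION_singleton_eq_range)
  moreover have "finite (verts G)" "finite (edges G)" using G unfolding tropical_curve_def by auto
  then have "piecewise ?A" "piecewise ?B"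
    by (simp_all add: piecewise_UN piecewise_point piecewise_edge)
  then have "piecewise (?A \<union> ?B)" using piecewise_UN[of "{True, False}" "\<lambda>b. if b then ?A else ?B"] by (simp add: Un_commute)
  ultimately show ?thesis by simp
qed

lemma connected_edge:
  assumes e: "e \<in> edges G"
  shows "connected ((\<lambda>t. \<theta> (chart G e (ereal t))) ` dom_upto (len G e))"
proof (rule connected_continuous_image)
  show "continuous_on (dom_upto (len G e)) (\<lambda>t. \<theta> (chart G e (ereal t)))"
    using continuous_on_vec_lambda[of "dom_upto (len G e)" "\<lambda>i t. \<theta> (chart G e (ereal t)) $ i"] curve_PL_D(1)[OF coords e] by simp
  show "connected (dom_upto (len G e))" using is_interval_dom_upto by (simp add: is_interval_connected_1[symmetric])
qed

end

context curve_map
begin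

text \<open>A vertex at infinity is represented by the other end of its edge.\<close>

definition finite_proxies :: "'p \<Rightarrow> 'p set" where
  "finite_proxies v = (if v \<in> finite_points G then {v} else
     {chart G e 0 | e. e \<in> edges G \<and> len G e = \<infinity> \<and> chart G e \<infinity> = v})"

lemma zero_in_dom: "e \<in> edges G \<Longrightarrow> 0 \<in> dom_upto (len G e)"
  using curve_len_pos[OF G, of e] by (simp add: dom_upto_def zero_ereal_def less_imp_le)

lemma edge_start_finite: "e \<in> edges G \<Longrightarrow> chart G e 0 \<in> finite_points G"
  using chart_finite_point[OF G _ zero_in_dom] by (metis zero_ereal_def)

lemma finite_proxies_nonempty:
  assumes "v \<in> verts G" shows "finite_proxies v \<noteq> {}"
proof (cases "v \<in> finite_points G")
  case False
  moreover have "v \<in> curve_points G" using assms unfolding curve_points_def by blast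
  ultimately obtain e where "e \<in> edges G" "len G e = \<infinity>" "v = chart G e \<infinity>"
    by (elim curve_point_cases) auto
  then show ?thesis using False unfolding finite_proxies_def by auto
qed (simp add: finite_proxies_def)

definition edge_image :: "nat \<Rightarrow> (real^'n) set" where
  "edge_image e = (\<lambda>t. \<theta> (chart G e (ereal t))) ` dom_upto (len G e)"

lemma edge_image_start: "e \<in> edges G \<Longrightarrow> \<theta> (chart G e 0) \<in> edge_image e"
  unfolding edge_image_def using zero_in_dom[of e] by (intro image_eqI[of _ _ 0]) (simp_all add: zero_ereal_def)

text \<open>Both ends of an infinite edge have its start as proxy; this rests on the uniqueness of
  the infinite edge that ends at a given point at infinity.\<close>

lemma finite_proxies_edge:
  assumes e: "e \<in> edges G" and v: "v \<in> edge_ends G e" and w: "w \<in> finite_proxies v"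
  shows "\<theta> w \<in> edge_image e"
proof (cases "v = chart G e 0")
  case True
  then have "w = chart G e 0" using w edge_start_finite[OF e] unfolding finite_proxies_def by simp
  then show ?thesis using edge_image_start[OF e] by simp
next
  case False
  then have v': "v = chart G e (len G e)" using v unfolding edge_ends_def by simp
  show ?thesis
  proof (cases "len G e = \<infinity>")
    case True
    have "v \<in> points_at_infinity G" using v' True e unfolding points_at_infinity_def by auto
    then have "v \<notin> finite_points G" unfolding finite_points_def by blast
    then obtain e' where e': "w = chart G e' 0" "e' \<in> edges G" "len G e' = \<infinity>" "chart G e' \<infinity> = v"
      using w unfolding finite_proxies_def by auto
    have "e' = e" using chart_eq_infinite_end[OF G e _ e'(2,3), of \<infinity>] v' e'(4) True by simp
    then show ?thesis using edge_image_start[OF e] e'(1) by simp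
  next
    case False
    then obtain l where l: "len G e = ereal l" using curve_len_pos[OF G e] by (cases "len G e") auto
    then have dl: "l \<in> dom_upto (len G e)" using curve_len_pos[OF G e] by (simp add: dom_upto_def)
    then have "w = chart G e (ereal l)" using w v' l chart_finite_point[OF G e dl] unfolding finite_proxies_def by simp
    then show ?thesis unfolding edge_image_def using dl by blast
  qed
qed

lemma edge_image_subset: "e \<in> edges G \<Longrightarrow> edge_image e \<subseteq> \<theta> ` finite_points G"
  unfolding edge_image_def using chart_finite_point[OF G] by blast

lemma edge_image_component:
  assumes "e \<in> edges G" "x \<in> edge_image e" "y \<in> edge_image e"
  shows "connected_component (\<theta> ` finite_points G) x y"
  unfolding connected_component_def
  using connected_edge[OF assms(1)] edge_image_subset[OF assms(1)] assms(2,3)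
  by (intro exI[of _ "edge_image e"]) (simp add: edge_image_def)

text \<open>Images of edges are connected, and the proxies of adjacent vertices lie on one of them.
  A path of edges thus becomes a chain inside one connected component, and each finite point is a
  vertex or lies on an edge.\<close>

lemma connected_image: "connected (\<theta> ` finite_points G)"
proof -
  let ?V = "\<theta> ` finite_points G"
  let ?r = "{(a, b). \<exists>e\<in>edges G. edge_ends G e = {a, b}}"
  obtain u0 where u0: "u0 \<in> verts G" using G unfolding tropical_curve_def by auto
  have reach: "(u0, v) \<in> ?r\<^sup>*" if "v \<in> verts G" for v
  proof -
    have "\<forall>u\<in>verts G. \<forall>v\<in>verts G. (u, v) \<in> ?r\<^sup>*"
      using G unfolding tropical_curve_def by (elim conjE)
    then show ?thesis using u0 that by blast
  qed
  obtain w0 where w0: "w0 \<in> finite_proxies u0" using finite_proxies_nonempty[OF u0] by blast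
  have prox_sub: "finite_proxies v \<subseteq> finite_points G" for v
    using edge_start_finite unfolding finite_proxies_def by auto
  \<comment> \<open>The induction speaks of all proxies of a vertex, so its base case needs the
    proxy of \<open>u0\<close> to be unique.\<close>
  have uniq: "w = w0" if "w \<in> finite_proxies u0" for w
  proof (cases "u0 \<in> finite_points G")
    case True
    then show ?thesis using that w0 unfolding finite_proxies_def by simp
  next
    case False
    obtain e where e: "w = chart G e 0" "e \<in> edges G" "len G e = \<infinity>" "chart G e \<infinity> = u0"
      using \<open>w \<in> finite_proxies u0\<close> False unfolding finite_proxies_def by auto
    obtain e' where e': "w0 = chart G e' 0" "e' \<in> edges G" "len G e' = \<infinity>" "chart G e' \<infinity> = u0"
      using w0 False unfolding finite_proxies_def by auto
    have "e' = e" using chart_eq_infinite_end[OF G e(2) _ e'(2,3), of \<infinity>] e e' by simp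
    then show ?thesis using e e' by simp
  qed
  have vert: "\<forall>w\<in>finite_proxies v. connected_component ?V (\<theta> w0) (\<theta> w)" if "(u0, v) \<in> ?r\<^sup>*" for v
    using that
  proof (induction rule: rtrancl_induct)
    case base
    have "\<theta> w0 \<in> ?V" using w0 prox_sub by blast
    then show ?case using uniq by (auto simp: connected_component_refl)
  next
    case (step v v')
    from step.hyps(2) obtain e where e: "e \<in> edges G" "edge_ends G e = {v, v'}" by auto
    have "edge_ends G e \<subseteq> verts G" using chart_end_in_verts[OF G e(1)] unfolding edge_ends_def by simp
    then have "v \<in> verts G" using e(2) by simp
    then obtain w where w: "w \<in> finite_proxies v" using finite_proxies_nonempty by blast
    then have cw: "connected_component ?V (\<theta> w0) (\<theta> w)" using step.IH by blast
    show ?case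
    proof
      fix w' assume w': "w' \<in> finite_proxies v'"
      have "connected_component ?V (\<theta> w) (\<theta> w')"
        by (rule edge_image_component[OF e(1)]) (use finite_proxies_edge[OF e(1)] w w' e(2) in auto)
      then show "connected_component ?V (\<theta> w0) (\<theta> w')" using cw by (rule connected_component_trans[rotated])
    qed
  qed
  have all: "connected_component ?V (\<theta> w0) y" if "y \<in> ?V" for y
  proof -
    obtain x where x: "x \<in> finite_points G" "y = \<theta> x" using \<open>y \<in> ?V\<close> by blast
    show ?thesis
    proof (rule finite_point_cases[OF G x(1)])
      assume "x \<in> verts G"
      then show ?thesis using vert[OF reach] x unfolding finite_proxies_def by auto
    next
      fix e t assume e: "e \<in> edges G" "t \<in> dom_upto (len G e)" "x = chart G e (ereal t)"
      have "chart G e 0 \<in> verts G" by (rule chart_end_in_verts(2)[OF G e(1)])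
      then have "connected_component ?V (\<theta> w0) (\<theta> (chart G e 0))"
        using vert[OF reach] edge_start_finite[OF e(1)] unfolding finite_proxies_def by auto
      moreover have "connected_component ?V (\<theta> (chart G e 0)) y"
        by (rule edge_image_component[OF e(1) edge_image_start[OF e(1)]]) (use e x in \<open>auto simp: edge_image_def\<close>)
      ultimately show ?thesis by (rule connected_component_trans)
    qed
  qed
  show ?thesis unfolding connected_iff_connected_component
  proof (intro ballI)
    fix x y assume "x \<in> ?V" "y \<in> ?V"
    then show "connected_component ?V x y"
      by (intro connected_component_trans[OF connected_component_sym[OF all] all])
  qed
qed

end

lemma trop_rational_hom_curve_map:
  fixes \<psi> :: "(real^'n::finite \<Rightarrow> ereal) \<Rightarrow> 'p \<Rightarrow> ereal"
  assumes G: "tropical_curve G" and \<psi>: "\<psi> \<in> talg_hom trop_rational (Rat G)"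
  shows "curve_map G (eval_map \<psi>)"
proof
  fix i :: 'n
  obtain x where x: "x \<in> finite_points G" using finite_points_nonempty[OF G] by blast
  have mem: "coord i \<in> carrier trop_rational" unfolding coord_def by (rule PL_in_carrier[OF PL_coord])
  \<comment> \<open>The zero function has value \<open>-\<infinity>\<close> at \<open>x\<close>,
    whereas evaluation of \<open>coord i\<close> there gives a coordinate of a point.\<close>
  have "\<psi> (coord i) x \<noteq> curve_const G (-\<infinity>) x"
    using trop_rational_hom_eval[OF G \<psi> x mem] curve_const_finite[OF x, of "-\<infinity>"] by (simp add: coord_def)
  then have "\<psi> (coord i) \<noteq> curve_const G (-\<infinity>)" by auto
  then show "curve_PL G (\<lambda>x. eval_map \<psi> x $ i)"
    using Rat_carrier_curve_PL[OF G, of "\<psi> (coord i)"] talg_homD(1)[OF \<psi> mem] by (simp add: eval_map_def)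
qed (rule G)

lemma trop_rational_hom_image_pieces:
  assumes G: "tropical_curve G" and \<psi>: "\<psi> \<in> talg_hom trop_rational (Rat G)"
  obtains D where "pieces D" "support D = eval_map \<psi> ` finite_points G" "connected (support D)"
proof -
  have cm: "curve_map G (eval_map \<psi>)" by (rule trop_rational_hom_curve_map[OF assms])
  have "eval_map \<psi> ` finite_points G \<noteq> {}" using finite_points_nonempty[OF G] by simp
  with curve_map.piecewise_image[OF cm] obtain D where "pieces D" "support D = eval_map \<psi> ` finite_points G"
    by (rule piecewise_pieces)
  then show thesis using that curve_map.connected_image[OF cm] by simp
qed

lemma curve_congruence_Ker:
  assumes G: "tropical_curve G" and \<psi>: "\<psi> \<in> talg_hom trop_rational (Rat G)"
  shows "curve_congruence (Ker trop_rational \<psi>)" "V_of (Ker trop_rational \<psi>) = eval_map \<psi> ` finite_points G"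
proof -
  obtain D where D: "pieces D" "support D = eval_map \<psi> ` finite_points G" "connected (support D)"
    by (rule trop_rational_hom_image_pieces[OF assms])
  have "Ker trop_rational \<psi> = E_of (support D)" using Ker_trop_rational_hom[OF assms] D(2) by simp
  then show "curve_congruence (Ker trop_rational \<psi>)" "V_of (Ker trop_rational \<psi>) = eval_map \<psi> ` finite_points G"
    using curve_congruence_support[OF D(1,3)] V_of_E_of_support[OF D(1)] D(2) by simp_all
qed

lemma Rat_par_simps [simp]:
  "x \<otimes>\<^bsub>Rat_par G\<^esub> y = x \<otimes>\<^bsub>Rat G\<^esub> y" "x \<oplus>\<^bsub>Rat_par G\<^esub> y = x \<oplus>\<^bsub>Rat G\<^esub> y"
  "\<one>\<^bsub>Rat_par G\<^esub> = \<one>\<^bsub>Rat G\<^esub>" "\<zero>\<^bsub>Rat_par G\<^esub> = \<zero>\<^bsub>Rat G\<^esub>" "struct_map (Rat_par G) = struct_map (Rat G)"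
  by (simp_all add: Rat_par_def)

lemma Rat_par_carrier_subset: "carrier (Rat_par G) \<subseteq> Rat_carrier G"
  unfolding Rat_par_def by auto

lemma talg_hom_Rat_par: "\<psi> \<in> talg_hom A (Rat_par G) \<Longrightarrow> \<psi> \<in> talg_hom A (Rat G)"
  using talg_homD[of \<psi> A "Rat_par G"] Rat_par_carrier_subset[of G]
  by (intro talg_homI) (auto simp del: Rat_simps simp: Rat_simps(1))

section \<open>Quotients by congruences\<close>

lemma equiv_Ker: "equiv (carrier A) (Ker A h)"
  unfolding Ker_def by (rule equivI) (auto simp: refl_on_def sym_def trans_def)

lemma Ker_congruence:
  assumes h: "h \<in> talg_hom A B"
    and add: "\<And>x y. x \<in> carrier A \<Longrightarrow> y \<in> carrier A \<Longrightarrow> x \<oplus>\<^bsub>A\<^esub> y \<in> carrier A"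
    and mult: "\<And>x y. x \<in> carrier A \<Longrightarrow> y \<in> carrier A \<Longrightarrow> x \<otimes>\<^bsub>A\<^esub> y \<in> carrier A"
  shows "congruence A (Ker A h)"
  unfolding congruence_def using equiv_Ker talg_homD(2,3)[OF h] add mult
  by (auto simp: Ker_def)

text \<open>By compatibility all members of the union are one and the same class.\<close>

lemma quotient_op:
  assumes E: "equiv C E" and comp: "\<And>a b c d. (a, b) \<in> E \<Longrightarrow> (c, d) \<in> E \<Longrightarrow> (f a c, f b d) \<in> E"
    and x: "x \<in> C" and y: "y \<in> C"
  shows "(\<Union>a\<in>E `` {x}. \<Union>b\<in>E `` {y}. E `` {f a b}) = E `` {f x y}"
proof -
  have "E `` {f a b} = E `` {f x y}" if "a \<in> E `` {x}" "b \<in> E `` {y}" for a b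
    using equiv_class_eq[OF E comp[of x a y b]] that by simp
  moreover have "x \<in> E `` {x}" "y \<in> E `` {y}" using equiv_class_self[OF E] x y by auto
  ultimately show ?thesis by blast
qed

lemma quotient_talg_simps:
  assumes E: "congruence A E"
  shows "x \<in> carrier A \<Longrightarrow> y \<in> carrier A \<Longrightarrow> E `` {x} \<otimes>\<^bsub>quotient_talg A E\<^esub> E `` {y} = E `` {x \<otimes>\<^bsub>A\<^esub> y}"
    "x \<in> carrier A \<Longrightarrow> y \<in> carrier A \<Longrightarrow> E `` {x} \<oplus>\<^bsub>quotient_talg A E\<^esub> E `` {y} = E `` {x \<oplus>\<^bsub>A\<^esub> y}"
proof -
  have eq: "equiv (carrier A) E" using E unfolding congruence_def by simp
  have c: "(a \<oplus>\<^bsub>A\<^esub> c, b \<oplus>\<^bsub>A\<^esub> d) \<in> E" "(a \<otimes>\<^bsub>A\<^esub> c, b \<otimes>\<^bsub>A\<^esub> d) \<in> E" if "(a, b) \<in> E" "(c, d) \<in> E" for a b c d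
    using E that unfolding congruence_def by auto
  show "x \<in> carrier A \<Longrightarrow> y \<in> carrier A \<Longrightarrow> E `` {x} \<otimes>\<^bsub>quotient_talg A E\<^esub> E `` {y} = E `` {x \<otimes>\<^bsub>A\<^esub> y}"
    "x \<in> carrier A \<Longrightarrow> y \<in> carrier A \<Longrightarrow> E `` {x} \<oplus>\<^bsub>quotient_talg A E\<^esub> E `` {y} = E `` {x \<oplus>\<^bsub>A\<^esub> y}"
    unfolding quotient_talg_def monoid.simps ring.simps
    using quotient_op[OF eq, of "\<lambda>x y. x \<otimes>\<^bsub>A\<^esub> y"] quotient_op[OF eq, of "\<lambda>x y. x \<oplus>\<^bsub>A\<^esub> y"] c by simp_all
qed

lemma quotient_talg_consts:
  "carrier (quotient_talg A E) = carrier A // E"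
  "\<one>\<^bsub>quotient_talg A E\<^esub> = E `` {\<one>\<^bsub>A\<^esub>}" "\<zero>\<^bsub>quotient_talg A E\<^esub> = E `` {\<zero>\<^bsub>A\<^esub>}"
  "struct_map (quotient_talg A E) a = E `` {struct_map A a}"
  by (simp_all add: quotient_talg_def)

lemma quotient_talg_proj:
  assumes E: "congruence A E"
  shows "(\<lambda>x. E `` {x}) \<in> talg_hom A (quotient_talg A E)"
    "(\<lambda>x. E `` {x}) ` carrier A = carrier (quotient_talg A E)"
    "Ker A (\<lambda>x. E `` {x}) = E"
proof -
  have eq: "equiv (carrier A) E" using E unfolding congruence_def by simp
  show "(\<lambda>x. E `` {x}) \<in> talg_hom A (quotient_talg A E)"
    by (intro talg_homI) (simp_all add: quotient_talg_simps[OF E] quotient_talg_consts quotientI)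
  show "(\<lambda>x. E `` {x}) ` carrier A = carrier (quotient_talg A E)"
    by (auto simp: quotient_talg_consts quotient_def)
  have "E \<subseteq> carrier A \<times> carrier A" using eq by (rule equiv_type)
  then show "Ker A (\<lambda>x. E `` {x}) = E" unfolding Ker_def using eq_equiv_class_iff[OF eq] by auto
qed

section \<open>Subsemifields and quotients\<close>

locale talg_closed =
  fixes A :: "('a, 'z) talgebra_scheme"
  assumes add_closed: "\<And>x y. x \<in> carrier A \<Longrightarrow> y \<in> carrier A \<Longrightarrow> x \<oplus>\<^bsub>A\<^esub> y \<in> carrier A"
    and mult_closed: "\<And>x y. x \<in> carrier A \<Longrightarrow> y \<in> carrier A \<Longrightarrow> x \<otimes>\<^bsub>A\<^esub> y \<in> carrier A"
    and one_closed: "\<one>\<^bsub>A\<^esub> \<in> carrier A" and zero_closed: "\<zero>\<^bsub>A\<^esub> \<in> carrier A"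
    and struct_closed: "\<And>a. a \<noteq> \<infinity> \<Longrightarrow> struct_map A a \<in> carrier A"

lemma trop_rational_closed: "talg_closed trop_rational"
  by unfold_locales (simp_all add: trop_rational_add_closed trop_rational_mult_closed trop_rational_const)

text \<open>First isomorphism theorem as an embedding with known image; in this form it can be
  composed with homomorphisms into the quotient.\<close>

lemma (in talg_closed) quotient_Ker_embedding:
  fixes B :: "('b, 'y) talgebra_scheme"
  assumes \<psi>: "\<psi> \<in> talg_hom A B"
  obtains h where "h \<in> talg_hom (quotient_talg A (Ker A \<psi>)) B" "inj_on h (carrier (quotient_talg A (Ker A \<psi>)))"
    "h ` carrier (quotient_talg A (Ker A \<psi>)) = \<psi> ` carrier A"
proof -
  let ?E = "Ker A \<psi>"
  have E: "congruence A ?E" by (rule Ker_congruence[OF \<psi> add_closed mult_closed])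
  have eq: "equiv (carrier A) ?E" by (rule equiv_Ker)
  \<comment> \<open>The homomorphism is constant on the classes of its kernel, so the choice of a
    representative does not matter.\<close>
  define h where "h X = \<psi> (SOME x. x \<in> X)" for X
  have hE: "h (?E `` {x}) = \<psi> x" if "x \<in> carrier A" for x
  proof -
    have "x \<in> ?E `` {x}" using equiv_class_self[OF eq that] .
    moreover define y where "y = (SOME y. y \<in> ?E `` {x})"
    ultimately have "y \<in> ?E `` {x}" unfolding y_def by (intro someI)
    then have "\<psi> y = \<psi> x" by (simp add: Ker_def)
    then show ?thesis unfolding h_def y_def .
  qed
  have rep: "\<exists>x\<in>carrier A. X = ?E `` {x}" if "X \<in> carrier (quotient_talg A ?E)" for X
    using that unfolding quotient_talg_consts by (rule quotientE) blast
  have "h \<in> talg_hom (quotient_talg A ?E) B"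
  proof (rule talg_homI)
    fix X assume "X \<in> carrier (quotient_talg A ?E)"
    then obtain x where "x \<in> carrier A" "X = ?E `` {x}" using rep by blast
    then show "h X \<in> carrier B" using hE talg_homD(1)[OF \<psi>] by simp
  next
    fix X Y assume "X \<in> carrier (quotient_talg A ?E)" "Y \<in> carrier (quotient_talg A ?E)"
    then obtain x y where xy: "x \<in> carrier A" "X = ?E `` {x}" "y \<in> carrier A" "Y = ?E `` {y}" using rep by metis
    show "h (X \<otimes>\<^bsub>quotient_talg A ?E\<^esub> Y) = h X \<otimes>\<^bsub>B\<^esub> h Y"
      "h (X \<oplus>\<^bsub>quotient_talg A ?E\<^esub> Y) = h X \<oplus>\<^bsub>B\<^esub> h Y"
      unfolding xy(2,4) quotient_talg_simps[OF E xy(1,3)]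
      using hE xy talg_homD(2,3)[OF \<psi>] mult_closed add_closed by simp_all
  qed (simp_all only: quotient_talg_consts hE one_closed zero_closed struct_closed talg_homD[OF \<psi>] not_False_eq_True)
  moreover have "inj_on h (carrier (quotient_talg A ?E))"
  proof (rule inj_onI)
    fix X Y assume XY: "X \<in> carrier (quotient_talg A ?E)" "Y \<in> carrier (quotient_talg A ?E)" "h X = h Y"
    then obtain x y where xy: "x \<in> carrier A" "X = ?E `` {x}" "y \<in> carrier A" "Y = ?E `` {y}" using rep by metis
    then have "(x, y) \<in> ?E" using hE XY(3) by (simp add: Ker_def)
    then show "X = Y" using equiv_class_eq[OF eq] xy by simp
  qed
  moreover have "h ` carrier (quotient_talg A ?E) = \<psi> ` carrier A"
    using quotient_talg_proj(2)[OF E] hE by (simp add: image_image[symmetric, of h "\<lambda>x. ?E `` {x}"] flip: quotient_talg_proj(2)[OF E])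
      (simp add: image_image)
  ultimately show thesis by (rule that)
qed

text \<open>The same isomorphism in the opposite direction, because \<open>talg_iso\<close> asks for
  a map that starts at its first argument.\<close>

lemma (in talg_closed) image_iso_quotient_Ker:
  fixes B :: "('b, 'y) talgebra_scheme"
  assumes \<psi>: "\<psi> \<in> talg_hom A B"
  shows "talg_iso (B\<lparr>carrier := \<psi> ` carrier A\<rparr>) (quotient_talg A (Ker A \<psi>))"
proof -
  let ?E = "Ker A \<psi>"
  have E: "congruence A ?E" by (rule Ker_congruence[OF \<psi> add_closed mult_closed])
  have eq: "equiv (carrier A) ?E" by (rule equiv_Ker)
  define g where "g y = ?E `` {SOME x. x \<in> carrier A \<and> \<psi> x = y}" for y
  have g\<psi>: "g (\<psi> x) = ?E `` {x}" if "x \<in> carrier A" for x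
  proof -
    have "(SOME x'. x' \<in> carrier A \<and> \<psi> x' = \<psi> x) \<in> carrier A \<and> \<psi> (SOME x'. x' \<in> carrier A \<and> \<psi> x' = \<psi> x) = \<psi> x"
      by (rule someI[of _ x]) (use that in simp)
    then have "(SOME x'. x' \<in> carrier A \<and> \<psi> x' = \<psi> x, x) \<in> ?E" using that by (simp add: Ker_def)
    then show ?thesis unfolding g_def by (rule equiv_class_eq[OF eq])
  qed
  have "g \<in> talg_hom (B\<lparr>carrier := \<psi> ` carrier A\<rparr>) (quotient_talg A ?E)"
  proof (rule talg_homI)
    fix y assume "y \<in> carrier (B\<lparr>carrier := \<psi> ` carrier A\<rparr>)"
    then show "g y \<in> carrier (quotient_talg A ?E)" using g\<psi> by (auto simp: quotient_talg_consts quotientI)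
  next
    fix y y' assume "y \<in> carrier (B\<lparr>carrier := \<psi> ` carrier A\<rparr>)" "y' \<in> carrier (B\<lparr>carrier := \<psi> ` carrier A\<rparr>)"
    then obtain x x' where x: "x \<in> carrier A" "y = \<psi> x" "x' \<in> carrier A" "y' = \<psi> x'" by auto
    show "g (y \<otimes>\<^bsub>B\<lparr>carrier := \<psi> ` carrier A\<rparr>\<^esub> y') = g y \<otimes>\<^bsub>quotient_talg A ?E\<^esub> g y'"
      "g (y \<oplus>\<^bsub>B\<lparr>carrier := \<psi> ` carrier A\<rparr>\<^esub> y') = g y \<oplus>\<^bsub>quotient_talg A ?E\<^esub> g y'"
      using x g\<psi> quotient_talg_simps[OF E x(1,3)] talg_homD(2,3)[OF \<psi> x(1,3)] mult_closed[OF x(1,3)] add_closed[OF x(1,3)]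
      by (simp_all flip: talg_homD(2,3)[OF \<psi> x(1,3)])
  next
    show "g \<one>\<^bsub>B\<lparr>carrier := \<psi> ` carrier A\<rparr>\<^esub> = \<one>\<^bsub>quotient_talg A ?E\<^esub>"
      using g\<psi>[OF one_closed] talg_homD(4)[OF \<psi>] by (simp add: quotient_talg_consts)
    show "g \<zero>\<^bsub>B\<lparr>carrier := \<psi> ` carrier A\<rparr>\<^esub> = \<zero>\<^bsub>quotient_talg A ?E\<^esub>"
      using g\<psi>[OF zero_closed] talg_homD(5)[OF \<psi>] by (simp add: quotient_talg_consts)
    fix a :: ereal assume "a \<noteq> \<infinity>"
    then show "g (struct_map (B\<lparr>carrier := \<psi> ` carrier A\<rparr>) a) = struct_map (quotient_talg A ?E) a"
      using g\<psi>[OF struct_closed] talg_homD(6)[OF \<psi>] by (simp add: quotient_talg_consts)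
  qed
  moreover have "bij_betw g (carrier (B\<lparr>carrier := \<psi> ` carrier A\<rparr>)) (carrier (quotient_talg A ?E))"
    unfolding bij_betw_def
  proof
    show "inj_on g (carrier (B\<lparr>carrier := \<psi> ` carrier A\<rparr>))"
    proof (rule inj_onI)
      fix y y' assume y: "y \<in> carrier (B\<lparr>carrier := \<psi> ` carrier A\<rparr>)" "y' \<in> carrier (B\<lparr>carrier := \<psi> ` carrier A\<rparr>)" "g y = g y'"
      then obtain x x' where x: "x \<in> carrier A" "y = \<psi> x" "x' \<in> carrier A" "y' = \<psi> x'" by auto
      then have "(x, x') \<in> ?E" using y(3) g\<psi> eq_equiv_class_iff[OF eq] by simp
      then show "y = y'" using x by (simp add: Ker_def)
    qed
    have "g ` carrier (B\<lparr>carrier := \<psi> ` carrier A\<rparr>) = (\<lambda>x. ?E `` {x}) ` carrier A"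
      using g\<psi> by (simp add: image_image)
    then show "g ` carrier (B\<lparr>carrier := \<psi> ` carrier A\<rparr>) = carrier (quotient_talg A ?E)"
      by (simp only: quotient_talg_proj(2)[OF E])
  qed
  ultimately show ?thesis unfolding talg_iso_def by blast
qed

lemma talg_hom_compose:
  assumes "h \<in> talg_hom A B" "k \<in> talg_hom B C"
  shows "k \<circ> h \<in> talg_hom A C"
  using talg_homD[OF assms(1)] talg_homD[OF assms(2)] by (intro talg_homI) simp_all

lemma Ker_inj_compose:
  assumes "h \<in> talg_hom A B" "inj_on k (carrier B)"
  shows "Ker A (k \<circ> h) = Ker A h"
  using talg_homD(1)[OF assms(1)] inj_onD[OF assms(2)] unfolding Ker_def by auto

lemma trop_rational_hom_zero:
  assumes G: "tropical_curve G" and \<psi>: "\<psi> \<in> talg_hom trop_rational (Rat G)" and f: "f \<in> PL"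
  shows "\<psi> (\<lambda>x. ereal (f x)) \<noteq> curve_const G (-\<infinity>)"
proof -
  obtain x where x: "x \<in> finite_points G" using finite_points_nonempty[OF G] by blast
  have "\<psi> (\<lambda>x. ereal (f x)) x \<noteq> curve_const G (-\<infinity>) x"
    using trop_rational_hom_eval_PL[OF G \<psi> x f] curve_const_finite[OF x, of "-\<infinity>"] by simp
  then show ?thesis by auto
qed

section \<open>The subsemifield generated by the images of the coordinates\<close>

context
  fixes G :: "('p, 'z) par_curve_scheme" and \<psi> :: "(real^'n::finite \<Rightarrow> ereal) \<Rightarrow> 'p \<Rightarrow> ereal"
  assumes G: "tropical_curve G" and par: "\<psi> \<in> talg_hom trop_rational (Rat_par G)"
begin

lemma hom_Rat: "\<psi> \<in> talg_hom trop_rational (Rat G)"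
  by (rule talg_hom_Rat_par[OF par])

definition im_semifield :: "('p \<Rightarrow> ereal) talgebra" where
  "im_semifield = (Rat_par G)\<lparr>carrier := \<psi> ` carrier trop_rational\<rparr>"

lemma im_simps [simp]:
  "carrier im_semifield = \<psi> ` carrier trop_rational"
  "x \<otimes>\<^bsub>im_semifield\<^esub> y = x \<otimes>\<^bsub>Rat_par G\<^esub> y" "x \<oplus>\<^bsub>im_semifield\<^esub> y = x \<oplus>\<^bsub>Rat_par G\<^esub> y"
  "\<one>\<^bsub>im_semifield\<^esub> = \<one>\<^bsub>Rat_par G\<^esub>" "\<zero>\<^bsub>im_semifield\<^esub> = \<zero>\<^bsub>Rat_par G\<^esub>" "struct_map im_semifield = struct_map (Rat_par G)"
  by (simp_all add: im_semifield_def)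

lemma im_op:
  assumes "F \<in> carrier trop_rational" "F' \<in> carrier trop_rational"
  shows "\<psi> F \<otimes>\<^bsub>Rat_par G\<^esub> \<psi> F' = \<psi> (\<lambda>x. F x + F' x)" "\<psi> F \<oplus>\<^bsub>Rat_par G\<^esub> \<psi> F' = \<psi> (\<lambda>x. max (F x) (F' x))"
  using talg_homD(2,3)[OF par assms] by (simp_all only: trop_rational_simps)

lemma im_consts:
  "\<one>\<^bsub>Rat_par G\<^esub> = \<psi> (\<lambda>x. 0)" "\<zero>\<^bsub>Rat_par G\<^esub> = \<psi> (\<lambda>x. -\<infinity>)" "a \<noteq> \<infinity> \<Longrightarrow> struct_map (Rat_par G) a = \<psi> (\<lambda>x. a)"
  using talg_homD(4,5)[OF par] talg_homD(6)[OF par, of a] by (simp_all del: Rat_simps Rat_par_simps)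

lemma trop_rational_not_infinity: "F \<in> carrier trop_rational \<Longrightarrow> F (x :: real^'n) \<noteq> \<infinity>"
  by (erule trop_rational_cases) auto

text \<open>Every law is checked on preimages, where it is a pointwise identity in
  \<open>ereal\<close>; the inverse of the image of \<open>f\<close> is the image of
  \<open>- f\<close>. Nontriviality and injectivity of the structure map are read off at a finite
  point.\<close>

lemma T_semifield_im: "T_semifield im_semifield"
proof -
  note closed = trop_rational_add_closed trop_rational_mult_closed trop_rational_const
  have c0: "(\<lambda>x :: real^'n. -\<infinity>) \<in> carrier trop_rational" and c1: "(\<lambda>x :: real^'n. 0) \<in> carrier trop_rational"
    by (simp_all add: closed(3))
  have md: "max a b + c = max (a + c) (b + c)" "c + max a b = max (c + a) (c + b)" for a b c :: ereal
    by (metis add_right_mono linear max.absorb1 max.absorb2) (metis add_left_mono linear max.absorb1 max.absorb2)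
  have am: "abelian_monoid im_semifield"
  proof (rule abelian_monoidI)
    fix x y z assume "x \<in> carrier im_semifield" "y \<in> carrier im_semifield" "z \<in> carrier im_semifield"
    then obtain F F' F'' where F: "F \<in> carrier trop_rational" "F' \<in> carrier trop_rational" "F'' \<in> carrier trop_rational"
      "x = \<psi> F" "y = \<psi> F'" "z = \<psi> F''" by auto
    show "x \<oplus>\<^bsub>im_semifield\<^esub> y \<oplus>\<^bsub>im_semifield\<^esub> z = x \<oplus>\<^bsub>im_semifield\<^esub> (y \<oplus>\<^bsub>im_semifield\<^esub> z)"
      unfolding im_simps F(4-6) by (simp only: im_op F(1-3) closed max.assoc)
  next
    fix x y assume "x \<in> carrier im_semifield" "y \<in> carrier im_semifield"
    then obtain F F' where F: "F \<in> carrier trop_rational" "F' \<in> carrier trop_rational" "x = \<psi> F" "y = \<psi> F'" by auto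
    show "x \<oplus>\<^bsub>im_semifield\<^esub> y \<in> carrier im_semifield" unfolding im_simps F(3,4) im_op[OF F(1,2)] using closed(1)[OF F(1,2)] by blast
    show "x \<oplus>\<^bsub>im_semifield\<^esub> y = y \<oplus>\<^bsub>im_semifield\<^esub> x"
      unfolding im_simps F(3,4) im_op[OF F(1,2)] im_op[OF F(2,1)] by (simp only: max.commute)
  next
    fix x assume "x \<in> carrier im_semifield"
    then obtain F where F: "F \<in> carrier trop_rational" "x = \<psi> F" by auto
    show "\<zero>\<^bsub>im_semifield\<^esub> \<oplus>\<^bsub>im_semifield\<^esub> x = x"
      unfolding im_simps F(2) im_consts(2) im_op(2)[OF c0 F(1)] by (simp add: max_absorb2)
  qed (unfold im_simps im_consts, intro imageI c0)
  have cm: "comm_monoid im_semifield"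
  proof (rule comm_monoidI)
    fix x y z assume "x \<in> carrier im_semifield" "y \<in> carrier im_semifield" "z \<in> carrier im_semifield"
    then obtain F F' F'' where F: "F \<in> carrier trop_rational" "F' \<in> carrier trop_rational" "F'' \<in> carrier trop_rational"
      "x = \<psi> F" "y = \<psi> F'" "z = \<psi> F''" by auto
    show "x \<otimes>\<^bsub>im_semifield\<^esub> y \<otimes>\<^bsub>im_semifield\<^esub> z = x \<otimes>\<^bsub>im_semifield\<^esub> (y \<otimes>\<^bsub>im_semifield\<^esub> z)"
      unfolding im_simps F(4-6) by (simp only: im_op F(1-3) closed add.assoc)
  next
    fix x y assume "x \<in> carrier im_semifield" "y \<in> carrier im_semifield"
    then obtain F F' where F: "F \<in> carrier trop_rational" "F' \<in> carrier trop_rational" "x = \<psi> F" "y = \<psi> F'" by auto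
    show "x \<otimes>\<^bsub>im_semifield\<^esub> y \<in> carrier im_semifield" unfolding im_simps F(3,4) im_op[OF F(1,2)] using closed(2)[OF F(1,2)] by blast
    show "x \<otimes>\<^bsub>im_semifield\<^esub> y = y \<otimes>\<^bsub>im_semifield\<^esub> x"
      unfolding im_simps F(3,4) im_op[OF F(1,2)] im_op[OF F(2,1)] by (simp only: add.commute)
  next
    fix x assume "x \<in> carrier im_semifield"
    then obtain F where F: "F \<in> carrier trop_rational" "x = \<psi> F" by auto
    show "\<one>\<^bsub>im_semifield\<^esub> \<otimes>\<^bsub>im_semifield\<^esub> x = x"
      unfolding im_simps F(2) im_consts(1) im_op(1)[OF c1 F(1)] by simp
  qed (unfold im_simps im_consts, intro imageI c1)
  have sr: "semiring im_semifield"
  proof (intro semiring.intro semiring_axioms.intro am)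
    show "monoid im_semifield" using cm by (rule comm_monoid.axioms)
  next
    fix x y z assume "x \<in> carrier im_semifield" "y \<in> carrier im_semifield" "z \<in> carrier im_semifield"
    then obtain F F' F'' where F: "F \<in> carrier trop_rational" "F' \<in> carrier trop_rational" "F'' \<in> carrier trop_rational"
      "x = \<psi> F" "y = \<psi> F'" "z = \<psi> F''" by auto
    show "(x \<oplus>\<^bsub>im_semifield\<^esub> y) \<otimes>\<^bsub>im_semifield\<^esub> z = x \<otimes>\<^bsub>im_semifield\<^esub> z \<oplus>\<^bsub>im_semifield\<^esub> y \<otimes>\<^bsub>im_semifield\<^esub> z"
      "z \<otimes>\<^bsub>im_semifield\<^esub> (x \<oplus>\<^bsub>im_semifield\<^esub> y) = z \<otimes>\<^bsub>im_semifield\<^esub> x \<oplus>\<^bsub>im_semifield\<^esub> z \<otimes>\<^bsub>im_semifield\<^esub> y"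
      unfolding im_simps F(4-6)
      by (simp_all only: im_op F(1-3) closed md)
  next
    fix x assume "x \<in> carrier im_semifield"
    then obtain F where F: "F \<in> carrier trop_rational" "x = \<psi> F" by auto
    \<comment> \<open>Absorption holds because \<open>F\<close> never takes the value
      \<open>\<infinity>\<close>.\<close>
    have "-\<infinity> + F z = -\<infinity>" "F z + -\<infinity> = -\<infinity>" for z
      using trop_rational_not_infinity[OF F(1), of z] by (cases "F z"; simp)+
    then show "\<zero>\<^bsub>im_semifield\<^esub> \<otimes>\<^bsub>im_semifield\<^esub> x = \<zero>\<^bsub>im_semifield\<^esub>" "x \<otimes>\<^bsub>im_semifield\<^esub> \<zero>\<^bsub>im_semifield\<^esub> = \<zero>\<^bsub>im_semifield\<^esub>"
      unfolding im_simps F(2) im_consts(2) unfolding im_op(1)[OF c0 F(1)] im_op(1)[OF F(1) c0] by (simp_all only:)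
  qed
  have st: "struct_map im_semifield \<in> semiring_hom trop im_semifield"
  proof -
    have "struct_map im_semifield a \<in> carrier im_semifield" if "a \<noteq> \<infinity>" for a
      unfolding im_simps im_consts(3)[OF that] using closed(3)[OF that] by blast
    moreover have "struct_map im_semifield (a + b) = struct_map im_semifield a \<otimes>\<^bsub>im_semifield\<^esub> struct_map im_semifield b"
        "struct_map im_semifield (max a b) = struct_map im_semifield a \<oplus>\<^bsub>im_semifield\<^esub> struct_map im_semifield b"
      if "a \<noteq> \<infinity>" "b \<noteq> \<infinity>" for a b
    proof -
      have "a + b \<noteq> \<infinity>" "max a b \<noteq> \<infinity>" using that by (auto simp: max_def)
      then show "struct_map im_semifield (a + b) = struct_map im_semifield a \<otimes>\<^bsub>im_semifield\<^esub> struct_map im_semifield b"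
        "struct_map im_semifield (max a b) = struct_map im_semifield a \<oplus>\<^bsub>im_semifield\<^esub> struct_map im_semifield b"
        unfolding im_simps using that by (simp_all only: im_consts(3) im_op closed(3) not_False_eq_True)
    qed
    moreover have "struct_map im_semifield 0 = \<one>\<^bsub>im_semifield\<^esub>" "struct_map im_semifield (-\<infinity>) = \<zero>\<^bsub>im_semifield\<^esub>"
      unfolding im_simps im_consts(1,2) using im_consts(3)[of 0] im_consts(3)[of "-\<infinity>"]
      by (simp_all del: Rat_simps Rat_par_simps)
    ultimately show ?thesis unfolding semiring_hom_def ring_hom_def trop_def by auto
  qed
  obtain x where x: "x \<in> finite_points G" using finite_points_nonempty[OF G] by blast
  have "carrier im_semifield - {\<zero>\<^bsub>im_semifield\<^esub>} \<subseteq> Units im_semifield"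
  proof
    fix y assume y: "y \<in> carrier im_semifield - {\<zero>\<^bsub>im_semifield\<^esub>}"
    then obtain F where F: "F \<in> carrier trop_rational" "y = \<psi> F" by auto
    show "y \<in> Units im_semifield"
    proof (cases rule: trop_rational_cases[OF F(1)])
      case 1
      then show ?thesis using y F(2) im_consts(2) by simp
    next
      case (2 f)
      have f': "(\<lambda>x. ereal (- f x)) \<in> carrier trop_rational" by (rule PL_in_carrier[OF PL_uminus[OF 2(1)]])
      have "\<psi> (\<lambda>x. ereal (- f x)) \<otimes>\<^bsub>im_semifield\<^esub> y = \<one>\<^bsub>im_semifield\<^esub>" "y \<otimes>\<^bsub>im_semifield\<^esub> \<psi> (\<lambda>x. ereal (- f x)) = \<one>\<^bsub>im_semifield\<^esub>"
        unfolding im_simps F(2) im_consts(1) im_op(1)[OF f' F(1)] im_op(1)[OF F(1) f'] unfolding 2(2)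
        by (simp_all add: zero_ereal_def)
      then show ?thesis using F f' unfolding Units_def by auto
    qed
  qed
  moreover have "\<zero>\<^bsub>im_semifield\<^esub> \<noteq> \<one>\<^bsub>im_semifield\<^esub>"
  proof
    assume "\<zero>\<^bsub>im_semifield\<^esub> = \<one>\<^bsub>im_semifield\<^esub>"
    then have "curve_const G (-\<infinity>) x = curve_const G 0 x" by simp
    then show False using curve_const_finite[OF x, of 0] curve_const_finite[OF x, of "-\<infinity>"] by simp
  qed
  moreover have "inj_on (struct_map im_semifield) (carrier trop)"
  proof (rule inj_onI)
    fix a b assume "struct_map im_semifield a = struct_map im_semifield b"
    then have "curve_const G a x = curve_const G b x" by simp
    then show "a = b" using curve_const_finite[OF x] by simp
  qed
  ultimately show ?thesis unfolding T_semifield_def T_algebra_def using sr cm st by blast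
qed

text \<open>Constants, sums and maxima stay in \<open>S\<close> by its closure properties. For
  negation, \<open>S\<close> contains an inverse of the image of \<open>f\<close>, and at every
  finite point this inverse has the value of the image of \<open>- f\<close>.\<close>

lemma im_subset_T_subsemifield:
  assumes S: "T_subsemifield S (Rat_par G)" and gen: "\<And>i. \<psi> (coord i) \<in> S"
  shows "\<psi> ` carrier trop_rational \<subseteq> S"
proof -
  define R where "R = (Rat_par G)\<lparr>carrier := S\<rparr>"
  have R: "carrier R = S" "x \<otimes>\<^bsub>R\<^esub> y = x \<otimes>\<^bsub>Rat_par G\<^esub> y" "x \<oplus>\<^bsub>R\<^esub> y = x \<oplus>\<^bsub>Rat_par G\<^esub> y"
    "\<one>\<^bsub>R\<^esub> = \<one>\<^bsub>Rat_par G\<^esub>" "\<zero>\<^bsub>R\<^esub> = \<zero>\<^bsub>Rat_par G\<^esub>" "struct_map R = struct_map (Rat_par G)" for x y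
    by (simp_all add: R_def)
  have sf: "T_semifield R" and sub: "S \<subseteq> carrier (Rat_par G)" using S unfolding T_subsemifield_def R_def by simp_all
  then have semi: "semiring R" and units: "carrier R - {\<zero>\<^bsub>R\<^esub>} \<subseteq> Units R" and st: "struct_map R \<in> semiring_hom trop R"
    unfolding T_semifield_def T_algebra_def by simp_all
  interpret semiring R by (rule semi)
  have mult: "a \<otimes>\<^bsub>Rat_par G\<^esub> b \<in> S" and add: "a \<oplus>\<^bsub>Rat_par G\<^esub> b \<in> S" if "a \<in> S" "b \<in> S" for a b
    using m_closed[of a b] a_closed[of a b] that unfolding R by simp_all
  have const: "struct_map (Rat_par G) a \<in> S" if "a \<noteq> \<infinity>" for a
    using st that unfolding semiring_hom_def ring_hom_def trop_def R by auto
  have "\<psi> (\<lambda>x. ereal (f x)) \<in> S" if "f \<in> PL" for f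
    using that
  proof (induction rule: PL_induct)
    case (const c)
    show ?case using \<open>ereal c \<noteq> \<infinity> \<Longrightarrow> struct_map (Rat_par G) (ereal c) \<in> S\<close> im_consts(3)[of "ereal c"] by simp
  next
    case (coord i)
    show ?case using gen[of i] unfolding coord_def .
  next
    case (add f g)
    then show ?case using mult[OF add(3,4)] im_op(1)[OF PL_in_carrier[OF add(1)] PL_in_carrier[OF add(2)]]
      by (simp only: plus_ereal.simps)
  next
    case (uminus f)
    have "\<psi> (\<lambda>x. ereal (f x)) \<in> Units R"
      using units uminus(2) trop_rational_hom_zero[OF G hom_Rat uminus(1)] unfolding R by auto
    then obtain y where y: "y \<in> S" "y \<otimes>\<^bsub>Rat_par G\<^esub> \<psi> (\<lambda>x. ereal (f x)) = \<one>\<^bsub>Rat_par G\<^esub>"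
      unfolding Units_def R by auto
    have yR: "y \<in> Rat_carrier G" using y(1) sub Rat_par_carrier_subset by blast
    have m: "\<psi> (\<lambda>x. ereal (f x)) \<in> Rat_carrier G" "\<psi> (\<lambda>x. ereal (- f x)) \<in> Rat_carrier G"
      using talg_homD(1)[OF hom_Rat PL_in_carrier[OF uminus(1)]] talg_homD(1)[OF hom_Rat PL_in_carrier[OF PL_uminus[OF uminus(1)]]] by simp_all
    have "\<psi> (\<lambda>x. ereal (- f x)) = y"
    proof (rule Rat_carrier_eqI[OF G m(2) yR])
      fix x assume x: "x \<in> finite_points G"
      have "y x + ereal (f (eval_map \<psi> x)) = 0"
        using Rat_mult(2)[OF G yR m(1) x] y(2) curve_const_finite[OF x, of 0] trop_rational_hom_eval_PL[OF G hom_Rat x uminus(1)] by simp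
      then have "y x = - ereal (f (eval_map \<psi> x))" by (cases "y x") auto
      then show "\<psi> (\<lambda>x. ereal (- f x)) x = y x"
        using trop_rational_hom_eval_PL[OF G hom_Rat x PL_uminus[OF uminus(1)]] by simp
    qed
    then show ?case using y(1) by simp
  next
    case (max f g)
    then show ?case using \<open>\<psi> (\<lambda>x. ereal (f x)) \<in> S \<Longrightarrow> \<psi> (\<lambda>x. ereal (g x)) \<in> S \<Longrightarrow> \<psi> (\<lambda>x. ereal (f x)) \<oplus>\<^bsub>Rat_par G\<^esub> \<psi> (\<lambda>x. ereal (g x)) \<in> S\<close>
       im_op(2)[OF PL_in_carrier[OF max(1)] PL_in_carrier[OF max(2)]]
      by (simp only: ereal_max)
  qed
  moreover have "\<psi> (\<lambda>x. -\<infinity>) \<in> S" using const[of "-\<infinity>"] im_consts(3)[of "-\<infinity>"] by simp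
  ultimately show ?thesis unfolding carrier_trop_rational by blast
qed

text \<open>The image is itself one of the subsemifields over which the intersection runs.\<close>

lemma generated_eq_im:
  "generated_T_semifield (Rat_par G) (range (\<lambda>i. \<psi> (coord i))) = im_semifield"
proof -
  have "T_subsemifield (\<psi> ` carrier trop_rational) (Rat_par G)"
    using T_semifield_im talg_homD(1)[OF par] unfolding T_subsemifield_def im_semifield_def by blast
  moreover have "range (\<lambda>i. \<psi> (coord i)) \<subseteq> \<psi> ` carrier trop_rational"
    using PL_in_carrier[OF PL_coord] unfolding coord_def by blast
  ultimately have "\<Inter>{S. T_subsemifield S (Rat_par G) \<and> range (\<lambda>i. \<psi> (coord i)) \<subseteq> S} = \<psi> ` carrier trop_rational"
  proof (intro equalityI Inter_lower Inter_greatest)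
    fix S assume "S \<in> {S. T_subsemifield S (Rat_par G) \<and> range (\<lambda>i. \<psi> (coord i)) \<subseteq> S}"
    then show "\<psi> ` carrier trop_rational \<subseteq> S" by (intro im_subset_T_subsemifield) auto
  qed simp
  then show ?thesis unfolding generated_T_semifield_def im_semifield_def by simp
qed

lemma generated_iso_quotient:
  "talg_iso (generated_T_semifield (Rat_par G) (range (\<lambda>i. \<psi> (coord i)))) (quotient_talg trop_rational (Ker trop_rational \<psi>))"
  unfolding generated_eq_im im_semifield_def
  by (rule talg_closed.image_iso_quotient_Ker[OF trop_rational_closed par])

text \<open>Followed by the embedding of the quotient into \<open>Rat G\<close>,
  \<open>\<phi>\<close> becomes a homomorphism from a rational function semifield into
  \<open>Rat G\<close> with the same kernel. The number of variables may differ from that of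
  \<open>\<psi>\<close>.\<close>

lemma curve_congruence_surjection:
  assumes \<phi>: "\<phi> \<in> talg_hom (trop_rational :: (real^'m::finite \<Rightarrow> ereal) talgebra) (quotient_talg trop_rational (Ker trop_rational \<psi>))"
  shows "curve_congruence (Ker trop_rational \<phi>)"
proof -
  obtain h where h: "h \<in> talg_hom (quotient_talg trop_rational (Ker trop_rational \<psi>)) (Rat G)"
    "inj_on h (carrier (quotient_talg trop_rational (Ker trop_rational \<psi>)))"
    by (rule talg_closed.quotient_Ker_embedding[OF trop_rational_closed hom_Rat])
  have "curve_congruence (Ker trop_rational (h \<circ> \<phi>))"
    by (rule curve_congruence_Ker(1)[OF G talg_hom_compose[OF \<phi> h(1)]])
  then show ?thesis unfolding Ker_inj_compose[OF \<phi> h(2)] .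
qed

end

section \<open>Decomposition of a union of segments\<close>

definition open_seg :: "('n::finite) piece \<Rightarrow> (real^'n) set" where
  "open_seg = (\<lambda>(p, u, T). (\<lambda>t. p + t *\<^sub>R rvec u) ` {t. 0 < t \<and> ereal t < T})"

lemma mem_open_seg: "x \<in> open_seg (p, u, T) \<longleftrightarrow> (\<exists>t. 0 < t \<and> ereal t < T \<and> x = p + t *\<^sub>R rvec u)"
  unfolding open_seg_def by auto

lemma mem_seg: "x \<in> seg p u T \<longleftrightarrow> (\<exists>t. 0 \<le> t \<and> ereal t \<le> T \<and> x = p + t *\<^sub>R rvec u)"
  unfolding seg_def dom_upto_def by auto

lemma primitive_parallel:
  assumes u: "primitive u" and v: "primitive v" and eq: "a *\<^sub>R rvec u = b *\<^sub>R rvec v" and a: "a \<noteq> 0"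
  shows "u = v \<or> u = - v"
proof -
  have comp: "a * of_int (u $ i) = b * of_int (v $ i)" for i
    using arg_cong[OF eq, of "\<lambda>x. x $ i"] by simp
  have cross: "u $ j * v $ i = u $ i * v $ j" for i j
  proof -
    have "a * of_int (u $ j) * of_int (v $ i) = b * of_int (v $ j) * of_int (v $ i)" using comp[of j] by simp
    also have "\<dots> = a * of_int (u $ i) * of_int (v $ j)" using comp[of i] by simp
    finally have "real_of_int (u $ j * v $ i) = real_of_int (u $ i * v $ j)" using a by simp
    then show ?thesis by (simp only: of_int_eq_iff)
  qed
  have "iprod u (rvec v) \<noteq> 0"
  proof
    assume "iprod u (rvec v) = 0"
    then have "iprod u (b *\<^sub>R rvec v) = 0" by (simp add: iprod_scaleR_right)
    then have "a * iprod u (rvec u) = 0" unfolding eq[symmetric] by (simp add: iprod_scaleR_right)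
    then show False using a iprod_rvec_pos[OF primitive_nonzero[OF u]] by simp
  qed
  then consider "iprod u (rvec v) > 0" | "iprod u (rvec (- v)) > 0"
    unfolding rvec_uminus using iprod_scaleR_right[of u "-1" "rvec v"] by force
  then show ?thesis
  proof cases
    case 1
    then show ?thesis using primitive_collinear_eq[OF u v cross] by blast
  next
    case 2
    have "u $ j * (- v) $ i = u $ i * (- v) $ j" for i j using cross by simp
    then show ?thesis using primitive_collinear_eq[OF u primitive_uminus[OF v] _ 2] by blast
  qed
qed

text \<open>Two different common points would make the directions proportional, and proportional
  primitive vectors agree up to sign.\<close>

lemma finite_seg_Int:
  assumes u: "primitive u" and v: "primitive v" and np: "u \<noteq> v" "u \<noteq> - v"
  shows "finite (seg p u T \<inter> seg q v S)"
proof (cases "seg p u T \<inter> seg q v S = {}")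
  case False
  then obtain x where x: "x \<in> seg p u T" "x \<in> seg q v S" by blast
  have "y = x" if y: "y \<in> seg p u T" "y \<in> seg q v S" for y
  proof (rule ccontr)
    assume ne: "y \<noteq> x"
    obtain t t' where t: "x = p + t *\<^sub>R rvec u" "y = p + t' *\<^sub>R rvec u" using x y unfolding mem_seg by blast
    obtain s s' where s: "x = q + s *\<^sub>R rvec v" "y = q + s' *\<^sub>R rvec v" using x y unfolding mem_seg by blast
    have "(t' - t) *\<^sub>R rvec u = y - x" using t by (simp add: algebra_simps)
    also have "\<dots> = (s' - s) *\<^sub>R rvec v" using s by (simp add: algebra_simps)
    finally have "(t' - t) *\<^sub>R rvec u = (s' - s) *\<^sub>R rvec v" .
    moreover have "t' - t \<noteq> 0" using ne t by auto
    ultimately show False using primitive_parallel[OF u v] np by blast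
  qed
  then have "seg p u T \<inter> seg q v S \<subseteq> {x}" by blast
  then show ?thesis using finite_subset by blast
qed simp

lemma inj_line: "u \<noteq> 0 \<Longrightarrow> p + t *\<^sub>R rvec u = p + s *\<^sub>R rvec u \<longleftrightarrow> t = s"
  by (simp add: rvec_eq_0_iff)

text \<open>Such segments become the edges of a graph with finite vertices \<open>W\<close>; a ray
  has a single end in \<open>W\<close>.\<close>

definition free_seg :: "(real^'n::finite) set \<Rightarrow> 'n piece \<Rightarrow> bool" where
  "free_seg W = (\<lambda>(p, u, T). primitive u \<and> 0 < T \<and> p \<in> W \<and> (T \<noteq> \<infinity> \<longrightarrow> p + real_of_ereal T *\<^sub>R rvec u \<in> W) \<and>
     open_seg (p, u, T) \<inter> W = {})"

lemma free_segD:
  assumes "free_seg W (p, u, T)"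
  shows "primitive u" "0 < T" "p \<in> W" "T \<noteq> \<infinity> \<Longrightarrow> p + real_of_ereal T *\<^sub>R rvec u \<in> W"
    "\<And>t. 0 < t \<Longrightarrow> ereal t < T \<Longrightarrow> p + t *\<^sub>R rvec u \<notin> W" "\<And>r. T = ereal r \<Longrightarrow> 0 < r \<and> p + r *\<^sub>R rvec u \<in> W"
proof -
  show "primitive u" "0 < T" "p \<in> W" "T \<noteq> \<infinity> \<Longrightarrow> p + real_of_ereal T *\<^sub>R rvec u \<in> W"
    using assms unfolding free_seg_def by auto
  show "\<And>t. 0 < t \<Longrightarrow> ereal t < T \<Longrightarrow> p + t *\<^sub>R rvec u \<notin> W"
    using assms unfolding free_seg_def mem_open_seg disjoint_iff by auto
  show "\<And>r. T = ereal r \<Longrightarrow> 0 < r \<and> p + r *\<^sub>R rvec u \<in> W" using assms unfolding free_seg_def by auto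
qed

text \<open>The length is the parameter of the first return to \<open>W\<close>, so start and
  direction determine a free segment.\<close>

lemma free_seg_length_unique:
  assumes A: "free_seg W (p, u, T)" and B: "free_seg W (p, u, T')"
  shows "T = T'"
proof -
  have "\<not> T < T'" if A: "free_seg W (p, u, T)" and B: "free_seg W (p, u, T')" for T T'
  proof
    assume lt: "T < T'"
    then obtain r where r: "T = ereal r" using free_segD(2)[OF A] by (cases T) auto
    then show False using free_segD(6)[OF A r] free_segD(5)[OF B, of r] lt by simp
  qed
  from this[OF A B] this[OF B A] show ?thesis by simp
qed

text \<open>If the starts differed, the later one would be an interior point of the other segment,
  but starts belong to \<open>W\<close>.\<close>

lemma free_seg_same_direction:
  assumes A: "free_seg W (p, u, T)" and B: "free_seg W (q, u, S)"
    and x: "x \<in> open_seg (p, u, T)" "x \<in> open_seg (q, u, S)"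
  shows "p = q"
proof -
  obtain t where t: "0 < t" "ereal t < T" "x = p + t *\<^sub>R rvec u" using x(1) unfolding mem_open_seg by blast
  obtain s where s: "0 < s" "ereal s < S" "x = q + s *\<^sub>R rvec u" using x(2) unfolding mem_open_seg by blast
  have no: "\<not> s < t" if "free_seg W (p, u, T)" "q \<in> W" "0 < s" "ereal t < T" "p + t *\<^sub>R rvec u = q + s *\<^sub>R rvec u" for p q s t T
  proof
    assume lt: "s < t"
    have "q = p + (t - s) *\<^sub>R rvec u" using that(5) by (simp add: algebra_simps)
    moreover have "ereal (t - s) < T" using that(3,4) by (metis diff_less_eq ereal_less(2) less_add_same_cancel1 less_ereal.simps(1) order_less_trans)
    ultimately show False using free_segD(5)[OF that(1), of "t - s"] lt that(2) by simp
  qed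
  have "t = s"
    using no[OF A free_segD(3)[OF B] s(1) t(2)] no[OF B free_segD(3)[OF A] t(1) s(2)] t(3) s(3) by force
  then show ?thesis using t(3) s(3) by simp
qed

text \<open>Each start is the far end of the other segment: were a segment longer, its interior
  would contain the other start; were it shorter, its own end would lie in the other
  interior.\<close>

lemma free_seg_opposite_direction:
  assumes A: "free_seg W (p, u, T)" and B: "free_seg W (q, - u, S)"
    and x: "x \<in> open_seg (p, u, T)" "x \<in> open_seg (q, - u, S)"
  shows "open_seg (p, u, T) = open_seg (q, - u, S)"
proof -
  obtain t where t: "0 < t" "ereal t < T" "x = p + t *\<^sub>R rvec u" using x(1) unfolding mem_open_seg by blast
  obtain s where s: "0 < s" "ereal s < S" "x = q + s *\<^sub>R rvec (- u)" using x(2) unfolding mem_open_seg by blast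
  have q: "q = p + (t + s) *\<^sub>R rvec u" using t(3) s(3) unfolding rvec_uminus by (simp add: algebra_simps)
  have p: "p = q + (t + s) *\<^sub>R rvec (- u)" unfolding q rvec_uminus by simp
  have "\<not> ereal (t + s) < T" using free_segD(5)[OF A, of "t + s"] free_segD(3)[OF B] q t(1) s(1) by auto
  moreover have "\<not> T < ereal (t + s)"
  proof
    assume lt: "T < ereal (t + s)"
    then obtain r where r: "T = ereal r" using free_segD(2)[OF A] by (cases T) auto
    have "p + r *\<^sub>R rvec u = q + (t + s - r) *\<^sub>R rvec (- u)" unfolding q rvec_uminus by (simp add: algebra_simps)
    moreover have "ereal (t + s - r) < S"
    proof -
      have "t + s - r < s" using t(2) r by simp
      then show ?thesis using s(2) by (metis ereal_less(2) less_ereal.simps(1) order_less_trans)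
    qed
    ultimately show False using free_segD(6)[OF A r] free_segD(5)[OF B, of "t + s - r"] lt r by simp
  qed
  ultimately have T: "T = ereal (t + s)" by simp
  have "\<not> ereal (t + s) < S" using free_segD(5)[OF B, of "t + s"] free_segD(3)[OF A] p t(1) s(1) by auto
  moreover have "\<not> S < ereal (t + s)"
  proof
    assume lt: "S < ereal (t + s)"
    then obtain r where r: "S = ereal r" using free_segD(2)[OF B] by (cases S) auto
    have "q + r *\<^sub>R rvec (- u) = p + (t + s - r) *\<^sub>R rvec u" unfolding q rvec_uminus by (simp add: algebra_simps)
    moreover have "ereal (t + s - r) < T"
    proof -
      have "t + s - r < t" using s(2) r by simp
      then show ?thesis using t(2) by (metis ereal_less(2) less_ereal.simps(1) order_less_trans)
    qed
    ultimately show False using free_segD(6)[OF B r] free_segD(5)[OF A, of "t + s - r"] lt r by simp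
  qed
  ultimately have S: "S = ereal (t + s)" by simp
  have flip: "open_seg (a, v, ereal c) \<subseteq> open_seg (b, - v, ereal c)" if "b = a + c *\<^sub>R rvec v" for a b v c
  proof
    fix y assume "y \<in> open_seg (a, v, ereal c)"
    then obtain r where r: "0 < r" "r < c" "y = a + r *\<^sub>R rvec v" unfolding mem_open_seg by auto
    then have "y = b + (c - r) *\<^sub>R rvec (- v)" unfolding that rvec_uminus by (simp add: algebra_simps)
    then show "y \<in> open_seg (b, - v, ereal c)" using r unfolding mem_open_seg by (intro exI[of _ "c - r"]) simp
  qed
  show ?thesis unfolding S T
    using flip[OF q] flip[OF p] by (simp only: minus_minus)
qed

text \<open>Once all ends and transversal crossings are cut points, free segments inside the pieces
  have equal or disjoint interiors: a common interior point is no crossing, so the directions agree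
  up to sign, and the preceding lemmas apply.\<close>

lemma support_decomposition:
  fixes D :: "('n::finite) piece set"
  assumes D: "pieces D"
  obtains W D' where "finite W" "W \<noteq> {}" "finite D'" "\<And>A. A \<in> D' \<Longrightarrow> free_seg W A"
    "\<And>A B. A \<in> D' \<Longrightarrow> B \<in> D' \<Longrightarrow> A \<noteq> B \<Longrightarrow> open_seg A \<inter> open_seg B = {}"
    "support D = W \<union> \<Union>(open_seg ` D')"
proof -
  define sg where "sg A = seg (fst A) (fst (snd A)) (snd (snd A))" for A :: "'n piece"
  define dir where "dir A = fst (snd A)" for A :: "'n piece"
  have Dprim: "primitive (dir A)" "0 \<le> snd (snd A)" if "A \<in> D" for A
    using D that unfolding pieces_def dir_def by auto
  have supp: "support D = (\<Union>A\<in>D. sg A)" unfolding support_def sg_def by (simp add: case_prod_unfold)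
  have finD: "finite D" "D \<noteq> {}" using D unfolding pieces_def by auto
  \<comment> \<open>Crossing sets are left out for parallel directions, where they may be infinite;
    there the ends of the pieces provide the cuts.\<close>
  define W where "W = fst ` D \<union> (\<lambda>A. fst A + real_of_ereal (snd (snd A)) *\<^sub>R rvec (dir A)) ` {A\<in>D. snd (snd A) \<noteq> \<infinity>} \<union>
     (\<Union>A\<in>D. \<Union>B\<in>D. if dir A = dir B \<or> dir A = - dir B then {} else sg A \<inter> sg B)"
  have "finite (if dir A = dir B \<or> dir A = - dir B then {} else sg A \<inter> sg B)" if "A \<in> D" "B \<in> D" for A B
    using finite_seg_Int[OF Dprim(1)[OF that(1)] Dprim(1)[OF that(2)]] unfolding sg_def dir_def by simp
  then have "finite (\<Union>A\<in>D. \<Union>B\<in>D. if dir A = dir B \<or> dir A = - dir B then {} else sg A \<inter> sg B)"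
    by (intro finite_UN_I finD(1))
  then have finW: "finite W" unfolding W_def using finD(1) by (intro finite_UnI) simp_all
  have neW: "W \<noteq> {}" unfolding W_def using finD by simp
  have Wstart: "fst A \<in> W" if "A \<in> D" for A using that unfolding W_def by simp
  have Wend: "fst A + real_of_ereal (snd (snd A)) *\<^sub>R rvec (dir A) \<in> W" if "A \<in> D" "snd (snd A) \<noteq> \<infinity>" for A
    using that unfolding W_def by simp
  have Wcross: "x \<in> W" if "A \<in> D" "B \<in> D" "dir A \<noteq> dir B" "dir A \<noteq> - dir B" "x \<in> sg A" "x \<in> sg B" for A B x
  proof -
    have "x \<in> (if dir A = dir B \<or> dir A = - dir B then {} else sg A \<inter> sg B)" using that by simp
    then show ?thesis using that(1,2) unfolding W_def by blast
  qed
  have Wsub: "W \<subseteq> support D"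
  proof -
    have "fst A \<in> support D" if "A \<in> D" for A
      using seg_start[OF Dprim(2)[OF that]] that unfolding supp sg_def by blast
    moreover have "fst A + real_of_ereal (snd (snd A)) *\<^sub>R rvec (dir A) \<in> support D" if "A \<in> D" "snd (snd A) \<noteq> \<infinity>" for A
    proof -
      have "fst A + real_of_ereal (snd (snd A)) *\<^sub>R rvec (dir A) \<in> sg A"
        using Dprim(2)[OF that(1)] that(2) unfolding sg_def mem_seg dir_def
        by (intro exI[of _ "real_of_ereal (snd (snd A))"]) (auto simp: ereal_real real_of_ereal_pos)
      then show ?thesis using that unfolding supp by blast
    qed
    moreover have "(if dir A = dir B \<or> dir A = - dir B then {} else sg A \<inter> sg B) \<subseteq> support D" if "A \<in> D" for A B
      using that unfolding supp by auto
    ultimately show ?thesis unfolding W_def by (intro Un_least UN_least) auto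
  qed
  \<comment> \<open>These are finitely many, since a start in \<open>W\<close> and the direction of
    a piece determine each of them.\<close>
  define P where "P = {A. free_seg W A \<and> (\<exists>B\<in>D. dir A = dir B \<and> open_seg A \<subseteq> sg B)}"
  have "finite ((\<lambda>A. (fst A, dir A)) ` P)"
  proof (rule finite_subset)
    show "(\<lambda>A. (fst A, dir A)) ` P \<subseteq> W \<times> dir ` D"
    proof
      fix y assume "y \<in> (\<lambda>A. (fst A, dir A)) ` P"
      then obtain A where A: "A \<in> P" "y = (fst A, dir A)" by blast
      then have "fst A \<in> W" unfolding P_def free_seg_def by auto
      moreover have "dir A \<in> dir ` D" using A unfolding P_def by auto
      ultimately show "y \<in> W \<times> dir ` D" using A by simp
    qed
    show "finite (W \<times> dir ` D)" using finW finD by simp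
  qed
  moreover have "inj_on (\<lambda>A. (fst A, dir A)) P"
  proof (rule inj_onI)
    fix A B assume AB: "A \<in> P" "B \<in> P" "(fst A, dir A) = (fst B, dir B)"
    obtain p u T where A: "A = (p, u, T)" by (cases A)
    obtain q v S where B: "B = (q, v, S)" by (cases B)
    have "p = q" "u = v" using AB(3) A B unfolding dir_def by simp_all
    moreover have "T = S" using free_seg_length_unique[of W p u T S] AB calculation unfolding P_def A B by simp
    ultimately show "A = B" using A B by simp
  qed
  ultimately have finP: "finite P" by (rule finite_imageD)
  have eqP: "open_seg A = open_seg B" if AB: "A \<in> P" "B \<in> P" "x \<in> open_seg A" "x \<in> open_seg B" for A B x
  proof -
    obtain p u T where A: "A = (p, u, T)" by (cases A)
    obtain q v S where B: "B = (q, v, S)" by (cases B)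
    have fA: "free_seg W (p, u, T)" and fB: "free_seg W (q, v, S)" using AB unfolding P_def A B by simp_all
    obtain A' where A': "A' \<in> D" "dir A = dir A'" "open_seg A \<subseteq> sg A'" using AB(1) unfolding P_def by auto
    obtain B' where B': "B' \<in> D" "dir B = dir B'" "open_seg B \<subseteq> sg B'" using AB(2) unfolding P_def by auto
    have "x \<notin> W" using fA AB(3) unfolding free_seg_def A by auto
    moreover have "x \<in> sg A'" "x \<in> sg B'" using A'(3) B'(3) AB(3,4) by auto
    ultimately have "dir A = dir B \<or> dir A = - dir B" using Wcross[OF A'(1) B'(1)] A'(2) B'(2) by auto
    then consider "v = u" | "v = - u" unfolding dir_def A B by auto
    then show ?thesis
    proof cases
      case 1
      have "p = q" using free_seg_same_direction[OF fA, of q S x] fB AB(3,4) unfolding A B 1 by simp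
      then have "T = S" using free_seg_length_unique[OF fA, of S] fB 1 by simp
      then show ?thesis using \<open>p = q\<close> 1 A B by simp
    next
      case 2
      then show ?thesis using free_seg_opposite_direction[OF fA, of q S x] fB AB(3,4) unfolding A B by simp
    qed
  qed
  have cover: "\<exists>A\<in>P. x \<in> open_seg A" if x: "x \<in> support D" "x \<notin> W" for x
  proof -
    obtain B where B: "B \<in> D" "x \<in> sg B" using x(1) unfolding supp by blast
    obtain q u S where quS: "B = (q, u, S)" by (cases B)
    have u: "primitive u" "u \<noteq> 0" using Dprim(1)[OF B(1)] primitive_nonzero unfolding quS dir_def by simp_all
    obtain s where s: "0 \<le> s" "ereal s \<le> S" "x = q + s *\<^sub>R rvec u" using B(2) unfolding sg_def quS mem_seg by auto
    \<comment> \<open>The finitely many cut parameters on the piece; the free segment through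
      \<open>x\<close> runs between the neighbours of \<open>s\<close> among them.\<close>
    define K where "K = {r \<in> dom_upto S. q + r *\<^sub>R rvec u \<in> W}"
    have "finite ((\<lambda>r. q + r *\<^sub>R rvec u) ` K)" using finW by (rule rev_finite_subset) (auto simp: K_def)
    moreover have "inj_on (\<lambda>r. q + r *\<^sub>R rvec u) K" by (rule inj_onI) (simp only: inj_line[OF u(2)])
    ultimately have finK: "finite K" by (rule finite_imageD)
    have q: "q \<in> W" using Wstart[OF B(1)] quS by simp
    then have "s \<noteq> 0" using x(2) s(3) by auto
    then have s0: "0 < s" using s(1) by simp
    have S0: "0 \<le> S" using Dprim(2)[OF B(1)] quS by simp
    have K0: "0 \<in> K" unfolding K_def using S0 q by (simp add: dom_upto_def zero_ereal_def)
    have sK: "s \<notin> K" using x(2) s(3) unfolding K_def by simp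
    define lo where "lo = Max {r\<in>K. r < s}"
    have finlo: "finite {r\<in>K. r < s}" "{r\<in>K. r < s} \<noteq> {}" using finK K0 s0 by auto
    have lo: "lo \<in> K" "lo < s" using Max_in[OF finlo] unfolding lo_def by auto
    have lo_max: "r \<le> lo" if "r \<in> K" "r < s" for r unfolding lo_def using finlo that by (intro Max_ge) auto
    have lo0: "0 \<le> lo" using lo_max[OF K0 s0] .
    \<comment> \<open>Without a cut parameter beyond \<open>s\<close> the free segment is a
      ray.\<close>
    define T where "T = (if \<exists>r\<in>K. s < r then ereal (Min {r\<in>K. s < r} - lo) else \<infinity>)"
    have T1: "lo + t \<notin> K" if t: "0 < t" "ereal t < T" for t
    proof
      assume K: "lo + t \<in> K"
      then have "lo + t \<noteq> s" using sK by auto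
      moreover have "\<not> lo + t < s" using lo_max[OF K] t(1) by auto
      ultimately have gt: "s < lo + t" by simp
      then have ex: "\<exists>r\<in>K. s < r" using K by blast
      have "Min {r\<in>K. s < r} \<le> lo + t" using finK K gt by (intro Min_le) auto
      then show False using t(2) ex unfolding T_def by simp
    qed
    have T2: "lo + t \<in> dom_upto S" if t: "0 < t" "ereal t < T" for t
    proof (cases "\<exists>r\<in>K. s < r")
      case True
      have "Min {r\<in>K. s < r} \<in> {r\<in>K. s < r}" using True finK by (intro Min_in) auto
      then have "ereal (Min {r\<in>K. s < r}) \<le> S" unfolding K_def dom_upto_def by simp
      moreover have "ereal (lo + t) \<le> ereal (Min {r\<in>K. s < r})" using t(2) True unfolding T_def by simp
      ultimately have "ereal (lo + t) \<le> S" using order_trans by blast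
      then show ?thesis using lo0 t(1) unfolding dom_upto_def by simp
    next
      case False
      \<comment> \<open>A finite end of the piece would itself be a cut parameter beyond
        \<open>s\<close>.\<close>
      have "S = \<infinity>"
      proof (rule ccontr)
        assume Sf: "S \<noteq> \<infinity>"
        then obtain r where r: "S = ereal r" using S0 by (cases S) auto
        have "r \<in> K" using Wend[OF B(1)] Sf S0 r unfolding K_def quS dir_def dom_upto_def by simp
        moreover have "s \<le> r" using s(2) r by simp
        ultimately show False using False sK by (metis order_le_less)
      qed
      then show ?thesis using lo0 t(1) unfolding dom_upto_def by simp
    qed
    have line: "q + lo *\<^sub>R rvec u + t *\<^sub>R rvec u = q + (lo + t) *\<^sub>R rvec u" for t by (simp add: algebra_simps)
    let ?A = "(q + lo *\<^sub>R rvec u, u, T)"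
    have sT: "ereal (s - lo) < T"
    proof (cases "\<exists>r\<in>K. s < r")
      case True
      have "Min {r\<in>K. s < r} \<in> {r\<in>K. s < r}" using True finK by (intro Min_in) auto
      then show ?thesis using True unfolding T_def by simp
    qed (simp add: T_def)
    have Tpos: "0 < T"
    proof -
      have "0 < ereal (s - lo)" using lo(2) by (simp add: zero_ereal_def)
      then show ?thesis using sT by (rule order_less_trans)
    qed
    have Tend: "q + lo *\<^sub>R rvec u + real_of_ereal T *\<^sub>R rvec u \<in> W" if "T \<noteq> \<infinity>"
    proof -
      have ex: "\<exists>r\<in>K. s < r" using that unfolding T_def by presburger
      have "Min {r\<in>K. s < r} \<in> {r\<in>K. s < r}" using ex finK by (intro Min_in) auto
      then have "q + Min {r\<in>K. s < r} *\<^sub>R rvec u \<in> W" unfolding K_def by simp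
      moreover have "lo + real_of_ereal T = Min {r\<in>K. s < r}" using ex unfolding T_def by simp
      ultimately show ?thesis unfolding line by simp
    qed
    have "open_seg ?A \<inter> W = {}"
    proof -
      have "y \<notin> W" if y: "y \<in> open_seg ?A" for y
      proof -
        obtain t where t: "0 < t" "ereal t < T" "y = q + (lo + t) *\<^sub>R rvec u" using y unfolding mem_open_seg line by blast
        then show ?thesis using T1[OF t(1,2)] T2[OF t(1,2)] unfolding K_def by simp
      qed
      then show ?thesis by blast
    qed
    then have "free_seg W ?A" unfolding free_seg_def using u(1) Tpos Tend lo(1) unfolding K_def by simp
    moreover have "open_seg ?A \<subseteq> sg B"
    proof
      fix y assume "y \<in> open_seg ?A"
      then obtain t where t: "0 < t" "ereal t < T" "y = q + (lo + t) *\<^sub>R rvec u" unfolding mem_open_seg line by blast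
      then show "y \<in> sg B"
        using imageI[OF T2[OF t(1,2)], of "\<lambda>r. q + r *\<^sub>R rvec u"] unfolding sg_def quS seg_def by simp
    qed
    moreover have "dir ?A = dir B" by (simp add: dir_def quS)
    ultimately have "?A \<in> P" unfolding P_def using B(1) by blast
    moreover have "x \<in> open_seg ?A"
      unfolding mem_open_seg line using lo(2) sT s(3) by (intro exI[of _ "s - lo"]) simp
    ultimately show ?thesis by blast
  qed
  \<comment> \<open>The same open segment may occur with both directions, so one representative is
    chosen for each.\<close>
  obtain D' where D': "D' \<subseteq> P" "inj_on open_seg D'" "open_seg ` P = open_seg ` D'"
    using subset_image_inj[of "open_seg ` P" open_seg P] by auto
  show thesis
  proof (rule that[of W D'])
    show "finite W" "W \<noteq> {}" by (rule finW neW)+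
    show "finite D'" using D'(1) finP by (rule finite_subset)
    show "free_seg W A" if "A \<in> D'" for A using that D'(1) unfolding P_def by auto
    show "open_seg A \<inter> open_seg B = {}" if AB: "A \<in> D'" "B \<in> D'" "A \<noteq> B" for A B
    proof (rule ccontr)
      assume "open_seg A \<inter> open_seg B \<noteq> {}"
      then obtain x where "x \<in> open_seg A" "x \<in> open_seg B" by blast
      then have "open_seg A = open_seg B" using eqP D'(1) AB(1,2) by blast
      then show False using inj_onD[OF D'(2)] AB by blast
    qed
    have "\<Union>(open_seg ` P) \<subseteq> support D"
    proof
      fix x assume "x \<in> \<Union>(open_seg ` P)"
      then obtain A B where "B \<in> D" "open_seg A \<subseteq> sg B" "x \<in> open_seg A" unfolding P_def by auto
      then show "x \<in> support D" unfolding supp by blast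
    qed
    moreover have "support D \<subseteq> W \<union> \<Union>(open_seg ` P)" using cover by blast
    ultimately have "support D = W \<union> \<Union>(open_seg ` P)" using Wsub by blast
    then show "support D = W \<union> \<Union>(open_seg ` D')" by (simp only: D'(3))
  qed
qed

section \<open>Rays of a curve\<close>

lemma edge_interiors_disjoint:
  assumes "tropical_curve G" "e \<in> edges G" "e' \<in> edges G" "e \<noteq> e'"
  shows "edge_interior G e \<inter> edge_interior G e' = {}"
proof -
  have "\<forall>e\<in>edges G. \<forall>e'\<in>edges G. e \<noteq> e' \<longrightarrow> edge_interior G e \<inter> edge_interior G e' = {}"
    using assms(1) unfolding tropical_curve_def by (elim conjE)
  then show ?thesis using assms by blast
qed

text \<open>Interior points are not vertices and open edges are disjoint, so an interior point
  determines its edge and its parameter.\<close>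

lemma chart_interior_inj:
  assumes G: "tropical_curve G" and e: "e \<in> edges G" "0 < t" "t < len G e"
    and e': "e' \<in> edges G" "t' \<in> {0..len G e'}" and eq: "chart G e t = chart G e' t'"
  shows "e' = e \<and> t' = t"
proof -
  have nv: "chart G e' t' \<notin> verts G" using chart_interior_not_vert[OF G e] eq by simp
  then have "t' \<noteq> 0" "t' \<noteq> len G e'" using chart_end_in_verts[OF G e'(1)] by auto
  then have t': "0 < t'" "t' < len G e'" using e'(2) by auto
  have "chart G e t \<in> edge_interior G e" unfolding edge_interior_def using e(2,3) by (intro imageI) simp
  moreover have "chart G e t \<in> edge_interior G e'" unfolding edge_interior_def eq using t' by (intro imageI) simp
  ultimately have "e' = e" using edge_interiors_disjoint[OF G e(1) e'(1)] by blast
  moreover have "\<forall>e\<in>edges G. inj_on (chart G e) {0<..<len G e} \<and> edge_interior G e \<inter> verts G = {}"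
    using G unfolding tropical_curve_def by (elim conjE)
  then have "inj_on (chart G e) {0<..<len G e}" using e(1) by blast
  ultimately show ?thesis using eq e t' by (auto simp: inj_on_def)
qed

lemma subdividesD:
  assumes "subdivides N G" "d \<in> edges N"
  obtains (ascending) e a where "e \<in> edges G" "0 \<le> a" "\<And>t. t \<in> {0..len N d} \<Longrightarrow> ereal a + t \<le> len G e \<and> chart N d t = chart G e (ereal a + t)"
    | (descending) e a where "e \<in> edges G" "0 \<le> a" "ereal a \<le> len G e" "\<And>t. t \<in> {0..len N d} \<Longrightarrow> t \<le> ereal a \<and> chart N d t = chart G e (ereal a - t)"
proof -
  have "\<exists>e\<in>edges G. \<exists>a::real. 0 \<le> a \<and> ereal a \<le> len G e \<and>
        ((\<forall>t\<in>{0..len N d}. ereal a + t \<le> len G e \<and> chart N d t = chart G e (ereal a + t)) \<or>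
         (\<forall>t\<in>{0..len N d}. t \<le> ereal a \<and> chart N d t = chart G e (ereal a - t)))"
    using assms unfolding subdivides_def by (elim conjE) (rule bspec)
  then show thesis using that by (elim bexE exE conjE disjE) simp_all
qed

text \<open>Parameters of a descending edge are bounded by the real number \<open>a\<close>, so an
  infinite edge is ascending.\<close>

lemma subdivision_infinite_edge_in:
  assumes "subdivides N G" "d \<in> edges N" "len N d = \<infinity>"
  obtains e b where "e \<in> edges G" "len G e = \<infinity>" "0 \<le> b" "\<forall>t\<ge>0. chart N d t = chart G e (ereal b + t)"
  using assms(1,2)
proof (cases rule: subdividesD)
  case (ascending e a)
  have "ereal a + \<infinity> \<le> len G e" using ascending(3)[of \<infinity>] assms(3) by simp
  then have "len G e = \<infinity>" by simp
  then show thesis using that[of e a] ascending assms(3) by simp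
next
  case (descending e a)
  have "\<infinity> \<le> ereal a" using descending(4)[of \<infinity>] assms(3) by simp
  then show thesis by simp
qed

text \<open>Finitely many edges of the subdivision cover an infinite edge, so one of them covers points of it that are
  arbitrarily far out.\<close>

lemma subdivision_infinite_edge_of:
  assumes N: "tropical_curve N" and H: "tropical_curve H" and sub: "subdivides N H" and e: "e \<in> edges H" "len H e = \<infinity>"
  obtains d a where "d \<in> edges N" "len N d = \<infinity>" "0 \<le> a" "\<forall>t\<ge>0. chart N d t = chart H e (ereal a + t)"
proof -
  \<comment> \<open>Each \<open>A v\<close> has at most one element, so the half-line can be covered
    only if some \<open>B d\<close> is unbounded.\<close>
  define A where "A v = {t. 0 < t \<and> chart H e (ereal t) = v}" for v
  define B where "B d = {t. 0 < t \<and> (\<exists>s\<in>{0..len N d}. chart H e (ereal t) = chart N d s)}" for d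
  have inj: "e' = e \<and> t' = ereal t" if "0 < t" "e' \<in> edges H" "t' \<in> {0..len H e'}" "chart H e (ereal t) = chart H e' t'" for t e' t'
    using chart_interior_inj[OF H e(1), of "ereal t" e' t'] that e(2) by simp
  have bA: "bdd_above (A v)" for v
  proof (cases "A v = {}")
    case False
    then obtain t where t: "t \<in> A v" by blast
    have "s = t" if "s \<in> A v" for s
      using inj[of t e "ereal s"] that t e unfolding A_def by simp
    then show ?thesis by (auto intro!: bdd_aboveI[of _ t])
  qed simp
  have fin: "finite (verts N)" "finite (edges N)" using N unfolding tropical_curve_def by auto
  have cover: "{0<..} \<subseteq> (\<Union>v\<in>verts N. A v) \<union> (\<Union>d\<in>edges N. B d)"
  proof
    fix t :: real assume t: "t \<in> {0<..}"
    have "chart H e (ereal t) \<in> curve_points H" using t e by (intro chart_in_points) auto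
    then have "chart H e (ereal t) \<in> curve_points N" using sub unfolding subdivides_def by simp
    then show "t \<in> (\<Union>v\<in>verts N. A v) \<union> (\<Union>d\<in>edges N. B d)" using t unfolding curve_points_def A_def B_def by auto
  qed
  have "\<exists>d\<in>edges N. \<not> bdd_above (B d)"
  proof (rule ccontr)
    assume "\<not> ?thesis"
    then have "bdd_above ((\<Union>v\<in>verts N. A v) \<union> (\<Union>d\<in>edges N. B d))"
      using fin bA by simp
    then have "bdd_above {0::real<..}" using cover by (rule bdd_above_mono)
    then obtain M :: real where M: "\<And>x. 0 < x \<Longrightarrow> x \<le> M" unfolding bdd_above_def by auto
    have "\<bar>M\<bar> + 1 \<le> M" by (rule M) simp
    then show False by simp
  qed
  then obtain d where d: "d \<in> edges N" "\<not> bdd_above (B d)" by auto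
  show thesis using sub d(1)
  proof (cases rule: subdividesD)
    case (ascending e' a)
    have B: "e' = e \<and> ereal a + s = ereal t" if "0 < t" "s \<in> {0..len N d}" "chart H e (ereal t) = chart N d s" for t s
    proof (rule inj)
      show "ereal a + s \<in> {0..len H e'}" using ascending(3)[OF that(2)] ascending(2) that(2) by (simp add: add_nonneg_nonneg)
    qed (use that ascending in simp_all)
    have "B d \<noteq> {}" using d(2) by auto
    then obtain t s where "0 < t" "s \<in> {0..len N d}" "chart H e (ereal t) = chart N d s" unfolding B_def by blast
    then have e': "e' = e" using B by blast
    have "len N d = \<infinity>"
    proof (rule ccontr)
      assume "len N d \<noteq> \<infinity>"
      then obtain l where l: "len N d = ereal l" using curve_len_pos[OF N d(1)] by (cases "len N d") auto
      have "t \<le> a + l" if "t \<in> B d" for t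
      proof -
        obtain s where s: "0 < t" "s \<in> {0..len N d}" "chart H e (ereal t) = chart N d s" using \<open>t \<in> B d\<close> unfolding B_def by blast
        have "ereal t = ereal a + s" using B[OF s] by simp
        also have "\<dots> \<le> ereal a + ereal l" using s(2) l by (intro add_left_mono) simp
        finally show ?thesis by simp
      qed
      then have "bdd_above (B d)" by (intro bdd_aboveI)
      then show False using d(2) by simp
    qed
    then show thesis using that[of d a] d(1) ascending e' by simp
  next
    case (descending e' a)
    \<comment> \<open>A descending edge covers no parameter beyond \<open>a\<close>.\<close>
    have "t \<le> a" if "t \<in> B d" for t
    proof -
      obtain s where s: "0 < t" "s \<in> {0..len N d}" "chart H e (ereal t) = chart N d s" using \<open>t \<in> B d\<close> unfolding B_def by blast
      have le: "ereal a - s \<le> ereal a" "0 \<le> ereal a - s" using s(2) descending(4)[OF s(2)] by (cases s; simp)+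
      have "e' = e \<and> ereal a - s = ereal t"
      proof (rule inj[OF s(1) descending(1)])
        show "ereal a - s \<in> {0..len H e'}" using le descending(3) order_trans by auto
        show "chart H e (ereal t) = chart H e' (ereal a - s)" using s(3) descending(4)[OF s(2)] by simp
      qed
      then show ?thesis using le(1) by simp
    qed
    then have "bdd_above (B d)" by (intro bdd_aboveI)
    then show thesis using d(2) by simp
  qed
qed

text \<open>Through a common subdivision, a ray of any model runs into an infinite edge of
  \<open>G\<close>; the charts differ by a translation, with neither reversal nor rescaling.\<close>

lemma ray_edge:
  assumes G: "tropical_curve G" and H: "model_of H G" and e: "e \<in> edges H" "len H e = \<infinity>"
  obtains e' a b where "e' \<in> edges G" "len G e' = \<infinity>" "0 \<le> a" "0 \<le> b"
    "\<forall>t\<ge>0. chart H e (ereal a + t) = chart G e' (ereal b + t)"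
proof -
  obtain N :: "'a curve_model" where N: "tropical_curve H" "tropical_curve N" "subdivides N H" "subdivides N G"
    using H unfolding model_of_def by blast
  obtain d a where d: "d \<in> edges N" "len N d = \<infinity>" "0 \<le> a" "\<forall>t\<ge>0. chart N d t = chart H e (ereal a + t)"
    by (rule subdivision_infinite_edge_of[OF N(2,1,3) e])
  obtain e' b where e': "e' \<in> edges G" "len G e' = \<infinity>" "0 \<le> b" "\<forall>t\<ge>0. chart N d t = chart G e' (ereal b + t)"
    by (rule subdivision_infinite_edge_in[OF N(4) d(1,2)])
  show thesis using that[OF e'(1,2) d(3) e'(3)] d(4) e'(4) by simp
qed

text \<open>An infinite edge of the common subdivision ends at the given point and lies in an
  infinite edge of \<open>H\<close>; a point at infinity of \<open>H\<close> lies on a single edge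
  of \<open>H\<close>, which is therefore \<open>e\<close>.\<close>

lemma ray_point_at_infinity:
  assumes G: "tropical_curve G" and H: "model_of H G" and e: "e \<in> edges H" "len H e = \<infinity>"
    and e': "e' \<in> edges G" "len G e' = \<infinity>" and mem: "chart G e' \<infinity> \<in> chart H e ` {0..\<infinity>}"
  shows "chart G e' \<infinity> = chart H e \<infinity>"
proof -
  obtain N :: "'a curve_model" where N: "tropical_curve H" "tropical_curve N" "subdivides N H" "subdivides N G"
    using H unfolding model_of_def by blast
  obtain d a where d: "d \<in> edges N" "len N d = \<infinity>" "0 \<le> a" "\<forall>t\<ge>0. chart N d t = chart G e' (ereal a + t)"
    by (rule subdivision_infinite_edge_of[OF N(2) G N(4) e'])
  obtain e'' b where e'': "e'' \<in> edges H" "len H e'' = \<infinity>" "0 \<le> b" "\<forall>t\<ge>0. chart N d t = chart H e'' (ereal b + t)"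
    by (rule subdivision_infinite_edge_in[OF N(3) d(1,2)])
  have eq: "chart G e' \<infinity> = chart H e'' \<infinity>" using d(4)[rule_format, of \<infinity>] e''(4)[rule_format, of \<infinity>] by simp
  obtain s where s: "s \<in> {0..\<infinity>}" "chart H e s = chart H e'' \<infinity>" using mem eq by auto
  then have "e'' = e" using chart_eq_infinite_end[OF N(1) e(1) _ e''(1,2)] e(2) by simp
  then show ?thesis using eq by simp
qed

text \<open>Attaches to each ray, whatever its model, the one infinite edge of \<open>G\<close> into
  which it runs.\<close>

lemma raysE:
  assumes G: "tropical_curve G" and L: "L \<in> rays G"
  obtains e where "e \<in> edges G" "len G e = \<infinity>" "chart G e \<infinity> \<in> L"
    "\<forall>e'\<in>edges G. len G e' = \<infinity> \<longrightarrow> chart G e' \<infinity> \<in> L \<longrightarrow> e' = e"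
proof -
  obtain H e0 where H: "model_of H G" "e0 \<in> edges H" "len H e0 = \<infinity>" "L = chart H e0 ` {0..\<infinity>}"
    using L unfolding rays_def by blast
  obtain e a b where e: "e \<in> edges G" "len G e = \<infinity>" "0 \<le> a" "0 \<le> b"
    "\<forall>t\<ge>0. chart H e0 (ereal a + t) = chart G e (ereal b + t)"
    by (rule ray_edge[OF G H(1-3)])
  have inf: "chart G e \<infinity> = chart H e0 \<infinity>" using e(5)[rule_format, of \<infinity>] by simp
  show thesis
  proof (rule that[OF e(1,2)])
    show "chart G e \<infinity> \<in> L" unfolding H(4) inf by auto
    show "\<forall>e'\<in>edges G. len G e' = \<infinity> \<longrightarrow> chart G e' \<infinity> \<in> L \<longrightarrow> e' = e"
    proof (intro ballI impI)
      fix e' assume e': "e' \<in> edges G" "len G e' = \<infinity>" "chart G e' \<infinity> \<in> L"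
      then have "chart G e' \<infinity> = chart H e0 \<infinity>" using ray_point_at_infinity[OF G H(1-3)] H(4) by blast
      then have "chart G e \<infinity> = chart G e' \<infinity>" using inf by simp
      then show "e' = e" using chart_eq_infinite_end[OF G e(1) _ e'(1,2), of \<infinity>] e(2) by simp
    qed
  qed
qed

text \<open>A translation of the parameter changes the constant but not the slope, so slopes at
  infinity can be computed in the given model.\<close>

lemma ray_chart_eventually:
  assumes G: "tropical_curve G" and H: "model_of H G" "e0 \<in> edges H" "len H e0 = \<infinity>"
    and e: "e \<in> edges G" "len G e = \<infinity>" "chart G e \<infinity> \<in> chart H e0 ` {0..\<infinity>}"
    and ev: "\<forall>\<^sub>F t in at_top. f (chart G e (ereal t)) = ereal (real_of_int m * t + c)"
  shows "\<exists>c. \<forall>\<^sub>F t in at_top. f (chart H e0 (ereal t)) = ereal (real_of_int m * t + c)"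
proof -
  obtain e' a b where e': "e' \<in> edges G" "len G e' = \<infinity>" "0 \<le> a" "0 \<le> b"
    "\<forall>t\<ge>0. chart H e0 (ereal a + t) = chart G e' (ereal b + t)"
    by (rule ray_edge[OF G H])
  have "chart G e' \<infinity> = chart G e \<infinity>"
    using e'(5)[rule_format, of \<infinity>] ray_point_at_infinity[OF G H e] by simp
  then have "e' = e" using chart_eq_infinite_end[OF G e(1) _ e'(1,2), of \<infinity>] e(2) by simp
  obtain K where K: "\<And>t. K \<le> t \<Longrightarrow> f (chart G e (ereal t)) = ereal (real_of_int m * t + c)"
    using ev unfolding eventually_at_top_linorder by blast
  have "\<forall>\<^sub>F t in at_top. f (chart H e0 (ereal t)) = ereal (real_of_int m * t + (real_of_int m * (b - a) + c))"
  proof (rule eventually_at_top_linorderI[of "max a (K + a)"])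
    fix t assume t: "max a (K + a) \<le> t"
    then have "chart H e0 (ereal t) = chart G e (ereal (b + (t - a)))"
      using e'(5)[rule_format, of "ereal (t - a)"] \<open>e' = e\<close> by (simp add: zero_ereal_def)
    moreover have "K \<le> b + (t - a)" using t e'(4) by simp
    ultimately show "f (chart H e0 (ereal t)) = ereal (real_of_int m * t + (real_of_int m * (b - a) + c))"
      using K by (simp add: algebra_simps)
  qed
  then show ?thesis by (rule exI)
qed

lemma slope_at_infinityI:
  assumes G: "tropical_curve G" and L: "L \<in> rays G"
    and e: "e \<in> edges G" "len G e = \<infinity>" "chart G e \<infinity> \<in> L"
    and ev: "\<forall>\<^sub>F t in at_top. f (chart G e (ereal t)) = ereal (real_of_int m * t + c)"
  shows "slope_at_infinity G f L m"
proof -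
  obtain H e0 where H: "model_of H G" "e0 \<in> edges H" "len H e0 = \<infinity>" "L = chart H e0 ` {0..\<infinity>}"
    using L unfolding rays_def by blast
  obtain c' where "\<forall>\<^sub>F t in at_top. f (chart H e0 (ereal t)) = ereal (real_of_int m * t + c')"
    using ray_chart_eventually[OF G H(1-3) e(1,2) _ ev] e(3) H(4) by blast
  then show ?thesis unfolding slope_at_infinity_def using H by (intro exI conjI)
qed

lemma affine_eventually_eq:
  assumes "\<forall>\<^sub>F t in at_top. real_of_int m * t + c = real_of_int n * t + d"
  shows "m = n"
proof -
  obtain K where K: "\<And>t. K \<le> t \<Longrightarrow> real_of_int m * t + c = real_of_int n * t + d"
    using assms unfolding eventually_at_top_linorder by blast
  show ?thesis using K[of K] K[of "K + 1"] by (simp add: algebra_simps)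
qed

text \<open>\<open>slope_at_infinity\<close> asks for some model; the slope is independent of the
  one chosen.\<close>

lemma slope_at_infinityD:
  assumes G: "tropical_curve G" and slope: "slope_at_infinity G f L n"
    and e: "e \<in> edges G" "len G e = \<infinity>" "chart G e \<infinity> \<in> L"
    and ev: "\<forall>\<^sub>F t in at_top. f (chart G e (ereal t)) = ereal (real_of_int m * t + c)"
  shows "n = m"
proof -
  obtain H e0 c0 where H: "model_of H G" "e0 \<in> edges H" "len H e0 = \<infinity>" "L = chart H e0 ` {0..\<infinity>}"
    "\<forall>\<^sub>F t in at_top. f (chart H e0 (ereal t)) = ereal (real_of_int n * t + c0)"
    using slope unfolding slope_at_infinity_def by (elim exE conjE)
  obtain c' where "\<forall>\<^sub>F t in at_top. f (chart H e0 (ereal t)) = ereal (real_of_int m * t + c')"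
    using ray_chart_eventually[OF G H(1-3) e(1,2) _ ev] e(3) H(4) by blast
  with H(5) have "\<forall>\<^sub>F t in at_top. real_of_int n * t + c0 = real_of_int m * t + c'"
    by eventually_elim simp
  then show ?thesis by (rule affine_eventually_eq)
qed

section \<open>The curve of a connected union of segments\<close>

lemma closed_seg:
  assumes "u \<noteq> 0" "0 \<le> T" shows "closed (seg p u T)"
  unfolding seg_eq_gap[OF assms]
  by (intro closed_Collect_le PL_continuous PL_seg_gap continuous_on_const)

text \<open>Rays depend only on the fields of \<open>curve_model\<close>, and the two records may
  have different types.\<close>

lemma rays_cong:
  assumes "verts G = verts G'" "edges G = edges G'" "len G = len G'" "chart G = chart G'"
  shows "rays G = rays G'"
  unfolding rays_def model_of_def subdivides_def curve_points_def assms ..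

lemma curve_cong:
  assumes "verts G = verts G'" "edges G = edges G'" "len G = len G'" "chart G = chart G'"
  shows "tropical_curve G = tropical_curve G'"
  unfolding tropical_curve_def edge_ends_def edge_interior_def assms ..

lemma subdivides_refl:
  assumes "tropical_curve G"
  shows "subdivides G G"
  unfolding subdivides_def
proof (intro conjI ballI)
  fix d assume d: "d \<in> edges G"
  show "\<exists>e\<in>edges G. \<exists>a::real. 0 \<le> a \<and> ereal a \<le> len G e \<and>
        ((\<forall>t\<in>{0..len G d}. ereal a + t \<le> len G e \<and> chart G d t = chart G e (ereal a + t)) \<or>
         (\<forall>t\<in>{0..len G d}. t \<le> ereal a \<and> chart G d t = chart G e (ereal a - t)))"
    using curve_len_pos[OF assms d] d
    by (intro bexI[of _ d] exI[of _ 0] conjI disjI1) (auto simp: zero_ereal_def[symmetric])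
qed simp_all

text \<open>Edges are numbered below \<open>N\<close> because a model names its edges by natural
  numbers.\<close>

locale embedded_graph =
  fixes W :: "(real^'n::finite) set" and ds :: "nat \<Rightarrow> 'n piece" and N :: nat
  assumes finW: "finite W" and neW: "W \<noteq> {}"
    and free: "\<And>k. k < N \<Longrightarrow> free_seg W (ds k)"
    and disj: "\<And>j k. j < N \<Longrightarrow> k < N \<Longrightarrow> j \<noteq> k \<Longrightarrow> open_seg (ds j) \<inter> open_seg (ds k) = {}"
    and conn: "connected (W \<union> (\<Union>k<N. open_seg (ds k)))"
begin

definition base :: "nat \<Rightarrow> real^'n" where "base k = fst (ds k)"
definition dir :: "nat \<Rightarrow> int^'n" where "dir k = fst (snd (ds k))"
definition lth :: "nat \<Rightarrow> ereal" where "lth k = snd (snd (ds k))"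
definition V :: "(real^'n) set" where "V = W \<union> (\<Union>k<N. open_seg (ds k))"

lemma mem_V: "x \<in> V \<longleftrightarrow> x \<in> W \<or> (\<exists>k. k < N \<and> x \<in> open_seg (ds k))"
  by (auto simp: V_def)

lemma free_seg_ds: "k < N \<Longrightarrow> free_seg W (base k, dir k, lth k)"
  using free[of k] by (simp add: base_def dir_def lth_def)

lemma mem_open_seg_ds: "x \<in> open_seg (ds k) \<longleftrightarrow> (\<exists>t. 0 < t \<and> ereal t < lth k \<and> x = base k + t *\<^sub>R rvec (dir k))"
  using mem_open_seg[of x "base k" "dir k" "lth k"] by (simp add: base_def dir_def lth_def)

text \<open>Finite points are the points of the embedded set, tagged \<open>Inl\<close>; every ray
  gets an end \<open>Inr k\<close> of its own, so no two rays share a point at infinity.\<close>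

definition the_chart :: "nat \<Rightarrow> ereal \<Rightarrow> real^'n + nat" where
  "the_chart k t = (if t = \<infinity> then Inr k else Inl (base k + real_of_ereal t *\<^sub>R rvec (dir k)))"

definition graph :: "(real^'n + nat) curve_model" where
  "graph = \<lparr>verts = Inl ` W \<union> Inr ` {k. k < N \<and> lth k = \<infinity>}, edges = {..<N}, len = lth, chart = the_chart\<rparr>"

lemma graph_simps [simp]:
  "verts graph = Inl ` W \<union> Inr ` {k. k < N \<and> lth k = \<infinity>}" "edges graph = {..<N}" "len graph = lth" "chart graph = the_chart"
  by (simp_all add: graph_def)

lemma chart_real [simp]: "the_chart k (ereal t) = Inl (base k + t *\<^sub>R rvec (dir k))"
  and chart_0 [simp]: "the_chart k 0 = Inl (base k)" and chart_infinity [simp]: "the_chart k \<infinity> = Inr k"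
  by (simp_all add: the_chart_def)

lemma dir_nonzero: "k < N \<Longrightarrow> dir k \<noteq> 0"
  using free_segD(1)[OF free_seg_ds] by (rule primitive_nonzero)

lemma lth_cases:
  assumes "k < N" obtains "lth k = \<infinity>" | r where "lth k = ereal r" "0 < r"
  using free_segD(2)[OF free_seg_ds[OF assms]] by (cases "lth k") auto

lemma the_chart_interior: "the_chart k ` {0<..<lth k} = Inl ` open_seg (ds k)"
proof
  show "the_chart k ` {0<..<lth k} \<subseteq> Inl ` open_seg (ds k)"
  proof
    fix y assume "y \<in> the_chart k ` {0<..<lth k}"
    then obtain t where t: "0 < t" "t < lth k" "y = the_chart k t" by auto
    then obtain s where s: "t = ereal s" by (cases t) auto
    have "base k + s *\<^sub>R rvec (dir k) \<in> open_seg (ds k)"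
      unfolding mem_open_seg_ds using t s by (intro exI[of _ s]) simp
    then show "y \<in> Inl ` open_seg (ds k)" using t(3) s by simp
  qed
  show "Inl ` open_seg (ds k) \<subseteq> the_chart k ` {0<..<lth k}"
  proof
    fix y :: "real^'n + nat" assume "y \<in> Inl ` open_seg (ds k)"
    then obtain t where t: "0 < t" "ereal t < lth k" "y = Inl (base k + t *\<^sub>R rvec (dir k))"
      unfolding image_iff Bex_def mem_open_seg_ds by (elim exE conjE) simp
    then show "y \<in> the_chart k ` {0<..<lth k}" by (intro image_eqI[of _ _ "ereal t"]) simp_all
  qed
qed

lemma edge_interior_graph: "edge_interior graph k = Inl ` open_seg (ds k)"
  unfolding edge_interior_def by (simp add: the_chart_interior)

lemma the_chart_end_in_verts:
  assumes k: "k < N" shows "the_chart k (lth k) \<in> verts graph"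
proof (cases rule: lth_cases[OF k])
  case 1
  then show ?thesis using k by simp
next
  case (2 r)
  then have "base k + r *\<^sub>R rvec (dir k) \<in> W" using free_segD(6)[OF free_seg_ds[OF k]] by blast
  then show ?thesis using 2 by simp
qed

lemma the_chart_start_in_verts: "k < N \<Longrightarrow> the_chart k 0 \<in> verts graph"
  using free_segD(3)[OF free_seg_ds] by simp

definition adj :: "((real^'n + nat) \<times> (real^'n + nat)) set" where
  "adj = {(a, b). \<exists>e\<in>edges graph. edge_ends graph e = {a, b}}"

lemma adj_edge: "k < N \<Longrightarrow> (the_chart k 0, the_chart k (lth k)) \<in> adj"
  unfolding adj_def edge_ends_def by auto

lemma sym_adj: "sym (adj\<^sup>*)"
proof (rule sym_rtrancl)
  show "sym adj" unfolding sym_def adj_def by (auto simp: insert_commute)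
qed

lemma seg_in_W:
  assumes k: "k < N" and x: "x \<in> seg (base k) (dir k) (lth k)" and R: "x \<in> W"
  shows "Inl x = the_chart k 0 \<or> Inl x = the_chart k (lth k)"
proof -
  obtain t where t: "0 \<le> t" "ereal t \<le> lth k" "x = base k + t *\<^sub>R rvec (dir k)" using x unfolding mem_seg by blast
  have "\<not> (0 < t \<and> ereal t < lth k)" using free_segD(5)[OF free_seg_ds[OF k], of t] R t(3) by blast
  then consider "t = 0" | "ereal t = lth k" using t(1,2) by fastforce
  then show ?thesis
  proof cases
    case 2
    then have "the_chart k (lth k) = Inl x" using t(3) by (simp flip: 2)
    then show ?thesis by simp
  qed (use t in simp)
qed

lemma seg_cases:
  assumes k: "k < N" and x: "x \<in> seg (base k) (dir k) (lth k)"
  shows "x \<in> W \<or> x \<in> open_seg (ds k)"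
proof -
  obtain t where t: "0 \<le> t" "ereal t \<le> lth k" "x = base k + t *\<^sub>R rvec (dir k)" using x unfolding mem_seg by blast
  consider "t = 0" | "0 < t" "ereal t < lth k" | "ereal t = lth k" using t(1,2) by fastforce
  then show ?thesis
  proof cases
    case 1
    then show ?thesis using t free_segD(3)[OF free_seg_ds[OF k]] by simp
  next
    case 2
    then show ?thesis unfolding mem_open_seg_ds using t by blast
  next
    case 3
    then show ?thesis using t free_segD(6)[OF free_seg_ds[OF k], of t] by simp
  qed
qed

lemma seg_subset_V: "k < N \<Longrightarrow> seg (base k) (dir k) (lth k) \<subseteq> V"
proof
  fix x assume "k < N" "x \<in> seg (base k) (dir k) (lth k)"
  then show "x \<in> V" using seg_cases[of k x] unfolding mem_V by auto
qed

lemma open_seg_subset: "open_seg (ds k) \<subseteq> seg (base k) (dir k) (lth k)"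
proof
  fix x assume "x \<in> open_seg (ds k)"
  then obtain t where "0 < t" "ereal t < lth k" "x = base k + t *\<^sub>R rvec (dir k)" unfolding mem_open_seg_ds by (elim exE conjE)
  then show "x \<in> seg (base k) (dir k) (lth k)" unfolding mem_seg by (intro exI[of _ t]) simp
qed

text \<open>If a vertex were unreachable, the reachable vertices with the closed segments starting
  at them and the other vertices with theirs would split the connected set \<open>V\<close> into two
  disjoint nonempty closed parts.\<close>

lemma reach_W:
  assumes w0: "w0 \<in> W" and w: "w \<in> W"
  shows "(Inl w0, Inl w) \<in> adj\<^sup>*"
proof (rule ccontr)
  assume nw: "(Inl w0, Inl w) \<notin> adj\<^sup>*"
  define R where "R = {w \<in> W. (Inl w0, Inl w) \<in> adj\<^sup>*}"
  define sg where "sg k = seg (base k) (dir k) (lth k)" for k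
  define V1 where "V1 = R \<union> (\<Union>k\<in>{k. k < N \<and> base k \<in> R}. sg k)"
  define V2 where "V2 = (W - R) \<union> (\<Union>k\<in>{k. k < N \<and> base k \<notin> R}. sg k)"
  \<comment> \<open>Either both ends of an edge are reachable or neither is.\<close>
  have seg_R: "x \<in> R \<longleftrightarrow> base k \<in> R" if "k < N" "x \<in> sg k" "x \<in> W" for k x
  proof -
    have "(Inl (base k), Inl x) \<in> adj\<^sup>*"
      using seg_in_W[OF that(1) _ that(3)] that(2) adj_edge[OF that(1)] unfolding sg_def by auto
    moreover from this have "(Inl x, Inl (base k)) \<in> adj\<^sup>*" using sym_adj unfolding sym_def by blast
    ultimately show ?thesis using that(3) free_segD(3)[OF free_seg_ds[OF that(1)]] unfolding R_def
      by (auto intro: rtrancl_trans)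
  qed
  have closed_sg: "closed (sg k)" if "k < N" for k
    unfolding sg_def using dir_nonzero[OF that] free_segD(2)[OF free_seg_ds[OF that]]
    by (intro closed_seg) (simp_all add: less_imp_le)
  have "finite R" using finW unfolding R_def by simp
  then have "closed R" "closed (W - R)" using finW by (simp_all add: finite_imp_closed)
  moreover have "closed (\<Union>k\<in>{k. k < N \<and> base k \<in> R}. sg k)" "closed (\<Union>k\<in>{k. k < N \<and> base k \<notin> R}. sg k)"
    using closed_sg by (simp_all add: closed_UN)
  ultimately have cl: "closed V1" "closed V2" unfolding V1_def V2_def by (simp_all add: closed_Un)
  have cover: "V \<subseteq> V1 \<union> V2"
  proof
    fix x assume "x \<in> V"
    then consider "x \<in> W" | k where "k < N" "x \<in> open_seg (ds k)" unfolding mem_V by (elim disjE exE conjE)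
    then show "x \<in> V1 \<union> V2"
    proof cases
      case 1
      then show ?thesis unfolding V1_def V2_def by blast
    next
      case 2
      have "x \<in> sg k" using subsetD[OF open_seg_subset 2(2)] unfolding sg_def .
      then show ?thesis using 2(1) unfolding V1_def V2_def by blast
    qed
  qed
  \<comment> \<open>A common point would be a vertex, excluded by \<open>seg_R\<close>, or interior
    to two different edges, excluded by \<open>disj\<close>.\<close>
  have "x \<notin> V2" if x: "x \<in> V1" for x
  proof
    assume x2: "x \<in> V2"
    show False
    proof (cases "x \<in> W")
      case True
      have "x \<in> R" using x True seg_R unfolding V1_def by blast
      moreover have "x \<notin> R" using x2 True seg_R unfolding V2_def by blast
      ultimately show False by blast
    next
      case False
      obtain j where j: "j < N" "base j \<in> R" "x \<in> sg j" using x False unfolding V1_def R_def by blast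
      obtain k where k: "k < N" "base k \<notin> R" "x \<in> sg k" using x2 False unfolding V2_def by blast
      have "x \<in> open_seg (ds j)" "x \<in> open_seg (ds k)"
        using seg_cases[OF j(1) j(3)[unfolded sg_def]] seg_cases[OF k(1) k(3)[unfolded sg_def]] False by simp_all
      moreover have "j \<noteq> k" using j k by auto
      ultimately show False using disj[OF j(1) k(1)] by blast
    qed
  qed
  then have "V1 \<inter> V2 \<inter> V = {}" by blast
  moreover have "w0 \<in> V1 \<inter> V" using w0 unfolding V1_def R_def V_def by simp
  moreover have "w \<in> V2 \<inter> V" using w nw unfolding V2_def R_def V_def by simp
  moreover have "connected V" using conn unfolding V_def .
  ultimately show False using cl cover unfolding connected_closed by blast
qed

lemma tropical_curve_graph: "tropical_curve graph"
proof -
  have ends: "edge_ends graph k \<subseteq> verts graph" if "k < N" for k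
    unfolding edge_ends_def using the_chart_start_in_verts[OF that] the_chart_end_in_verts[OF that] by (simp del: graph_simps(1))
  have conn_verts: "(u, v) \<in> adj\<^sup>*" if u: "u \<in> verts graph" and v: "v \<in> verts graph" for u v
  proof -
    have W: "\<exists>w\<in>W. (u, Inl w) \<in> adj\<^sup>*" if "u \<in> verts graph" for u
    proof -
      have "u \<in> Inl ` W \<union> Inr ` {k. k < N \<and> lth k = \<infinity>}" using that by simp
      then show ?thesis
      proof
        assume "u \<in> Inr ` {k. k < N \<and> lth k = \<infinity>}"
        then obtain k where k: "k < N" "lth k = \<infinity>" "u = Inr k" by blast
        have "(Inl (base k), u) \<in> adj\<^sup>*" using adj_edge[OF k(1)] k by auto
        then have "(u, Inl (base k)) \<in> adj\<^sup>*" using sym_adj unfolding sym_def by blast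
        then show ?thesis using free_segD(3)[OF free_seg_ds[OF k(1)]] by blast
      qed auto
    qed
    obtain w where w: "w \<in> W" "(u, Inl w) \<in> adj\<^sup>*" using W[OF u] by blast
    obtain w' where w': "w' \<in> W" "(v, Inl w') \<in> adj\<^sup>*" using W[OF v] by blast
    have "(Inl w', v) \<in> adj\<^sup>*" using w'(2) sym_adj unfolding sym_def by blast
    then show ?thesis using w(2) reach_W[OF w(1) w'(1)] by (blast intro: rtrancl_trans)
  qed
  have inj: "inj_on (the_chart k) {0<..<lth k}" if "k < N" for k
  proof (rule inj_onI)
    fix s t assume st: "s \<in> {0<..<lth k}" "t \<in> {0<..<lth k}" "the_chart k s = the_chart k t"
    obtain s' where s': "s = ereal s'" using st(1) by (cases s) auto
    obtain t' where t': "t = ereal t'" using st(2) by (cases t) auto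
    show "s = t" using st(3) dir_nonzero[OF that] unfolding s' t' by (simp add: rvec_eq_0_iff)
  qed
  have inter: "edge_interior graph k \<inter> verts graph = {}" if "k < N" for k
    unfolding edge_interior_graph using free_segD(5)[OF free_seg_ds[OF that]] by (auto simp: mem_open_seg_ds)
  have "\<forall>e\<in>edges graph. 0 < len graph e \<and> edge_ends graph e \<subseteq> verts graph"
    using free_segD(2)[OF free_seg_ds] ends by simp
  moreover have "\<forall>u\<in>verts graph. \<forall>v\<in>verts graph. (u, v) \<in> {(a, b). \<exists>e\<in>edges graph. edge_ends graph e = {a, b}}\<^sup>*"
    by (intro ballI) (rule conn_verts[unfolded adj_def])
  moreover have "\<forall>e\<in>edges graph. inj_on (chart graph e) {0<..<len graph e} \<and> edge_interior graph e \<inter> verts graph = {}"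
    using inj inter by (simp del: graph_simps(1))
  moreover have "\<forall>e\<in>edges graph. \<forall>e'\<in>edges graph. e \<noteq> e' \<longrightarrow> edge_interior graph e \<inter> edge_interior graph e' = {}"
  proof (intro ballI impI)
    fix e e' assume "e \<in> edges graph" "e' \<in> edges graph" "e \<noteq> e'"
    then have "open_seg (ds e) \<inter> open_seg (ds e') = {}" by (intro disj) simp_all
    then show "edge_interior graph e \<inter> edge_interior graph e' = {}"
      unfolding edge_interior_graph by (simp flip: image_Int)
  qed
  moreover have "\<forall>e\<in>edges graph. len graph e = \<infinity> \<longrightarrow>
        chart graph e 0 \<noteq> chart graph e \<infinity> \<and> (\<forall>e'\<in>edges graph. e' \<noteq> e \<longrightarrow> chart graph e \<infinity> \<notin> edge_ends graph e')"
    by (simp add: edge_ends_def the_chart_def)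
  moreover have "finite (verts graph)" "verts graph \<noteq> {}" "finite (edges graph)" using finW neW by simp_all
  ultimately show ?thesis unfolding tropical_curve_def by (intro conjI)
qed

lemma points_at_infinity_graph: "points_at_infinity graph = Inr ` {k. k < N \<and> lth k = \<infinity>}"
  unfolding points_at_infinity_def by auto

lemma finite_points_graph: "finite_points graph = Inl ` V"
proof
  show "finite_points graph \<subseteq> Inl ` V"
  proof
    fix x assume x: "x \<in> finite_points graph"
    show "x \<in> Inl ` V"
    proof (rule finite_point_cases[OF tropical_curve_graph x])
      assume "x \<in> verts graph"
      moreover have "x \<notin> points_at_infinity graph" using x unfolding finite_points_def by blast
      ultimately show ?thesis unfolding points_at_infinity_graph V_def by auto
    next
      fix e t assume e: "e \<in> edges graph" "t \<in> dom_upto (len graph e)" "x = chart graph e (ereal t)"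
      then have "base e + t *\<^sub>R rvec (dir e) \<in> seg (base e) (dir e) (lth e)" unfolding seg_def by (intro imageI) simp
      then show ?thesis using seg_subset_V[of e] e by auto
    qed
  qed
  show "Inl ` V \<subseteq> finite_points graph"
  proof
    fix y :: "real^'n + nat" assume "y \<in> Inl ` V"
    then obtain x where x: "x \<in> V" "y = Inl x" by blast
    have "y \<in> curve_points graph"
    proof (cases "x \<in> W")
      case True
      then show ?thesis unfolding curve_points_def using x by simp
    next
      case False
      then have "\<exists>k. k < N \<and> x \<in> open_seg (ds k)" using x unfolding mem_V by simp
      then obtain k where k: "k < N" "x \<in> open_seg (ds k)" by (elim exE conjE)
      then obtain t where t: "0 < t" "ereal t < lth k" "x = base k + t *\<^sub>R rvec (dir k)" unfolding mem_open_seg_ds by blast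
      have "chart graph k (ereal t) \<in> curve_points graph" using k t by (intro chart_in_points) simp_all
      then show ?thesis using t x by simp
    qed
    then show "y \<in> finite_points graph" using x unfolding finite_points_def points_at_infinity_graph by auto
  qed
qed

text \<open>A set, so that it makes sense for rays of all models; for a ray it is a singleton, the
  direction of the infinite edge into which the ray runs.\<close>

definition ray_dirs :: "(real^'n + nat) set \<Rightarrow> (int^'n) set" where
  "ray_dirs L = dir ` {k. k < N \<and> lth k = \<infinity> \<and> Inr k \<in> L}"

definition par_graph :: "(real^'n + nat) par_curve" where
  "par_graph = curve_model.extend graph \<lparr>parallel = {(L1, L2). L1 \<in> rays graph \<and> L2 \<in> rays graph \<and> ray_dirs L1 = ray_dirs L2}\<rparr>"

lemma par_graph_simps [simp]: "verts par_graph = verts graph" "edges par_graph = {..<N}" "len par_graph = lth" "chart par_graph = the_chart"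
  "parallel par_graph = {(L1, L2). L1 \<in> rays graph \<and> L2 \<in> rays graph \<and> ray_dirs L1 = ray_dirs L2}"
  by (simp_all add: par_graph_def graph_def curve_model.defs)

lemma rays_par_graph: "rays par_graph = rays graph"
  by (rule rays_cong) simp_all

lemma finite_points_par_graph: "finite_points par_graph = Inl ` V"
proof -
  have "finite_points par_graph = finite_points graph"
    unfolding finite_points_def curve_points_def points_at_infinity_def by simp
  then show ?thesis by (simp only: finite_points_graph)
qed

lemma tropical_curve_par_graph: "tropical_curve par_graph"
proof -
  have "tropical_curve par_graph = tropical_curve graph" by (rule curve_cong) simp_all
  then show ?thesis using tropical_curve_graph by simp
qed

lemma ray_cases:
  assumes L: "L \<in> rays graph"
  obtains k where "k < N" "lth k = \<infinity>" "Inr k \<in> L" "ray_dirs L = {dir k}"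
proof -
  obtain e where e: "e \<in> edges graph" "len graph e = \<infinity>" "chart graph e \<infinity> \<in> L"
    "\<forall>e'\<in>edges graph. len graph e' = \<infinity> \<longrightarrow> chart graph e' \<infinity> \<in> L \<longrightarrow> e' = e"
    by (rule raysE[OF tropical_curve_graph L])
  have "{k. k < N \<and> lth k = \<infinity> \<and> Inr k \<in> L} = {e}"
  proof (intro equalityI subsetI)
    fix k assume "k \<in> {k. k < N \<and> lth k = \<infinity> \<and> Inr k \<in> L}"
    then have "k = e" using e(4)[rule_format, of k] by simp
    then show "k \<in> {e}" by simp
  next
    fix k assume "k \<in> {e}"
    then show "k \<in> {k. k < N \<and> lth k = \<infinity> \<and> Inr k \<in> L}" using e(1-3) by simp
  qed
  then have "ray_dirs L = {dir e}" unfolding ray_dirs_def by simp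
  then show thesis using that[of e] e(1-3) by simp
qed

lemma tropical_curve_par_par_graph: "tropical_curve_par par_graph"
  unfolding tropical_curve_par_def rays_par_graph
proof (intro conjI ballI impI)
  show "tropical_curve par_graph" by (rule tropical_curve_par_graph)
  show "equiv (rays graph) (parallel par_graph)" by (rule equivI) (auto simp: refl_on_def sym_def trans_def)
  fix L1 L2 assume L: "L1 \<in> rays graph" "L2 \<in> rays graph" "L1 \<subseteq> L2"
  obtain j where j: "j < N" "lth j = \<infinity>" "Inr j \<in> L1" "ray_dirs L1 = {dir j}" by (rule ray_cases[OF L(1)])
  obtain k where k: "k < N" "lth k = \<infinity>" "Inr k \<in> L2" "ray_dirs L2 = {dir k}" by (rule ray_cases[OF L(2)])
  have "dir j \<in> ray_dirs L2" using j(1-3) L(3) unfolding ray_dirs_def by blast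
  then show "(L1, L2) \<in> parallel par_graph" using L j(4) k(4) by simp
qed

lemma edge_in_rays:
  assumes k: "k < N" "lth k = \<infinity>"
  shows "the_chart k ` {0..\<infinity>} \<in> rays graph" "Inr k \<in> the_chart k ` {0..\<infinity>}" "ray_dirs (the_chart k ` {0..\<infinity>}) = {dir k}"
proof -
  have "model_of graph graph" unfolding model_of_def using tropical_curve_graph subdivides_refl[OF tropical_curve_graph] by blast
  then show "the_chart k ` {0..\<infinity>} \<in> rays graph" unfolding rays_def using k by (intro CollectI exI[of _ graph] exI[of _ k]) simp_all
  show "Inr k \<in> the_chart k ` {0..\<infinity>}" by (rule image_eqI[of _ _ \<infinity>]) simp_all
  have "j = k" if "Inr j \<in> the_chart k ` {0..\<infinity>}" for j
    using that by (auto simp: the_chart_def split: if_splits)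
  then show "ray_dirs (the_chart k ` {0..\<infinity>}) = {dir k}"
    using k \<open>Inr k \<in> the_chart k ` {0..\<infinity>}\<close> by (intro equalityI subsetI) (auto simp only: ray_dirs_def mem_Collect_eq singleton_iff image_iff)
qed

end

section \<open>Restriction of rational functions to the embedded curve\<close>

context embedded_graph
begin

lemma V_base: "k < N \<Longrightarrow> t \<in> dom_upto (lth k) \<Longrightarrow> base k + t *\<^sub>R rvec (dir k) \<in> V"
  using seg_subset_V[of k] unfolding seg_def by blast

text \<open>Restriction to the curve. The choice is determined, since values at finite points fix
  those at infinity.\<close>

definition ext :: "(real^'n \<Rightarrow> ereal) \<Rightarrow> real^'n + nat \<Rightarrow> ereal" where
  "ext F = (SOME k. k \<in> Rat_carrier par_graph \<and> (\<forall>x\<in>V. k (Inl x) = F x))"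

text \<open>The value \<open>0\<close> at \<open>Inr\<close> is a dummy that finite parameters never
  reach.\<close>

lemma curve_PL_par_graph:
  assumes h: "h \<in> PL"
  shows "curve_PL par_graph (\<lambda>y. case y of Inl x \<Rightarrow> h x | Inr _ \<Rightarrow> 0)"
  unfolding curve_PL_def
proof (intro ballI conjI)
  fix k
  have eq: "(case chart par_graph k (ereal t) of Inl x \<Rightarrow> h x | Inr _ \<Rightarrow> 0) = h (base k + t *\<^sub>R rvec (dir k))" for t
    by simp
  show "pw_int_affine (len par_graph k) (\<lambda>t. case chart par_graph k (ereal t) of Inl x \<Rightarrow> h x | Inr _ \<Rightarrow> 0)"
    unfolding eq by (rule PL_along_line[OF h])
  show "continuous_on (dom_upto (len par_graph k)) (\<lambda>t. case chart par_graph k (ereal t) of Inl x \<Rightarrow> h x | Inr _ \<Rightarrow> 0)"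
    unfolding eq by (intro continuous_on_compose2[OF PL_continuous[OF h, of UNIV]] continuous_intros) auto
qed

lemma Rat_par_graph_eqI:
  assumes "f \<in> Rat_carrier par_graph" "g \<in> Rat_carrier par_graph" "\<And>x. x \<in> V \<Longrightarrow> f (Inl x) = g (Inl x)"
  shows "f = g"
  by (rule Rat_carrier_eqI[OF tropical_curve_par_graph assms(1,2)]) (use assms(3) in \<open>auto simp: finite_points_par_graph\<close>)

lemma ext:
  assumes F: "F \<in> carrier trop_rational"
  shows "ext F \<in> Rat_carrier par_graph" "x \<in> V \<Longrightarrow> ext F (Inl x) = F x"
proof -
  have "\<exists>k. k \<in> Rat_carrier par_graph \<and> (\<forall>x\<in>V. k (Inl x) = F x)"
  proof (cases rule: trop_rational_cases[OF F])
    case 1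
    have "curve_const par_graph (-\<infinity>) (Inl x) = F x" if "x \<in> V" for x
      using 1 curve_const_finite[of "Inl x" par_graph "-\<infinity>"] that finite_points_par_graph by simp
    then show ?thesis using zero_in_Rat_carrier by blast
  next
    case (2 h)
    obtain k where k: "k \<in> Rat_carrier par_graph"
      "\<And>y. y \<in> finite_points par_graph \<Longrightarrow> k y = ereal (case y of Inl x \<Rightarrow> h x | Inr _ \<Rightarrow> 0)"
      using Rat_carrier_extension[OF tropical_curve_par_graph curve_PL_par_graph[OF 2(1)]] by auto
    have "k (Inl x) = F x" if "x \<in> V" for x using k(2)[of "Inl x"] that 2(2) finite_points_par_graph by simp
    then show ?thesis using k(1) by blast
  qed
  then have "ext F \<in> Rat_carrier par_graph \<and> (\<forall>x\<in>V. ext F (Inl x) = F x)" unfolding ext_def by (rule someI_ex)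
  then show "ext F \<in> Rat_carrier par_graph" "x \<in> V \<Longrightarrow> ext F (Inl x) = F x" by simp_all
qed

text \<open>\<open>PL_slope_at_infinity\<close> gives one slope for each direction, and parallel
  rays of \<open>par_graph\<close> have the same direction.\<close>

lemma ext_in_Rat_par:
  assumes F: "F \<in> carrier trop_rational"
  shows "ext F \<in> carrier (Rat_par par_graph)"
proof (cases rule: trop_rational_cases[OF F])
  case 1
  have "ext F = curve_const par_graph (-\<infinity>)"
  proof (rule Rat_par_graph_eqI[OF ext(1)[OF F] zero_in_Rat_carrier])
    fix x assume "x \<in> V"
    then show "ext F (Inl x) = curve_const par_graph (-\<infinity>) (Inl x)"
      using 1 ext(2)[OF F] curve_const_finite[of "Inl x" par_graph "-\<infinity>"] finite_points_par_graph by simp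
  qed
  then show ?thesis using zero_in_Rat_carrier unfolding Rat_par_def by simp
next
  case (2 h)
  have "\<exists>m. slope_at_infinity par_graph (ext F) L1 m \<and> slope_at_infinity par_graph (ext F) L2 m"
    if L: "L1 \<in> rays graph" "L2 \<in> rays graph" "ray_dirs L1 = ray_dirs L2" for L1 L2
  proof -
    obtain j where j: "j < N" "lth j = \<infinity>" "Inr j \<in> L1" "ray_dirs L1 = {dir j}" by (rule ray_cases[OF L(1)])
    obtain k where k: "k < N" "lth k = \<infinity>" "Inr k \<in> L2" "ray_dirs L2 = {dir k}" by (rule ray_cases[OF L(2)])
    have dir: "dir k = dir j" using L(3) j(4) k(4) by simp
    obtain m where m: "\<And>p. \<exists>c. \<forall>\<^sub>F t in at_top. h (p + t *\<^sub>R rvec (dir j)) = real_of_int m * t + c"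
      using PL_slope_at_infinity[OF 2(1), of "dir j"] by blast
    have slope: "slope_at_infinity par_graph (ext F) L m"
      if i: "i < N" "lth i = \<infinity>" "Inr i \<in> L" "dir i = dir j" and L: "L \<in> rays graph" for i L
    proof -
      obtain c where c: "\<forall>\<^sub>F t in at_top. h (base i + t *\<^sub>R rvec (dir j)) = real_of_int m * t + c" using m by blast
      have "\<forall>\<^sub>F t in at_top. ext F (chart par_graph i (ereal t)) = ereal (real_of_int m * t + c)"
        using c eventually_ge_at_top[of 0]
      proof eventually_elim
        case (elim t)
        have "base i + t *\<^sub>R rvec (dir i) \<in> V" using V_base[OF i(1), of t] i(2) elim(2) by (simp add: dom_upto_def)
        then show ?case using ext(2)[OF F] elim(1) i(4) 2(2) by simp
      qed
      then show ?thesis by (intro slope_at_infinityI[OF tropical_curve_par_graph, of L i]) (use i L rays_par_graph in simp_all)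
    qed
    show ?thesis using slope[OF j(1-3) refl L(1)] slope[OF k(1-3) dir L(2)] by blast
  qed
  then show ?thesis using ext(1)[OF F] unfolding Rat_par_def by auto
qed

lemma ext_hom: "ext \<in> talg_hom trop_rational (Rat_par par_graph)"
proof (rule talg_homI)
  show "ext F \<in> carrier (Rat_par par_graph)" if "F \<in> carrier trop_rational" for F by (rule ext_in_Rat_par[OF that])
next
  fix F G :: "real^'n \<Rightarrow> ereal" assume FG: "F \<in> carrier trop_rational" "G \<in> carrier trop_rational"
  have x: "Inl x \<in> finite_points par_graph" if "x \<in> V" for x using that finite_points_par_graph by simp
  have "ext (\<lambda>x. F x + G x) = ext F \<otimes>\<^bsub>Rat par_graph\<^esub> ext G"
  proof (rule Rat_par_graph_eqI)
    show "ext (\<lambda>x. F x + G x) \<in> Rat_carrier par_graph" by (rule ext(1)[OF trop_rational_mult_closed[OF FG]])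
    show "ext F \<otimes>\<^bsub>Rat par_graph\<^esub> ext G \<in> Rat_carrier par_graph" by (rule Rat_mult(1)[OF tropical_curve_par_graph ext(1)[OF FG(1)] ext(1)[OF FG(2)]])
    show "ext (\<lambda>x. F x + G x) (Inl x) = (ext F \<otimes>\<^bsub>Rat par_graph\<^esub> ext G) (Inl x)" if "x \<in> V" for x
      unfolding Rat_mult(2)[OF tropical_curve_par_graph ext(1)[OF FG(1)] ext(1)[OF FG(2)] x[OF that]]
      by (simp only: ext(2)[OF trop_rational_mult_closed[OF FG] that] ext(2)[OF FG(1) that] ext(2)[OF FG(2) that])
  qed
  then show "ext (F \<otimes>\<^bsub>trop_rational\<^esub> G) = ext F \<otimes>\<^bsub>Rat_par par_graph\<^esub> ext G" by (simp del: Rat_simps)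
  have "ext (\<lambda>x. max (F x) (G x)) = ext F \<oplus>\<^bsub>Rat par_graph\<^esub> ext G"
  proof (rule Rat_par_graph_eqI)
    show "ext (\<lambda>x. max (F x) (G x)) \<in> Rat_carrier par_graph" by (rule ext(1)[OF trop_rational_add_closed[OF FG]])
    show "ext F \<oplus>\<^bsub>Rat par_graph\<^esub> ext G \<in> Rat_carrier par_graph" by (rule Rat_add(1)[OF tropical_curve_par_graph ext(1)[OF FG(1)] ext(1)[OF FG(2)]])
    show "ext (\<lambda>x. max (F x) (G x)) (Inl x) = (ext F \<oplus>\<^bsub>Rat par_graph\<^esub> ext G) (Inl x)" if "x \<in> V" for x
      unfolding Rat_add(2)[OF tropical_curve_par_graph ext(1)[OF FG(1)] ext(1)[OF FG(2)] x[OF that]]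
      by (simp only: ext(2)[OF trop_rational_add_closed[OF FG] that] ext(2)[OF FG(1) that] ext(2)[OF FG(2) that])
  qed
  then show "ext (F \<oplus>\<^bsub>trop_rational\<^esub> G) = ext F \<oplus>\<^bsub>Rat_par par_graph\<^esub> ext G" by (simp del: Rat_simps)
next
  have const: "ext (\<lambda>x. a) = curve_const par_graph a" if "a \<noteq> \<infinity>" for a
  proof (rule Rat_par_graph_eqI)
    have c: "(\<lambda>x. a) \<in> carrier trop_rational" by (rule trop_rational_const[OF that])
    show "ext (\<lambda>x. a) \<in> Rat_carrier par_graph" by (rule ext(1)[OF c])
    show "ext (\<lambda>x. a) (Inl x) = curve_const par_graph a (Inl x)" if "x \<in> V" for x
      using ext(2)[OF c that] curve_const_finite[of "Inl x" par_graph a] that finite_points_par_graph by simp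
    show "curve_const par_graph a \<in> Rat_carrier par_graph"
    proof (cases "a = -\<infinity>")
      case True
      then show ?thesis using zero_in_Rat_carrier by simp
    next
      case False
      then obtain r where r: "a = ereal r" using \<open>a \<noteq> \<infinity>\<close> by (cases a) auto
      have "curve_const par_graph a \<in> extensional (curve_points par_graph)" "continuous_map (curve_topology par_graph) euclidean (curve_const par_graph a)"
        by (rule curve_const_extensional curve_const_continuous)+
      moreover have "\<forall>x\<in>finite_points par_graph. \<bar>curve_const par_graph a x\<bar> \<noteq> \<infinity>" using r by (simp add: curve_const_finite)
      moreover have "pw_integral_affine (len par_graph e) (\<lambda>t. curve_const par_graph a (chart par_graph e t))" if e: "e \<in> edges par_graph" for e
      proof (subst pw_integral_affine_iff)
        show "pw_int_affine (len par_graph e) (\<lambda>t. r)" by (rule pw_int_affine_const)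
        show "curve_const par_graph a (chart par_graph e (ereal t)) = ereal r" if "t \<in> dom_upto (len par_graph e)" for t
          using curve_const_finite[OF chart_finite_point[OF tropical_curve_par_graph e that]] r by simp
      qed
      ultimately show ?thesis unfolding Rat_carrier_def by blast
    qed
  qed
  show "ext \<one>\<^bsub>trop_rational\<^esub> = \<one>\<^bsub>Rat_par par_graph\<^esub>" "ext \<zero>\<^bsub>trop_rational\<^esub> = \<zero>\<^bsub>Rat_par par_graph\<^esub>"
    by (simp_all add: const)
  show "ext (struct_map trop_rational a) = struct_map (Rat_par par_graph) a" if "a \<noteq> \<infinity>" for a
    using const[OF that] by simp
qed

lemma Ker_ext: "Ker trop_rational ext = E_of V"
proof -
  have "ext F = ext G \<longleftrightarrow> (\<forall>x\<in>V. F x = G x)" if FG: "F \<in> carrier trop_rational" "G \<in> carrier trop_rational" for F G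
  proof
    assume eq: "ext F = ext G"
    show "\<forall>x\<in>V. F x = G x"
    proof
      fix x assume x: "x \<in> V"
      show "F x = G x" using ext(2)[OF FG(1) x] ext(2)[OF FG(2) x] eq by simp
    qed
  next
    assume "\<forall>x\<in>V. F x = G x"
    then show "ext F = ext G"
      by (intro Rat_par_graph_eqI ext(1) FG) (simp add: ext(2)[OF FG(1)] ext(2)[OF FG(2)])
  qed
  then show ?thesis unfolding Ker_def E_of_def by auto
qed

text \<open>The function is cut into affine parts along the edges and handed to
  \<open>PL_extension\<close>; membership in \<open>Rat_par par_graph\<close> supplies the
  hypothesis on rays of equal direction.\<close>

lemma ext_surj:
  assumes g: "g \<in> carrier (Rat_par par_graph)"
  obtains F where "F \<in> carrier trop_rational" "ext F = g"
proof (cases "g = curve_const par_graph (-\<infinity>)")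
  case True
  have "ext (\<lambda>x. -\<infinity>) = g" using talg_homD(5)[OF ext_hom] True by simp
  then show thesis using that trop_rational_const[of "-\<infinity>"] by simp
next
  case False
  have gR: "g \<in> Rat_carrier par_graph" using g Rat_par_carrier_subset by blast
  define h where "h x = real_of_ereal (g (Inl x))" for x
  have gh: "g (Inl x) = ereal (h x)" if "x \<in> V" for x
    unfolding h_def using Rat_carrier_finite_value[OF gR False, of "Inl x"] that finite_points_par_graph by simp
  have PLg: "curve_PL par_graph (\<lambda>x. real_of_ereal (g x))" by (rule Rat_carrier_curve_PL[OF tropical_curve_par_graph gR False])
  define hk where "hk k t = h (base k + t *\<^sub>R rvec (dir k))" for k t
  have hk: "continuous_on (dom_upto (lth k)) (hk k)" "pw_int_affine (lth k) (hk k)" if "k < N" for k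
    using curve_PL_D[OF PLg, of k] that unfolding hk_def h_def by simp_all
  have "\<exists>C :: (real \<times> ereal) set. finite C \<and> (\<forall>(a, S)\<in>C. 0 \<le> a \<and> 0 \<le> S \<and> ereal a + S \<le> lth k \<and>
      (\<exists>(m::int) c. \<forall>t\<in>dom_upto S. hk k (a + t) = real_of_int m * t + c)) \<and>
    (\<forall>t\<in>dom_upto (lth k). \<exists>(a, S)\<in>C. a \<le> t \<and> ereal (t - a) \<le> S)" if k: "k < N" for k
  proof (rule pw_int_affine_closed_cover[of "{hk k}" "lth k"])
    show "finite {hk k}" by simp
    show "pw_int_affine (lth k) h'" "continuous_on (dom_upto (lth k)) h'" if "h' \<in> {hk k}" for h'
      using that hk[OF k] by simp_all
    fix C :: "(real \<times> ereal) set"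
    assume C: "finite C" "\<And>a S. (a, S) \<in> C \<Longrightarrow> 0 \<le> a \<and> 0 \<le> S \<and> ereal a + S \<le> lth k"
      "\<And>a S h. (a, S) \<in> C \<Longrightarrow> h \<in> {hk k} \<Longrightarrow> \<exists>(m::int) c. \<forall>t\<in>dom_upto S. h (a + t) = real_of_int m * t + c"
      "\<And>t. t \<in> dom_upto (lth k) \<Longrightarrow> \<exists>(a, S)\<in>C. a \<le> t \<and> ereal (t - a) \<le> S"
    have "\<forall>(a, S)\<in>C. 0 \<le> a \<and> 0 \<le> S \<and> ereal a + S \<le> lth k \<and>
      (\<exists>(m::int) c. \<forall>t\<in>dom_upto S. hk k (a + t) = real_of_int m * t + c)"
    proof (rule ballI, rule case_prodI2)
      fix r a S assume r: "r \<in> C" "r = (a, S)"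
      then show "0 \<le> a \<and> 0 \<le> S \<and> ereal a + S \<le> lth k \<and>
        (\<exists>(m::int) c. \<forall>t\<in>dom_upto S. hk k (a + t) = real_of_int m * t + c)"
        using C(2)[of a S] C(3)[of a S "hk k", OF _ singletonI] by simp
    qed
    moreover have "\<forall>t\<in>dom_upto (lth k). \<exists>(a, S)\<in>C. a \<le> t \<and> ereal (t - a) \<le> S" using C(4) by (intro ballI)
    ultimately show ?thesis using C(1) by (intro exI[of _ C] conjI)
  qed
  then have "\<forall>k\<in>{..<N}. \<exists>C :: (real \<times> ereal) set. finite C \<and> (\<forall>(a, S)\<in>C. 0 \<le> a \<and> 0 \<le> S \<and> ereal a + S \<le> lth k \<and>
      (\<exists>(m::int) c. \<forall>t\<in>dom_upto S. hk k (a + t) = real_of_int m * t + c)) \<and>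
    (\<forall>t\<in>dom_upto (lth k). \<exists>(a, S)\<in>C. a \<le> t \<and> ereal (t - a) \<le> S)" by simp
  from bchoice[OF this] obtain C where C: "\<forall>k\<in>{..<N}. finite (C k) \<and> (\<forall>(a, S)\<in>C k. 0 \<le> a \<and> 0 \<le> S \<and> ereal a + S \<le> lth k \<and>
      (\<exists>(m::int) c. \<forall>t\<in>dom_upto S. hk k (a + t) = real_of_int m * t + c)) \<and>
    (\<forall>t\<in>dom_upto (lth k). \<exists>(a, S)\<in>C k. a \<le> t \<and> ereal (t - a) \<le> S)" by (elim exE)
  have Cfin: "finite (C k)" if "k < N" for k using C that by simp
  have Cprop: "0 \<le> a" "0 \<le> S" "ereal a + S \<le> lth k" "\<exists>(m::int) c. \<forall>t\<in>dom_upto S. hk k (a + t) = real_of_int m * t + c"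
    if "k < N" "(a, S) \<in> C k" for k a S
    using bspec[OF C, of k] that by auto
  have Ccover: "\<exists>a S. (a, S) \<in> C k \<and> a \<le> t \<and> ereal (t - a) \<le> S" if "k < N" "t \<in> dom_upto (lth k)" for k t
    using bspec[OF C, of k] that by blast
  \<comment> \<open>Vertices enter as pieces of length \<open>0\<close>, with an arbitrary
    direction; this also covers a graph that is a single point.\<close>
  define D1 where "D1 = (\<lambda>w. (w, axis undefined 1 :: int^'n, 0 :: ereal)) ` W"
  define D2 where "D2 = (\<Union>k<N. (\<lambda>(a, S). (base k + a *\<^sub>R rvec (dir k), dir k, S)) ` C k)"
  have D2E: "\<exists>k a. k < N \<and> (a, T) \<in> C k \<and> p = base k + a *\<^sub>R rvec (dir k) \<and> u = dir k" if "(p, u, T) \<in> D2" for p u T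
    using that unfolding D2_def by auto
  have pieces: "pieces (D1 \<union> D2)"
    unfolding pieces_def
  proof (intro conjI)
    show "finite (D1 \<union> D2)" using finW Cfin unfolding D1_def D2_def by simp
    show "D1 \<union> D2 \<noteq> {}" using neW unfolding D1_def by simp
    show "\<forall>(p, u, T)\<in>D1 \<union> D2. primitive u \<and> 0 \<le> T"
    proof (rule ballI, rule case_prodI2, rule case_prodI2)
      fix A p v u T assume A: "A \<in> D1 \<union> D2" "A = (p, v)" "v = (u, T)"
      show "primitive u \<and> 0 \<le> T"
      proof (cases "A \<in> D1")
        case True
        then show ?thesis using A primitive_axis unfolding D1_def by auto
      next
        case False
        then have "(p, u, T) \<in> D2" using A by simp
        then obtain k a where "k < N" "(a, T) \<in> C k" "u = dir k" using D2E by blast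
        then show ?thesis using Cprop(2)[of k a T] free_segD(1)[OF free_seg_ds[of k]] by simp
      qed
    qed
  qed
  have affine: "\<exists>(m::int) c. \<forall>t\<in>dom_upto T. h (p + t *\<^sub>R rvec u) = real_of_int m * t + c" if "(p, u, T) \<in> D1 \<union> D2" for p u T
  proof (cases "(p, u, T) \<in> D1")
    case True
    then have "T = 0" unfolding D1_def by auto
    then have "\<forall>t\<in>dom_upto T. h (p + t *\<^sub>R rvec u) = real_of_int 0 * t + h p" by (auto simp: dom_upto_def zero_ereal_def)
    then show ?thesis by (intro exI)
  next
    case False
    then have "(p, u, T) \<in> D2" using that by simp
    then obtain k a where k: "k < N" "(a, T) \<in> C k" "p = base k + a *\<^sub>R rvec (dir k)" "u = dir k" using D2E by blast
    have "p + t *\<^sub>R rvec u = base k + (a + t) *\<^sub>R rvec (dir k)" for t using k by (simp add: algebra_simps)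
    then show ?thesis using Cprop(4)[OF k(1,2)] unfolding hk_def by simp
  qed
  have "\<forall>A\<in>D1 \<union> D2. \<exists>mc. \<forall>t\<in>dom_upto (snd (snd A)). h (fst A + t *\<^sub>R rvec (fst (snd A))) = real_of_int (fst mc) * t + snd mc"
  proof
    fix A assume A: "A \<in> D1 \<union> D2"
    obtain p u T where puT: "A = (p, u, T)" by (cases A)
    obtain m c where "\<forall>t\<in>dom_upto T. h (p + t *\<^sub>R rvec u) = real_of_int m * t + c" using affine[of p u T] A puT by blast
    then show "\<exists>mc. \<forall>t\<in>dom_upto (snd (snd A)). h (fst A + t *\<^sub>R rvec (fst (snd A))) = real_of_int (fst mc) * t + snd mc"
      unfolding puT by (intro exI[of _ "(m, c)"]) simp
  qed
  from bchoice[OF this] obtain mc where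
    mc: "\<forall>A\<in>D1 \<union> D2. \<forall>t\<in>dom_upto (snd (snd A)). h (fst A + t *\<^sub>R rvec (fst (snd A))) = real_of_int (fst (mc A)) * t + snd (mc A)"
    by (elim exE)
  have slope: "\<forall>t\<in>dom_upto T. h (p + t *\<^sub>R rvec u) = real_of_int (fst (mc (p, u, T))) * t + snd (mc (p, u, T))"
    if "(p, u, T) \<in> D1 \<union> D2" for p u T
    using bspec[OF mc that] by simp
  \<comment> \<open>An affine part of infinite length is a terminal part of an infinite edge, so its
    slope is the slope of \<open>g\<close> at infinity along that edge.\<close>
  have ray: "\<exists>k c. k < N \<and> lth k = \<infinity> \<and> dir k = u \<and>
      (\<forall>\<^sub>F t in at_top. g (the_chart k (ereal t)) = ereal (real_of_int (fst (mc (p, u, \<infinity>))) * t + c))"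
    if A: "(p, u, \<infinity>) \<in> D1 \<union> D2" for p u
  proof -
    have "(p, u, \<infinity>) \<notin> D1" unfolding D1_def by auto
    then have "(p, u, \<infinity>) \<in> D2" using A by simp
    then obtain k a where k: "k < N" "(a, \<infinity>) \<in> C k" "p = base k + a *\<^sub>R rvec (dir k)" "u = dir k" using D2E by blast
    have inf: "lth k = \<infinity>" using Cprop(3)[OF k(1,2)] by simp
    define m where "m = fst (mc (p, u, \<infinity>))"
    define c where "c = snd (mc (p, u, \<infinity>))"
    have "g (the_chart k (ereal t)) = ereal (real_of_int m * t + (c - real_of_int m * a))" if t: "a \<le> t" for t
    proof -
      have "0 \<le> t" using t Cprop(1)[OF k(1,2)] by simp
      then have "base k + t *\<^sub>R rvec (dir k) \<in> V" using V_base[OF k(1), of t] inf by (simp add: dom_upto_def)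
      moreover have eq: "base k + t *\<^sub>R rvec (dir k) = p + (t - a) *\<^sub>R rvec u" using k by (simp add: algebra_simps)
      moreover have "h (p + (t - a) *\<^sub>R rvec u) = real_of_int m * (t - a) + c"
        using slope[OF A, rule_format, of "t - a"] t unfolding m_def c_def by (simp add: dom_upto_def)
      ultimately have "g (the_chart k (ereal t)) = ereal (real_of_int m * (t - a) + c)"
        unfolding chart_real eq using gh by simp
      then show ?thesis by (simp add: right_diff_distrib add_diff_eq diff_add_eq)
    qed
    then have "\<forall>\<^sub>F t in at_top. g (the_chart k (ereal t)) = ereal (real_of_int m * t + (c - real_of_int m * a))"
      by (rule eventually_at_top_linorderI)
    then show ?thesis using k(1,4) inf unfolding m_def by blast
  qed
  have parallel: "fst (mc (p, u, \<infinity>)) = fst (mc (q, u, \<infinity>))"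
    if A: "(p, u, \<infinity>) \<in> D1 \<union> D2" and B: "(q, u, \<infinity>) \<in> D1 \<union> D2" for p q u
  proof -
    obtain j c where j: "j < N" "lth j = \<infinity>" "dir j = u"
      "\<forall>\<^sub>F t in at_top. g (the_chart j (ereal t)) = ereal (real_of_int (fst (mc (p, u, \<infinity>))) * t + c)"
      using ray[OF A] by blast
    obtain k d where k: "k < N" "lth k = \<infinity>" "dir k = u"
      "\<forall>\<^sub>F t in at_top. g (the_chart k (ereal t)) = ereal (real_of_int (fst (mc (q, u, \<infinity>))) * t + d)"
      using ray[OF B] by blast
    let ?L = "\<lambda>k. the_chart k ` {0..\<infinity>}"
    \<comment> \<open>Parallelism is a relation between rays, so the two edges are viewed as rays of
      the given model.\<close>
    have "(?L j, ?L k) \<in> parallel par_graph"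
      using edge_in_rays[OF j(1,2)] edge_in_rays[OF k(1,2)] j(3) k(3) by simp
    moreover have "\<forall>(L1, L2)\<in>parallel par_graph. \<exists>m. slope_at_infinity par_graph g L1 m \<and> slope_at_infinity par_graph g L2 m"
      using g False unfolding Rat_par_def by simp
    ultimately obtain m where m: "slope_at_infinity par_graph g (?L j) m" "slope_at_infinity par_graph g (?L k) m" by blast
    have "m = fst (mc (p, u, \<infinity>))"
      by (rule slope_at_infinityD[OF tropical_curve_par_graph m(1), of j _ c]) (use j edge_in_rays[OF j(1,2)] in simp_all)
    moreover have "m = fst (mc (q, u, \<infinity>))"
      by (rule slope_at_infinityD[OF tropical_curve_par_graph m(2), of k _ d]) (use k edge_in_rays[OF k(1,2)] in simp_all)
    ultimately show ?thesis by simp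
  qed
  obtain F where F: "F \<in> PL" "\<And>x. x \<in> support (D1 \<union> D2) \<Longrightarrow> F x = h x"
    using PL_extension[OF pieces slope parallel] by blast
  have supp: "x \<in> support (D1 \<union> D2)" if x: "x \<in> V" for x
  proof (cases "x \<in> W")
    case True
    have "x \<in> seg x (axis undefined 1) 0" by (rule seg_start) simp
    moreover have "(x, axis undefined 1, 0) \<in> D1 \<union> D2" using True unfolding D1_def by simp
    ultimately show ?thesis unfolding support_def by blast
  next
    case False
    then obtain k where k: "k < N" "x \<in> open_seg (ds k)" using x unfolding mem_V by (elim disjE exE conjE) simp_all
    obtain t where t: "0 < t" "ereal t < lth k" "x = base k + t *\<^sub>R rvec (dir k)" using k(2) unfolding mem_open_seg_ds by (elim exE conjE)
    have "t \<in> dom_upto (lth k)" using t by (simp add: dom_upto_def)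
    then obtain a S where a: "(a, S) \<in> C k" "a \<le> t" "ereal (t - a) \<le> S" using Ccover[OF k(1)] by blast
    have "(base k + a *\<^sub>R rvec (dir k), dir k, S) \<in> D2"
      unfolding D2_def using k(1) a(1) by (intro UN_I[of k] image_eqI[of _ _ "(a, S)"]) simp_all
    moreover have "x \<in> seg (base k + a *\<^sub>R rvec (dir k)) (dir k) S"
      unfolding mem_seg using a t by (intro exI[of _ "t - a"]) (simp add: algebra_simps)
    ultimately show ?thesis unfolding support_def by blast
  qed
  have mem: "(\<lambda>x. ereal (F x)) \<in> carrier trop_rational" by (rule PL_in_carrier[OF F(1)])
  have "ext (\<lambda>x. ereal (F x)) = g"
    by (rule Rat_par_graph_eqI[OF ext(1)[OF mem] gR]) (simp add: ext(2)[OF mem] gh F(2)[OF supp])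
  then show thesis using that mem by blast
qed

lemma ext_image: "ext ` carrier trop_rational = carrier (Rat_par par_graph)"
proof
  show "ext ` carrier trop_rational \<subseteq> carrier (Rat_par par_graph)" using ext_in_Rat_par by blast
  show "carrier (Rat_par par_graph) \<subseteq> ext ` carrier trop_rational"
  proof
    fix g assume "g \<in> carrier (Rat_par par_graph)"
    then obtain F where "F \<in> carrier trop_rational" "ext F = g" by (rule ext_surj)
    then show "g \<in> ext ` carrier trop_rational" by blast
  qed
qed

lemma quotient_iso: "talg_iso (quotient_talg trop_rational (E_of V)) (Rat_par par_graph)"
proof -
  obtain h where "h \<in> talg_hom (quotient_talg trop_rational (Ker trop_rational ext)) (Rat_par par_graph)"
    "inj_on h (carrier (quotient_talg trop_rational (Ker trop_rational ext)))"
    "h ` carrier (quotient_talg trop_rational (Ker trop_rational ext)) = ext ` carrier trop_rational"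
    by (rule talg_closed.quotient_Ker_embedding[OF trop_rational_closed ext_hom])
  then show ?thesis unfolding talg_iso_def bij_betw_def Ker_ext ext_image by blast
qed

end

text \<open>Numbering the free segments of the decomposition turns it into an
  \<open>embedded_graph\<close> whose \<open>V\<close> is the support.\<close>

lemma quotient_E_of_support_iso:
  fixes D :: "('n::finite) piece set"
  assumes D: "pieces D" and conn: "connected (support D)"
  obtains \<Gamma> :: "(real^'n + nat) par_curve" where "tropical_curve_par \<Gamma>"
    "talg_iso (quotient_talg trop_rational (E_of (support D))) (Rat_par \<Gamma>)"
proof (rule support_decomposition[OF D])
  fix W :: "(real^'n) set" and D' :: "'n piece set"
  assume W: "finite W" "W \<noteq> {}" and D': "finite D'" "\<And>A. A \<in> D' \<Longrightarrow> free_seg W A"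
    "\<And>A B. A \<in> D' \<Longrightarrow> B \<in> D' \<Longrightarrow> A \<noteq> B \<Longrightarrow> open_seg A \<inter> open_seg B = {}"
    and supp: "support D = W \<union> \<Union>(open_seg ` D')"
  obtain ds where ds: "bij_betw ds {0..<card D'} D'" using ex_bij_betw_nat_finite[OF D'(1)] by blast
  have mem: "ds k \<in> D'" if "k < card D'" for k using ds that by (auto simp: bij_betw_def)
  have img: "ds ` {..<card D'} = D'" using ds by (simp add: bij_betw_def lessThan_atLeast0)
  then have supp': "support D = W \<union> (\<Union>k<card D'. open_seg (ds k))" using supp by (metis image_image)
  have graph: "embedded_graph W ds (card D')"
  proof
    show "open_seg (ds j) \<inter> open_seg (ds k) = {}" if "j < card D'" "k < card D'" "j \<noteq> k" for j k
    proof (rule D'(3)[OF mem[OF that(1)] mem[OF that(2)]])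
      show "ds j \<noteq> ds k" using ds that by (auto simp: bij_betw_def inj_on_def)
    qed
    show "connected (W \<union> (\<Union>k<card D'. open_seg (ds k)))" using conn supp' by simp
  qed (use W D'(2) mem in simp_all)
  have "embedded_graph.V W ds (card D') = support D" unfolding embedded_graph.V_def[OF graph] supp' ..
  then show thesis using that[OF embedded_graph.tropical_curve_par_par_graph[OF graph]] embedded_graph.quotient_iso[OF graph] by simp
qed

theorem corollary4p12:
  fixes \<Gamma> :: "'p par_curve"
    and f :: "'n::finite \<Rightarrow> 'p \<Rightarrow> ereal"
    and \<psi> :: "(real^'n \<Rightarrow> ereal) \<Rightarrow> ('p \<Rightarrow> ereal)"
  assumes "tropical_curve_par \<Gamma>"
    and "\<And>i. f i \<in> carrier (Rat_par \<Gamma>) - {\<zero>\<^bsub>Rat_par \<Gamma>\<^esub>}"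
    and "\<psi> \<in> talg_hom trop_rational (Rat_par \<Gamma>)"
    and "\<And>i. \<psi> (coord i) = f i"
  defines "Q \<equiv> quotient_talg trop_rational (Ker trop_rational \<psi>)"
  shows "talg_iso (generated_T_semifield (Rat_par \<Gamma>) (range f)) Q \<and>
    (\<exists>\<Gamma>' :: ((real^'n) + nat) par_curve. tropical_curve_par \<Gamma>' \<and> talg_iso Q (Rat_par \<Gamma>')) \<and>
    (\<exists>\<phi> :: (real^'n \<Rightarrow> ereal) \<Rightarrow> (real^'n \<Rightarrow> ereal) set.
        \<phi> \<in> talg_hom trop_rational Q \<and> \<phi> ` carrier trop_rational = carrier Q \<and>
        curve_congruence (Ker trop_rational \<phi>)) \<and>
    (\<forall>\<phi> :: (real^'m::finite \<Rightarrow> ereal) \<Rightarrow> (real^'n \<Rightarrow> ereal) set.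
        \<phi> \<in> talg_hom trop_rational Q \<and> \<phi> ` carrier trop_rational = carrier Q \<longrightarrow>
        curve_congruence (Ker trop_rational \<phi>)) \<and>
    V_of (Ker trop_rational \<psi>) = (\<lambda>x. \<chi> i. real_of_ereal (f i x)) ` finite_points \<Gamma>"
proof -
  have G: "tropical_curve \<Gamma>" using assms(1) unfolding tropical_curve_par_def by simp
  have hom: "\<psi> \<in> talg_hom trop_rational (Rat \<Gamma>)" by (rule talg_hom_Rat_par[OF assms(3)])
  have f: "(\<lambda>i. \<psi> (coord i)) = f" using assms(4) by blast
  have E: "congruence trop_rational (Ker trop_rational \<psi>)"
    unfolding Ker_trop_rational_hom[OF G hom] by (rule congruence_E_of)
  obtain D where D: "pieces D" "support D = eval_map \<psi> ` finite_points \<Gamma>" "connected (support D)"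
    by (rule trop_rational_hom_image_pieces[OF G hom])
  have KD: "Ker trop_rational \<psi> = E_of (support D)" using Ker_trop_rational_hom[OF G hom] D(2) by simp
  have "talg_iso (generated_T_semifield (Rat_par \<Gamma>) (range f)) Q"
    using generated_iso_quotient[OF G assms(3)] unfolding f Q_def .
  moreover obtain \<Gamma>' :: "((real^'n) + nat) par_curve" where "tropical_curve_par \<Gamma>'" "talg_iso Q (Rat_par \<Gamma>')"
    unfolding Q_def KD by (rule quotient_E_of_support_iso[OF D(1,3)])
  \<comment> \<open>The projection is one surjection of the required kind; its kernel is
    \<open>Ker trop_rational \<psi>\<close>.\<close>
  moreover have "(\<lambda>x. Ker trop_rational \<psi> `` {x}) \<in> talg_hom trop_rational Q"
    "(\<lambda>x. Ker trop_rational \<psi> `` {x}) ` carrier trop_rational = carrier Q"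
    "curve_congruence (Ker trop_rational (\<lambda>x. Ker trop_rational \<psi> `` {x}))"
    using quotient_talg_proj[OF E] curve_congruence_Ker(1)[OF G hom] unfolding Q_def by simp_all
  moreover have "curve_congruence (Ker trop_rational \<phi>)"
    if "\<phi> \<in> talg_hom trop_rational Q" for \<phi> :: "(real^'m \<Rightarrow> ereal) \<Rightarrow> (real^'n \<Rightarrow> ereal) set"
    using that unfolding Q_def by (rule curve_congruence_surjection[OF G assms(3)])
  moreover have "V_of (Ker trop_rational \<psi>) = (\<lambda>x. \<chi> i. real_of_ereal (f i x)) ` finite_points \<Gamma>"
    using curve_congruence_Ker(2)[OF G hom] assms(4) unfolding eval_map_def by simp
  ultimately show ?thesis by blast
qed

end
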